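(* Let $q>1/2$, $s>0$. For any $\star$-Bryuno vector $\omega\in\ell^{q,\infty}(\mathbb R)$ and any $f\in\mathscr H_\star^{2s}(\mathbb T^{\mathbb Z},\mathbb R)$, there exists $\varepsilon_1=\varepsilon_1(s,\omega,\|f\|_{2s,\star,\mathbb R})>0$ such that for all $\varepsilon\in(-\varepsilon_1,\varepsilon_1)$ there exists a solution $u\in\mathscr H_\star^{s}(\mathbb T^{\mathbb Z},\ell^\infty(\mathbb R))$ to $$(\omega\cdot\partial_\varphi)^2u=-\varepsilon\,\partial_\theta f(\varphi+u)$$ such that $\|u\|_{s,\star,\ell^\infty(\mathbb R)}\to0$ as $\varepsilon\to0$.
   Context: Notation: $\langle j\rangle=\max\{1,|j|\}$; $\|\cdot\|_1$ is the $\ell^1$ norm; $a\cdot b=\sum_{j\in\mathbb Z}a_jb_j$. $\mathbb Z^{\mathbb Z}_f=\{\nu\in\mathbb Z^{\mathbb Z}:\|\nu\|_1<\infty\}$. $\star$-norm: $|\nu|_\star=\sum_{j\in\mathbb Z}h_j|\nu_j|$ for $\nu\in\mathbb Z^{\mathbb Z}_f$, where the fixed weights $h_j$ are positive reals with $h_{-j}=h_j$, $h_{j+1}\ge h_j$ for $j\ge0$, and $h_j\to+\infty$ as $j\to+\infty$. $\mathbb T^{\mathbb Z}=\{\theta=\{\theta_j\}_{j\in\mathbb Z}:\theta_j\in\mathbb R/2\pi\mathbb Z\}$ with metric $\mathrm{dist}(\theta,\theta')=\sup_j\inf_{k\in\mathbb Z}|\theta_j-\theta_j'-2\pi k|$.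 For a Banach space $(X,|\cdot|_X)$ and $\mathfrak s>0$, $\mathscr H_\star^{\mathfrak s}(\mathbb T^{\mathbb Z},X)$ is the set of $u:\mathbb T^{\mathbb Z}\to X$ of the form $u(\varphi)=\sum_{\nu\in\mathbb Z^{\mathbb Z}_f}e^{\mathrm i\nu\cdot\varphi}u_\nu$ with $\|u\|_{\mathfrak s,\star,X}:=\sum_\nu|u_\nu|_Xe^{\mathfrak s|\nu|_\star}<\infty$ (for real $X$ the coefficients lie in the complexification and $u_{-\nu}=\overline{u_\nu}$). For $f\in\mathscr H_\star^{\mathfrak s}(\mathbb T^{\mathbb Z},\mathbb R)$, $\partial_\theta f=\{\partial_{\theta_j}f\}_{j\in\mathbb Z}=\sum_\nu \mathrm i\nu f_\nu e^{\mathrm i\nu\cdot\theta}$. $(\omega\cdot\partial_\varphi)u=\sum_\nu\mathrm i(\omega\cdot\nu)u_\nu e^{\mathrm i\nu\cdot\varphi}$. $\ell^{q,\infty}(\mathbb R)=\{I=\{I_j\}_{j\in\mathbb Z}: I_j\in\mathbb R,\ \sup_j|I_j|\langle j\rangle^q<\infty\}$. $\star$-Bryuno vectors: for $\omega\in\mathbb R^{\mathbb Z}$ set $\beta^\star_\omega(m)=\inf\{|\omega\cdot\nu|:\nu\in\mathbb Z^{\mathbb Z}_f,\ 0<|\nu|_\star\le2^m\}$ and $\mathcal B^\star(\omega)=\sum_{m\ge1}2^{-m}\log(1/\beta^\star_\omega(m))$ (the finitely many terms, if any, with empty index set are disregarded); $\omega$ is a $\star$-Bryuno vector if $\mathcal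 B^\star(\omega)<+\infty$. *)

theory Defs
  imports "HOL-Analysis.Analysis" "HOL-Library.Poly_Mapping"
begin

section \<open>Finitely supported integer vectors and the star-norm\<close>

type_synonym freq = "int \<Rightarrow>\<^sub>0 int"

text \<open>The integer sequences of finite l1-norm are exactly the finitely supported ones,
  i.e. the elements of the library type \<^typ>\<open>int \<Rightarrow>\<^sub>0 int\<close>.\<close>

lemma range_lookup_eq_finite_l1:
  "range (Poly_Mapping.lookup :: freq \<Rightarrow> int \<Rightarrow> int)
     = {\<nu>. (\<lambda>j. \<bar>real_of_int (\<nu> j)\<bar>) summable_on UNIV}"
proof (intro equalityI subsetI)
  fix \<nu> :: "int \<Rightarrow> int"
  assume "\<nu> \<in> range (Poly_Mapping.lookup :: freq \<Rightarrow> int \<Rightarrow> int)"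
  then have "finite {j. \<nu> j \<noteq> 0}" by auto
  then have "(\<lambda>j. \<bar>real_of_int (\<nu> j)\<bar>) summable_on {j. \<nu> j \<noteq> 0}"
    by (rule summable_on_finite)
  moreover have "(\<lambda>j. \<bar>real_of_int (\<nu> j)\<bar>) summable_on {j. \<nu> j \<noteq> 0}
      \<longleftrightarrow> (\<lambda>j. \<bar>real_of_int (\<nu> j)\<bar>) summable_on UNIV"
    by (rule summable_on_cong_neutral) auto
  ultimately show "\<nu> \<in> {\<nu>. (\<lambda>j. \<bar>real_of_int (\<nu> j)\<bar>) summable_on UNIV}" by simp
next
  fix \<nu> :: "int \<Rightarrow> int"
  assume "\<nu> \<in> {\<nu>. (\<lambda>j. \<bar>real_of_int (\<nu> j)\<bar>) summable_on UNIV}"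
  then have S: "(\<lambda>j. \<bar>real_of_int (\<nu> j)\<bar>) summable_on UNIV" by simp
  define L where "L = infsum (\<lambda>j. \<bar>real_of_int (\<nu> j)\<bar>) UNIV"
  have "finite {j. \<nu> j \<noteq> 0}"
  proof (rule finite_if_finite_subsets_card_bdd[THEN conjunct1])
    fix G assume G: "G \<subseteq> {j. \<nu> j \<noteq> 0}" "finite G"
    have "real (card G) = (\<Sum>j\<in>G. 1)" by simp
    also have "\<dots> \<le> (\<Sum>j\<in>G. \<bar>real_of_int (\<nu> j)\<bar>)"
      using G(1) by (intro sum_mono) (auto simp flip: of_int_abs)
    also have "\<dots> \<le> L"
      unfolding L_def by (rule finite_sum_le_infsum[OF S G(2)]) auto
    finally show "card G \<le> nat \<lceil>L\<rceil>" by linarith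
  qed
  then have "\<nu> = Poly_Mapping.lookup (Abs_poly_mapping \<nu>)" by simp
  then show "\<nu> \<in> range (Poly_Mapping.lookup :: freq \<Rightarrow> int \<Rightarrow> int)" by blast
qed

definition star_weight :: "(int \<Rightarrow> real) \<Rightarrow> bool" where
  "star_weight h \<longleftrightarrow>
     (\<forall>j. 0 < h j) \<and> (\<forall>j. h (- j) = h j) \<and> (\<forall>j\<ge>0. h j \<le> h (j + 1)) \<and>
     filterlim h at_top at_top"

definition star_norm :: "(int \<Rightarrow> real) \<Rightarrow> freq \<Rightarrow> real" where
  "star_norm h \<nu> = (\<Sum>j\<in>Poly_Mapping.keys \<nu>. h j * \<bar>real_of_int (Poly_Mapping.lookup \<nu> j)\<bar>)"

definition freq_dot :: "(int \<Rightarrow> real) \<Rightarrow> freq \<Rightarrow> real" where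
  "freq_dot \<omega> \<nu> = (\<Sum>j\<in>Poly_Mapping.keys \<nu>. \<omega> j * real_of_int (Poly_Mapping.lookup \<nu> j))"

definition ell_infty :: "real \<Rightarrow> (int \<Rightarrow> real) set" where
  "ell_infty q = {I. bdd_above (range (\<lambda>j. \<bar>I j\<bar> * (max 1 \<bar>real_of_int j\<bar>) powr q))}"

section \<open>Star-Bryuno vectors\<close>

definition small_divisors :: "(int \<Rightarrow> real) \<Rightarrow> (int \<Rightarrow> real) \<Rightarrow> nat \<Rightarrow> real set" where
  "small_divisors h \<omega> m = {\<bar>freq_dot \<omega> \<nu>\<bar> | \<nu>. 0 < star_norm h \<nu> \<and> star_norm h \<nu> \<le> 2 ^ m}"

definition star_beta :: "(int \<Rightarrow> real) \<Rightarrow> (int \<Rightarrow> real) \<Rightarrow> nat \<Rightarrow> real" where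
  "star_beta h \<omega> m = Inf (small_divisors h \<omega> m)"

text \<open>Terms with empty index set are dropped, and \<open>log (1 / 0) = \<infinity>\<close>.  For admissible weights the
  partial sums always have a limit in the extended reals, since \<open>star_beta\<close> is eventually
  decreasing in \<open>m\<close> and hence the terms are bounded below by a constant times \<open>2 ^ (- m)\<close>.\<close>

definition star_bryuno_sum :: "(int \<Rightarrow> real) \<Rightarrow> (int \<Rightarrow> real) \<Rightarrow> ereal" where
  "star_bryuno_sum h \<omega> =
     suminf (\<lambda>m. if m = 0 \<or> small_divisors h \<omega> m = {} then 0
       else if star_beta h \<omega> m = 0 then \<infinity>
       else ereal (1 / 2 ^ m * ln (1 / star_beta h \<omega> m)))"

definition star_bryuno :: "(int \<Rightarrow> real) \<Rightarrow> (int \<Rightarrow> real) \<Rightarrow> bool" where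
  "star_bryuno h \<omega> \<longleftrightarrow> star_bryuno_sum h \<omega> < \<infinity>"

section \<open>The infinite-dimensional torus\<close>

quotient_type circle = real / "\<lambda>x y. \<exists>k::int. x - y = 2 * pi * of_int k"
proof (intro equivpI reflpI sympI transpI)
  fix x :: real
  show "\<exists>k::int. x - x = 2 * pi * of_int k" by (intro exI[of _ 0]) simp
next
  fix x y :: real
  assume "\<exists>k::int. x - y = 2 * pi * of_int k"
  then obtain k :: int where "x - y = 2 * pi * of_int k" ..
  then show "\<exists>k::int. y - x = 2 * pi * of_int k" by (intro exI[of _ "- k"]) simp
next
  fix x y z :: real
  assume "\<exists>k::int. x - y = 2 * pi * of_int k" "\<exists>k::int. y - z = 2 * pi * of_int k"
  then obtain k l :: int where "x - y = 2 * pi * of_int k" "y - z = 2 * pi * of_int l" by blast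
  then show "\<exists>k::int. x - z = 2 * pi * of_int k"
    by (intro exI[of _ "k + l"]) (simp add: algebra_simps)
qed

lift_definition circle_exp :: "circle \<Rightarrow> complex" is cis
proof -
  fix x y :: real
  assume "\<exists>k::int. x - y = 2 * pi * of_int k"
  then obtain k :: int where "x = y + 2 * pi * of_int k" by (auto simp: algebra_simps)
  then show "cis x = cis y" by (simp flip: cis_mult add: cis_multiple_2pi)
qed

lift_definition circle_translate :: "circle \<Rightarrow> real \<Rightarrow> circle" is "(+)"
  by simp

type_synonym torus = "int \<Rightarrow> circle"

type_synonym linf_real = "int \<Rightarrow>\<^sub>C real"
type_synonym linf_complex = "int \<Rightarrow>\<^sub>C complex"

text \<open>The topology of \<^typ>\<open>int\<close> is discrete, so \<^typ>\<open>int \<Rightarrow>\<^sub>C real\<close> consists of all bounded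
  sequences, with the supremum norm, and \<^typ>\<open>int \<Rightarrow>\<^sub>C complex\<close> is its complexification.\<close>

definition torus_translate :: "torus \<Rightarrow> linf_real \<Rightarrow> torus" where
  "torus_translate \<phi> x = (\<lambda>j. circle_translate (\<phi> j) (apply_bcontfun x j))"

text \<open>\<open>e ^ (i \<nu> \<cdot> \<theta>)\<close>, written as the product of the \<open>(e ^ (i \<theta>_j)) ^ \<nu>_j\<close>.\<close>

definition character :: "freq \<Rightarrow> torus \<Rightarrow> complex" where
  "character \<nu> \<theta> = (\<Prod>j\<in>Poly_Mapping.keys \<nu>. circle_exp (\<theta> j) powi Poly_Mapping.lookup \<nu> j)"

section \<open>Real-valued functions on the torus\<close>

definition fourier_rep :: "(torus \<Rightarrow> real) \<Rightarrow> (freq \<Rightarrow> complex) \<Rightarrow> bool" where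
  "fourier_rep f F \<longleftrightarrow>
     (\<lambda>\<nu>. norm (F \<nu>)) summable_on UNIV \<and>
     (\<forall>\<nu>. F (- \<nu>) = cnj (F \<nu>)) \<and>
     (\<forall>\<theta>. ((\<lambda>\<nu>. character \<nu> \<theta> * F \<nu>) has_sum complex_of_real (f \<theta>)) UNIV)"

text \<open>Absolutely summable Fourier coefficients are unique, so the description below is proper for
  every function having a representation.\<close>

definition fourier_coeff :: "(torus \<Rightarrow> real) \<Rightarrow> freq \<Rightarrow> complex" where
  "fourier_coeff f = (THE F. fourier_rep f F)"

definition H_star :: "(int \<Rightarrow> real) \<Rightarrow> real \<Rightarrow> (torus \<Rightarrow> real) set" where
  "H_star h s = {f. \<exists>F. fourier_rep f F \<and>
     (\<lambda>\<nu>. norm (F \<nu>) * exp (s * star_norm h \<nu>)) summable_on UNIV}"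

definition H_star_norm :: "(int \<Rightarrow> real) \<Rightarrow> real \<Rightarrow> (torus \<Rightarrow> real) \<Rightarrow> real" where
  "H_star_norm h s f = (\<Sum>\<^sub>\<infinity>\<nu>. norm (fourier_coeff f \<nu>) * exp (s * star_norm h \<nu>))"

text \<open>The sum is real because of the symmetry of the coefficients; \<^const>\<open>Re\<close> only adjusts
  its type.\<close>

definition torus_grad :: "(torus \<Rightarrow> real) \<Rightarrow> torus \<Rightarrow> int \<Rightarrow> real" where
  "torus_grad f \<theta> j =
     Re (\<Sum>\<^sub>\<infinity>\<nu>. \<i> * of_int (Poly_Mapping.lookup \<nu> j) * fourier_coeff f \<nu> * character \<nu> \<theta>)"

section \<open>Functions on the torus with values in the bounded sequences\<close>

context includes bcontfun.lifting
begin

lift_definition linf_scale :: "complex \<Rightarrow> linf_complex \<Rightarrow> linf_complex" is "\<lambda>c x j. c * x j"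
  by (auto simp: bcontfun_def bounded_iff norm_mult intro!: continuous_intros
      intro: mult_left_mono[OF _ norm_ge_zero])

lift_definition linf_of_real :: "linf_real \<Rightarrow> linf_complex" is "\<lambda>x j. complex_of_real (x j)"
  by (auto simp: bcontfun_def bounded_iff intro!: continuous_intros)

lift_definition linf_Re :: "linf_complex \<Rightarrow> linf_real" is "\<lambda>x j. Re (x j)"
  by (auto simp: bcontfun_def bounded_iff intro!: continuous_intros
      intro: order_trans[OF abs_Re_le_cmod])

lift_definition linf_cnj :: "linf_complex \<Rightarrow> linf_complex" is "\<lambda>x j. cnj (x j)"
  by (auto simp: bcontfun_def bounded_iff intro!: continuous_intros)

end

definition fourier_rep_linf :: "(torus \<Rightarrow> linf_real) \<Rightarrow> (freq \<Rightarrow> linf_complex) \<Rightarrow> bool" where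
  "fourier_rep_linf u U \<longleftrightarrow>
     (\<lambda>\<nu>. norm (U \<nu>)) summable_on UNIV \<and>
     (\<forall>\<nu>. U (- \<nu>) = linf_cnj (U \<nu>)) \<and>
     (\<forall>\<phi>. ((\<lambda>\<nu>. linf_scale (character \<nu> \<phi>) (U \<nu>)) has_sum linf_of_real (u \<phi>)) UNIV)"

definition fourier_coeff_linf :: "(torus \<Rightarrow> linf_real) \<Rightarrow> freq \<Rightarrow> linf_complex" where
  "fourier_coeff_linf u = (THE U. fourier_rep_linf u U)"

definition H_star_linf :: "(int \<Rightarrow> real) \<Rightarrow> real \<Rightarrow> (torus \<Rightarrow> linf_real) set" where
  "H_star_linf h s = {u. \<exists>U. fourier_rep_linf u U \<and>
     (\<lambda>\<nu>. norm (U \<nu>) * exp (s * star_norm h \<nu>)) summable_on UNIV}"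

definition H_star_linf_norm :: "(int \<Rightarrow> real) \<Rightarrow> real \<Rightarrow> (torus \<Rightarrow> linf_real) \<Rightarrow> real" where
  "H_star_linf_norm h s u =
     (\<Sum>\<^sub>\<infinity>\<nu>. norm (fourier_coeff_linf u \<nu>) * exp (s * star_norm h \<nu>))"

definition omega_deriv :: "(int \<Rightarrow> real) \<Rightarrow> (torus \<Rightarrow> linf_real) \<Rightarrow> torus \<Rightarrow> linf_real" where
  "omega_deriv \<omega> u \<phi> =
     linf_Re (\<Sum>\<^sub>\<infinity>\<nu>. linf_scale (\<i> * of_real (freq_dot \<omega> \<nu>) * character \<nu> \<phi>)
                                    (fourier_coeff_linf u \<nu>))"

end

theory Submission
  imports Defs "HOL-Library.Function_Algebras"
begin

text \<open>The solution is built by a Newton iteration in configuration space.  Write \<open>D\<close> for the derivative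
  along \<open>\<omega>\<close>, and for a displacement \<open>u\<close> let \<open>e = D\<^sup>2 u + \<epsilon> (\<partial>f)(\<phi> + u)\<close> be the residual of the equation.

  The gradient of an analytic function is not merely bounded but absolutely summable over the index
  \<open>j\<close>, since \<open>\<Sum>\<^sub>j \<bar>\<nu>\<^sub>j\<bar>\<close> is dominated by the star-norm.  So the unknown is kept in \<open>\<ell>\<^sup>1\<close> and the Jacobian
  \<open>\<partial>u\<close> in the matrices with absolutely summable entries.  These form a Banach algebra that is closed under
  transposition, which the bounded operators on \<open>\<ell>\<^sup>\<infinity>\<close> are not, and \<open>V = 1 + \<partial>u\<close> can be used
  together with its transpose.

  Substituting \<open>w = V z\<close> in the equation linearised at \<open>u\<close> and multiplying by \<open>V\<^sup>T\<close> gives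
  \<open>V\<^sup>T e + D (V\<^sup>T V D z) + V\<^sup>T (\<partial>e) z + K D z\<close> with \<open>K = V\<^sup>T DV - (DV)\<^sup>T V\<close>
  (\<open>transpose_linres\<close>).  The last two terms are quadratically small: \<open>D K\<close> is linear in \<open>\<partial>e\<close> by the symmetry
  of the Hessian of \<open>f\<close>, and \<open>K\<close> has average zero because second derivatives of \<open>u\<close> commute.  As the force
  is a gradient, \<open>V\<^sup>T e\<close> is a sum of derivatives and has average zero too, so that
  \<open>D (V\<^sup>T V D z) = - V\<^sup>T e\<close> can be solved by dividing twice by the small divisors \<open>\<omega> \<cdot> \<nu>\<close>; the
  factor \<open>V\<^sup>T V\<close> is close to the identity and is inverted by a contraction (\<open>approx_solution\<close>).

  Every division is restricted to \<open>\<bar>\<nu>\<bar>\<^sub>\<star> \<le> 2 ^ m\<close>, where the divisors are at least \<open>\<beta>\<close>; the neglected tail costs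
  \<open>exp (- \<delta> 2 ^ m)\<close> when the width of analyticity shrinks by \<open>\<delta>\<close>.  Altogether a residual of size \<open>\<eta>\<close>
  becomes one of size \<open>C \<eta>\<^sup>2 / (\<beta>\<^sup>4 \<delta>)\<close>, as soon as \<open>exp (- \<delta> 2 ^ m) \<le> \<eta>\<close>
  (\<open>newton_iteration_step\<close>).  The potential is replaced at each step by a finite part of its Fourier series, so that
  only finitely many components move and all sums over \<open>j\<close> are finite, with bounds independent of their number.

  The Bryuno condition makes the total loss of width finite (\<open>cutoff_schedule\<close>).  Let the target be
  \<open>\<eta>\<^sub>n = exp (- E\<^sub>n)\<close> with \<open>E\<^sub>n = E (3/2) ^ n\<close>, let \<open>b m\<close> bound \<open>log (1 / \<beta>)\<close> at cutoff \<open>2 ^ m\<close>, and let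
  \<open>m\<^sub>n\<close> be the largest \<open>m\<close> with \<open>16 b m \<le> E\<^sub>n\<close>.  Then \<open>\<delta>\<^sub>n = E\<^sub>n / 2 ^ m\<^sub>n\<close> suffices.  By maximality
  \<open>E\<^sub>n < 16 b (m\<^sub>n + 1)\<close>, and the steps that share a cutoff contribute a geometric sum dominated by its last
  term; hence \<open>\<Sum> \<delta>\<^sub>n\<close> is at most \<open>96\<close> times a tail of the convergent series \<open>\<Sum> b m / 2 ^ m\<close>, and it is small when
  \<open>E\<close> is large, that is, when \<open>\<epsilon>\<close> is small.  The corrections sum up to \<open>9 exp (- E / 2)\<close>, and \<open>E\<close> may be
  chosen as \<open>- log (C \<bar>\<epsilon>\<bar>)\<close>; so the norm of the solution is at most of the order of \<open>\<bar>\<epsilon>\<bar>\<close> to the power \<open>1/2\<close>, and it tends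
  to \<open>0\<close>.\<close>

section \<open>Frequencies, characters and rotations\<close>

abbreviation "lk \<equiv> Poly_Mapping.lookup"

type_synonym tfun = "torus \<Rightarrow> complex"

definition l1 :: "freq \<Rightarrow> real" where
  "l1 \<nu> = (\<Sum>j\<in>Poly_Mapping.keys \<nu>. \<bar>real_of_int (lk \<nu> j)\<bar>)"

definition rotate_torus :: "torus \<Rightarrow> (int \<Rightarrow> real) \<Rightarrow> torus" where
  "rotate_torus \<theta> x = (\<lambda>j. circle_translate (\<theta> j) (x j))"

text \<open>Sums over the support of a frequency are compared for different frequencies by enlarging the
  index set to a common finite one.\<close>

lemma freq_sum_superset:
  assumes "finite K" "Poly_Mapping.keys \<nu> \<subseteq> K" "\<And>j. g j 0 = (0::real)"
  shows "(\<Sum>j\<in>Poly_Mapping.keys \<nu>. g j (lk \<nu> j)) = (\<Sum>j\<in>K. g j (lk \<nu> j))"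
  using assms by (intro sum.mono_neutral_left) (auto simp: in_keys_iff)

lemma freq_dot_superset:
  assumes "finite K" "Poly_Mapping.keys \<nu> \<subseteq> K"
  shows "freq_dot x \<nu> = (\<Sum>j\<in>K. x j * real_of_int (lk \<nu> j))"
  unfolding freq_dot_def using freq_sum_superset[OF assms, of "\<lambda>j k. x j * real_of_int k"] by simp

lemma star_norm_superset:
  assumes "finite K" "Poly_Mapping.keys \<nu> \<subseteq> K"
  shows "star_norm h \<nu> = (\<Sum>j\<in>K. h j * \<bar>real_of_int (lk \<nu> j)\<bar>)"
  unfolding star_norm_def
  using freq_sum_superset[OF assms, of "\<lambda>j k. h j * \<bar>real_of_int k\<bar>"] by simp

lemma freq_dot_add: "freq_dot x (\<nu> + \<mu>) = freq_dot x \<nu> + freq_dot x \<mu>"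
proof -
  let ?K = "Poly_Mapping.keys \<nu> \<union> Poly_Mapping.keys \<mu>"
  have "Poly_Mapping.keys (\<nu> + \<mu>) \<subseteq> ?K" by (rule keys_add)
  then show ?thesis
    by (simp add: freq_dot_superset[of ?K] lookup_add sum.distrib algebra_simps)
qed

lemma freq_dot_uminus: "freq_dot x (- \<nu>) = - freq_dot x \<nu>"
  by (simp add: freq_dot_def sum_negf)

lemma freq_dot_zero [simp]: "freq_dot x 0 = 0"
  by (simp add: freq_dot_def)

lemma abs_freq_dot_le:
  assumes "\<And>j. \<bar>x j\<bar> \<le> c"
  shows "\<bar>freq_dot x \<nu>\<bar> \<le> c * l1 \<nu>"
proof -
  have "\<bar>freq_dot x \<nu>\<bar> \<le> (\<Sum>j\<in>Poly_Mapping.keys \<nu>. \<bar>x j * real_of_int (lk \<nu> j)\<bar>)"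
    unfolding freq_dot_def by (rule sum_abs)
  also have "\<dots> \<le> (\<Sum>j\<in>Poly_Mapping.keys \<nu>. c * \<bar>real_of_int (lk \<nu> j)\<bar>)"
    by (intro sum_mono) (auto simp: abs_mult intro!: mult_right_mono assms)
  finally show ?thesis by (simp add: l1_def sum_distrib_left)
qed

lemma l1_nonneg [simp]: "0 \<le> l1 \<nu>"
  by (simp add: l1_def sum_nonneg)

lemma lookup_le_l1: "(\<Sum>j\<in>J. \<bar>real_of_int (lk \<nu> j)\<bar>) \<le> l1 \<nu>" if "finite J"
proof -
  have "(\<Sum>j\<in>J. \<bar>real_of_int (lk \<nu> j)\<bar>) \<le> (\<Sum>j\<in>J \<union> Poly_Mapping.keys \<nu>. \<bar>real_of_int (lk \<nu> j)\<bar>)"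
    using that by (intro sum_mono2) auto
  also have "\<dots> = l1 \<nu>"
    unfolding l1_def using freq_sum_superset[of "J \<union> Poly_Mapping.keys \<nu>" \<nu> "\<lambda>j k. \<bar>real_of_int k\<bar>"] that
    by simp
  finally show ?thesis .
qed

lemma circle_exp_norm [simp]: "norm (circle_exp c) = 1"
  by transfer simp

lemma circle_exp_nonzero [simp]: "circle_exp c \<noteq> 0"
  by (metis circle_exp_norm norm_zero zero_neq_one)

lemma circle_exp_translate: "circle_exp (circle_translate c t) = circle_exp c * cis t"
  by transfer (simp add: cis_mult)

lemma character_superset:
  assumes "finite K" "Poly_Mapping.keys \<nu> \<subseteq> K"
  shows "character \<nu> \<theta> = (\<Prod>j\<in>K. circle_exp (\<theta> j) powi lk \<nu> j)"
  unfolding character_def using assms by (intro prod.mono_neutral_left) (auto simp: in_keys_iff)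

lemma character_add: "character (\<nu> + \<mu>) \<theta> = character \<nu> \<theta> * character \<mu> \<theta>"
proof -
  let ?K = "Poly_Mapping.keys \<nu> \<union> Poly_Mapping.keys \<mu>"
  have "Poly_Mapping.keys (\<nu> + \<mu>) \<subseteq> ?K" by (rule keys_add)
  then show ?thesis
    by (simp add: character_superset[of ?K] lookup_add power_int_add prod.distrib)
qed

lemma character_zero [simp]: "character 0 \<theta> = 1"
  by (simp add: character_def)

lemma norm_character [simp]: "norm (character \<nu> \<theta>) = 1"
  by (simp add: character_def prod_norm[symmetric] norm_power_int)

lemma character_uminus: "character (- \<nu>) \<theta> = cnj (character \<nu> \<theta>)"
proof -
  have "character \<nu> \<theta> * character (- \<nu>) \<theta> = 1"
    using character_add[of \<nu> "- \<nu>" \<theta>] by simp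
  moreover have "character \<nu> \<theta> * cnj (character \<nu> \<theta>) = 1"
    by (simp add: complex_norm_square[symmetric])
  moreover have "character \<nu> \<theta> \<noteq> 0" by (metis norm_character norm_zero zero_neq_one)
  ultimately show ?thesis by (metis mult_cancel_left)
qed

lemma character_rotate: "character \<nu> (rotate_torus \<theta> x) = character \<nu> \<theta> * cis (freq_dot x \<nu>)"
proof -
  have "(\<Prod>j\<in>A. cis (x j) powi lk \<nu> j) = cis (\<Sum>j\<in>A. x j * real_of_int (lk \<nu> j))" if "finite A" for A
    using that by (induction A) (auto simp: cis_power_int cis_mult algebra_simps)
  then show ?thesis
    by (simp add: character_def rotate_torus_def circle_exp_translate power_int_mult_distrib
        prod.distrib freq_dot_def)
qed

section \<open>Uniqueness of Fourier coefficients\<close>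

definition abs_sum :: "(freq \<Rightarrow> complex) \<Rightarrow> bool" where
  "abs_sum F \<longleftrightarrow> (\<lambda>\<nu>. norm (F \<nu>)) summable_on UNIV"

definition represents :: "(freq \<Rightarrow> complex) \<Rightarrow> tfun \<Rightarrow> bool" where
  "represents F g \<longleftrightarrow> abs_sum F \<and> (\<forall>\<theta>. ((\<lambda>\<nu>. F \<nu> * character \<nu> \<theta>) has_sum g \<theta>) UNIV)"

lemma abs_sum_comparison:
  assumes "abs_sum F" "\<And>\<nu>. norm (G \<nu>) \<le> norm (F \<nu>)"
  shows "abs_sum G"
  using assms unfolding abs_sum_def by (rule Infinite_Sum.abs_summable_on_comparison_test)

text \<open>Averaging over the identity and one rotation \<open>x\<close> multiplies the coefficient at \<open>\<nu>\<close> by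
  \<open>(1 + exp (i x \<cdot> \<nu>)) / 2\<close>.  This factor is bounded by \<open>1\<close>, equals \<open>1\<close> at \<open>\<nu> = 0\<close>, and vanishes at a
  prescribed \<open>\<mu> \<noteq> 0\<close> for a suitable \<open>x\<close>.  Finitely many such averages remove finitely many
  frequencies, which replaces integration over the infinite-dimensional torus.\<close>

lemma represents_zero_kill:
  assumes F: "represents F (\<lambda>_. 0)" and S: "finite S" "0 \<notin> S"
  shows "\<exists>G. represents G (\<lambda>_. 0) \<and> (\<forall>\<nu>. norm (G \<nu>) \<le> norm (F \<nu>)) \<and> G 0 = F 0 \<and> (\<forall>\<nu>\<in>S. G \<nu> = 0)"
  using S
proof (induction S rule: finite_induct)
  case empty
  then show ?case using F by blast
next
  case (insert \<mu> S)
  then obtain G where G: "represents G (\<lambda>_. 0)" "\<And>\<nu>. norm (G \<nu>) \<le> norm (F \<nu>)" "G 0 = F 0" "\<And>\<nu>. \<nu> \<in> S \<Longrightarrow> G \<nu> = 0"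
    by (metis insertCI)
  from insert have "\<mu> \<noteq> 0" by auto
  then obtain j where j: "lk \<mu> j \<noteq> 0" by (metis lookup_zero poly_mapping_eqI)
  \<comment> \<open>a rotation with x . mu = pi, on which the character of mu takes the value -1\<close>
  define x where "x = (\<lambda>i. if i = j then pi / real_of_int (lk \<mu> j) else 0)"
  have "freq_dot x \<mu> = (\<Sum>i\<in>Poly_Mapping.keys \<mu>. if i = j then pi else 0)"
    unfolding freq_dot_def x_def using j by (intro sum.cong) auto
  also have "\<dots> = pi" using j by (simp add: in_keys_iff)
  finally have x: "freq_dot x \<mu> = pi" .
  define H where "H = (\<lambda>\<nu>. G \<nu> * ((1 + cis (freq_dot x \<nu>)) / 2))"
  have le1: "norm ((1 + cis t) / 2) \<le> 1" for t
    using norm_triangle_ineq[of 1 "cis t"] by (simp add: norm_divide)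
  have HG: "norm (H \<nu>) \<le> norm (G \<nu>)" for \<nu>
    unfolding H_def norm_mult using le1 by (intro mult_left_le) auto
  have "((\<lambda>\<nu>. H \<nu> * character \<nu> \<theta>) has_sum 0) UNIV" for \<theta>
  proof -
    have "((\<lambda>\<nu>. G \<nu> * character \<nu> \<theta> + G \<nu> * character \<nu> (rotate_torus \<theta> x)) has_sum 0 + 0) UNIV"
      using G(1) by (intro has_sum_add) (auto simp: represents_def)
    from has_sum_cmult_left[OF this, of "1/2"] show ?thesis
      by (simp add: H_def character_rotate algebra_simps add_divide_distrib)
  qed
  moreover have "abs_sum H"
    using abs_sum_comparison[OF _ HG] G(1) by (auto simp: represents_def)
  ultimately have "represents H (\<lambda>_. 0)" by (simp add: represents_def)
  moreover have "norm (H \<nu>) \<le> norm (F \<nu>)" for \<nu> using HG G(2) order_trans by blast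
  moreover have "H 0 = F 0" using G(3) by (simp add: H_def)
  moreover have "\<forall>\<nu>\<in>insert \<mu> S. H \<nu> = 0" using G(4) x by (auto simp: H_def)
  ultimately show ?case by blast
qed

text \<open>Once all frequencies outside a small tail have been removed, the constant coefficient is
  bounded by that tail.\<close>

lemma represents_zero_at_0:
  assumes F: "represents F (\<lambda>_. 0)"
  shows "F 0 = 0"
proof (rule ccontr)
  assume "F 0 \<noteq> 0"
  define e where "e = norm (F 0) / 2"
  have e: "e > 0" "e < norm (F 0)" using \<open>F 0 \<noteq> 0\<close> by (auto simp: e_def)
  let ?n = "\<lambda>\<nu>. norm (F \<nu>)"
  have sm: "?n summable_on UNIV" using F by (simp add: represents_def abs_sum_def)
  obtain B where B: "finite B" "dist (sum ?n B) (infsum ?n UNIV) \<le> e"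
    using infsum_finite_approximation[OF sm e(1)] by auto
  have "infsum ?n UNIV = sum ?n B + infsum ?n (- B)"
    using infsum_Un_disjoint[of ?n B "- B"] sm B(1)
    by (simp add: summable_on_subset_banach[OF sm])
  then have tail: "infsum ?n (- B) \<le> e"
    using B(2) by (simp add: dist_real_def abs_le_iff)
  obtain G where G: "represents G (\<lambda>_. 0)" "\<And>\<nu>. norm (G \<nu>) \<le> ?n \<nu>" "G 0 = F 0"
      "\<And>\<nu>. \<nu> \<in> B - {0} \<Longrightarrow> G \<nu> = 0"
    using represents_zero_kill[OF F, of "B - {0}"] B(1) by auto
  define \<theta> :: torus where "\<theta> = undefined"
  let ?t = "\<lambda>\<nu>. G \<nu> * character \<nu> \<theta>"
  have "(?t has_sum 0) UNIV" using G(1) by (simp add: represents_def)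
  then have s0: "?t summable_on UNIV" "infsum ?t UNIV = 0" by (auto simp: has_sum_iff)
  have "infsum ?t UNIV = infsum ?t {0} + infsum ?t (- {0})"
    using infsum_Un_disjoint[of ?t "{0}" "- {0}"] s0(1)
    by (simp add: summable_on_subset_banach[OF s0(1)])
  then have "F 0 = - infsum ?t (- {0})" using s0 G(3) by (simp add: add_eq_0_iff)
  also have "infsum ?t (- {0}) = infsum ?t (- B - {0})"
    by (rule infsum_cong_neutral) (use G(4) in auto)
  finally have "norm (F 0) = norm (infsum ?t (- B - {0}))" by simp
  also have "\<dots> \<le> infsum ?n (- B - {0})"
    by (rule norm_infsum_le[of ?t _ _ ?n])
      (use G(2) in \<open>auto simp: norm_mult intro!: has_sum_infsum summable_on_subset_banach[OF s0(1)] summable_on_subset_banach[OF sm]\<close>)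
  also have "\<dots> \<le> infsum ?n (- B)"
    by (rule infsum_mono2) (auto intro!: summable_on_subset_banach[OF sm])
  finally show False using tail e by linarith
qed

lemma has_sum_diff:
  fixes f g :: "'b \<Rightarrow> 'a::real_normed_vector"
  assumes "(f has_sum a) A" "(g has_sum b) A"
  shows "((\<lambda>x. f x - g x) has_sum a - b) A"
  using has_sum_add[OF assms(1), of "\<lambda>x. - g x" "- b"] assms(2) by (simp add: has_sum_uminus)

lemma has_sum_shift:
  fixes f :: "freq \<Rightarrow> 'a::real_normed_vector"
  shows "((\<lambda>\<nu>. f (\<nu> + \<mu>)) has_sum a) UNIV \<longleftrightarrow> (f has_sum a) UNIV"
proof -
  have "bij_betw (\<lambda>\<nu>. \<nu> + \<mu>) UNIV UNIV"
    by (intro bij_betwI[of _ _ _ "\<lambda>\<nu>. \<nu> - \<mu>"]) auto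
  then show ?thesis by (rule has_sum_reindex_bij_betw)
qed

lemma has_sum_reflect:
  fixes f :: "freq \<Rightarrow> 'a::real_normed_vector"
  shows "((\<lambda>\<nu>. f (- \<nu>)) has_sum a) UNIV \<longleftrightarrow> (f has_sum a) UNIV"
proof -
  have "bij_betw (\<lambda>\<nu>::freq. - \<nu>) UNIV UNIV"
    by (intro bij_betwI[of _ _ _ "\<lambda>\<nu>. - \<nu>"]) auto
  then show ?thesis by (rule has_sum_reindex_bij_betw)
qed

text \<open>A frequency shift reduces every coefficient to the constant one.\<close>

lemma represents_unique:
  assumes F: "represents F g" and G: "represents G g"
  shows "F = G"
proof
  fix \<mu>
  define H where "H = (\<lambda>\<nu>. F (\<nu> + \<mu>) - G (\<nu> + \<mu>))"
  have "((\<lambda>\<nu>. H \<nu> * character \<nu> \<theta>) has_sum 0) UNIV" for \<theta>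
  proof -
    have "((\<lambda>\<nu>. F \<nu> * character \<nu> \<theta> - G \<nu> * character \<nu> \<theta>) has_sum g \<theta> - g \<theta>) UNIV"
      using F G by (intro has_sum_diff) (auto simp: represents_def)
    from has_sum_cmult_left[OF this, of "character (- \<mu>) \<theta>"]
    have "((\<lambda>\<nu>. (F \<nu> - G \<nu>) * character (\<nu> - \<mu>) \<theta>) has_sum 0) UNIV"
      using character_add[of _ "- \<mu>" \<theta>] by (simp add: algebra_simps)
    then show ?thesis
      unfolding H_def by (subst has_sum_shift[symmetric, where \<mu> = "- \<mu>"]) simp
  qed
  moreover have "abs_sum H"
  proof -
    have "(\<lambda>\<nu>. norm (F \<nu>) + norm (G \<nu>)) summable_on UNIV"
      using F G by (intro summable_on_add) (auto simp: represents_def abs_sum_def)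
    then have "(\<lambda>\<nu>. norm (F (\<nu> + \<mu>)) + norm (G (\<nu> + \<mu>))) summable_on UNIV"
      using has_sum_shift[of "\<lambda>\<nu>. norm (F \<nu>) + norm (G \<nu>)" \<mu>] unfolding summable_on_def by blast
    then show ?thesis unfolding abs_sum_def H_def
      by (rule Infinite_Sum.abs_summable_on_comparison_test') (rule norm_triangle_ineq4)
  qed
  ultimately have "represents H (\<lambda>_. 0)" by (simp add: represents_def)
  from represents_zero_at_0[OF this] show "F \<mu> = G \<mu>" by (simp add: H_def)
qed

text \<open>For a function without an absolutely convergent Fourier series this is an unspecified value;
  all uses are for members of the spaces \<open>A\<close> below.\<close>

definition coef :: "tfun \<Rightarrow> freq \<Rightarrow> complex" where
  "coef g = (THE F. represents F g)"

lemma coef_eq: "represents F g \<Longrightarrow> coef g = F"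
  unfolding coef_def by (rule the_equality) (auto intro: represents_unique)

text \<open>Functions on the torus are treated as elements of a commutative ring; the pointwise
  equations are therefore kept out of the simplifier and applied only where points matter.\<close>

declare plus_fun_apply [simp del] times_fun_apply [simp del] zero_fun_apply [simp del]
  one_fun_apply [simp del] minus_apply [simp del] uminus_apply [simp del]

lemmas fun_apply = plus_fun_apply times_fun_apply zero_fun_apply one_fun_apply minus_apply uminus_apply

section \<open>Interchange of double sums\<close>

text \<open>Product and limit of Fourier series both need Fubini twice: for the weighted moduli, which
  yields the norm estimate, and then for the series themselves, dominated by those moduli.\<close>

lemma nonneg_double_sum:
  fixes f :: "'a \<Rightarrow> 'b \<Rightarrow> real"
  assumes f: "\<And>x y. 0 \<le> f x y" "\<And>x. (f x has_sum n x) UNIV" and n: "(n has_sum S) UNIV"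
  shows "(\<lambda>(x, y). f x y) summable_on (UNIV \<times> UNIV)"
    and "((\<lambda>x. f x y) has_sum (\<Sum>\<^sub>\<infinity>x. f x y)) UNIV"
    and "((\<lambda>y. \<Sum>\<^sub>\<infinity>x. f x y) has_sum S) UNIV"
proof -
  have inner: "((\<lambda>y. case (x, y) of (x, y) \<Rightarrow> f x y) has_sum n x) UNIV" for x using f(2) by simp
  show sm: "(\<lambda>(x, y). f x y) summable_on (UNIV \<times> UNIV)"
    by (rule summable_on_SigmaI[OF inner has_sum_imp_summable[OF n]]) (use f(1) in auto)
  have P: "((\<lambda>(y, x). f x y) has_sum S) (UNIV \<times> UNIV)"
    using has_sum_SigmaI[OF inner n sm] by (subst (asm) has_sum_swap) simp
  show in2: "((\<lambda>x. f x y) has_sum (\<Sum>\<^sub>\<infinity>x. f x y)) UNIV" for y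
    using summable_on_SigmaD1[OF has_sum_imp_summable[OF P]] by (intro has_sum_infsum) auto
  show "((\<lambda>y. \<Sum>\<^sub>\<infinity>x. f x y) has_sum S) UNIV"
    by (rule has_sum_SigmaD[OF P]) (use in2 in auto)
qed

lemma dominated_double_sum:
  fixes t :: "'a \<Rightarrow> 'b \<Rightarrow> complex"
  assumes f: "(\<lambda>(x, y). f x y) summable_on (UNIV \<times> UNIV)" "\<And>x y. norm (t x y) \<le> f x y"
    and t: "\<And>x. (t x has_sum a x) UNIV" "(a has_sum T) UNIV" "\<And>y. ((\<lambda>x. t x y) has_sum b y) UNIV"
  shows "(b has_sum T) UNIV"
proof -
  have "(\<lambda>x. norm (case x of (x, y) \<Rightarrow> t x y)) summable_on (UNIV \<times> UNIV)"
    by (rule Infinite_Sum.abs_summable_on_comparison_test'[OF f(1)]) (use f(2) in auto)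
  then have sm: "(\<lambda>(x, y). t x y) summable_on (UNIV \<times> UNIV)" by (rule abs_summable_summable)
  have "((\<lambda>y. case (x, y) of (x, y) \<Rightarrow> t x y) has_sum a x) UNIV" for x using t(1) by simp
  from has_sum_SigmaI[OF this t(2) sm]
  have "((\<lambda>(y, x). t x y) has_sum T) (UNIV \<times> UNIV)" by (subst (asm) has_sum_swap) simp
  then show ?thesis by (rule has_sum_SigmaD) (use t(3) in simp)
qed

section \<open>Weighted Wiener algebras on the torus\<close>

locale star_weighted =
  fixes h :: "int \<Rightarrow> real"
  assumes star_weight: "star_weight h"
begin

abbreviation size_of :: "freq \<Rightarrow> real" ("|_|\<^sub>h") where "size_of \<nu> \<equiv> star_norm h \<nu>"

lemma h0_pos [simp]: "0 < h 0" and h_pos [simp]: "0 < h j"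
  using star_weight by (auto simp: star_weight_def)

text \<open>The weights increase away from \<open>0\<close>, so \<open>h 0\<close> is the smallest one and the star-norm controls the
  \<open>\<ell>\<^sup>1\<close> norm of a frequency.\<close>

lemma h0_le: "h 0 \<le> h j"
proof -
  have "h 0 \<le> h (int n)" for n
  proof (induction n)
    case (Suc n)
    have "h (int n) \<le> h (int n + 1)" using star_weight by (auto simp: star_weight_def)
    with Suc show ?case by (simp add: add.commute)
  qed simp
  moreover have "h j = h (int (nat \<bar>j\<bar>))"
    using star_weight by (cases "j \<ge> 0") (auto simp: star_weight_def)
  ultimately show ?thesis by metis
qed

lemma size_nonneg [simp]: "0 \<le> |\<nu>|\<^sub>h"
  unfolding star_norm_def by (intro sum_nonneg mult_nonneg_nonneg) (auto simp: less_imp_le)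

lemma size_zero [simp]: "|0|\<^sub>h = 0"
  by (simp add: star_norm_def)

lemma size_uminus [simp]: "|- \<nu>|\<^sub>h = |\<nu>|\<^sub>h"
  by (simp add: star_norm_def)

lemma size_add_le: "|\<nu> + \<mu>|\<^sub>h \<le> |\<nu>|\<^sub>h + |\<mu>|\<^sub>h"
proof -
  let ?K = "Poly_Mapping.keys \<nu> \<union> Poly_Mapping.keys \<mu>"
  have "Poly_Mapping.keys (\<nu> + \<mu>) \<subseteq> ?K" by (rule keys_add)
  then have "|\<nu> + \<mu>|\<^sub>h = (\<Sum>j\<in>?K. h j * \<bar>real_of_int (lk \<nu> j) + real_of_int (lk \<mu> j)\<bar>)"
    by (simp add: star_norm_superset[of ?K] lookup_add)
  also have "\<dots> \<le> (\<Sum>j\<in>?K. h j * (\<bar>real_of_int (lk \<nu> j)\<bar> + \<bar>real_of_int (lk \<mu> j)\<bar>))"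
    by (intro sum_mono mult_left_mono) (auto simp: less_imp_le)
  also have "\<dots> = |\<nu>|\<^sub>h + |\<mu>|\<^sub>h"
    by (simp add: star_norm_superset[of ?K] distrib_left sum.distrib)
  finally show ?thesis .
qed

lemma l1_le_size: "h 0 * l1 \<nu> \<le> |\<nu>|\<^sub>h"
  unfolding l1_def star_norm_def sum_distrib_left
  by (intro sum_mono mult_right_mono h0_le) auto

lemma size_pos_iff [simp]: "0 < |\<nu>|\<^sub>h \<longleftrightarrow> \<nu> \<noteq> 0"
proof
  assume "\<nu> \<noteq> 0"
  then obtain j where j: "lk \<nu> j \<noteq> 0" by (metis lookup_zero poly_mapping_eqI)
  have "0 < \<bar>real_of_int (lk \<nu> j)\<bar>" using j by simp
  also have "\<dots> \<le> l1 \<nu>" using lookup_le_l1[of "{j}" \<nu>] by simp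
  finally have "0 < h 0 * l1 \<nu>" by simp
  with l1_le_size[of \<nu>] show "0 < |\<nu>|\<^sub>h" by linarith
qed auto

definition wsum :: "real \<Rightarrow> (freq \<Rightarrow> complex) \<Rightarrow> bool" where
  "wsum \<sigma> F \<longleftrightarrow> (\<lambda>\<nu>. norm (F \<nu>) * exp (\<sigma> * |\<nu>|\<^sub>h)) summable_on UNIV"

text \<open>The complex scalar version of the analytic functions of width \<open>\<sigma>\<close>, with its norm \<open>N \<sigma>\<close>.
  Coefficients are unique, so the representation may be left existentially quantified here.\<close>

definition A :: "real \<Rightarrow> tfun set" where
  "A \<sigma> = {g. \<exists>F. represents F g \<and> wsum \<sigma> F}"

definition N :: "real \<Rightarrow> tfun \<Rightarrow> real" where
  "N \<sigma> g = (\<Sum>\<^sub>\<infinity>\<nu>. norm (coef g \<nu>) * exp (\<sigma> * |\<nu>|\<^sub>h))"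

lemma A_represents: "g \<in> A \<sigma> \<Longrightarrow> represents (coef g) g"
  and A_wsum: "g \<in> A \<sigma> \<Longrightarrow> wsum \<sigma> (coef g)"
  unfolding A_def by (auto simp: coef_eq)

lemma A_abs_sum: "g \<in> A \<sigma> \<Longrightarrow> abs_sum (coef g)"
  using A_represents[of g \<sigma>] by (simp add: represents_def)

lemma A_has_sum: "g \<in> A \<sigma> \<Longrightarrow> ((\<lambda>\<nu>. coef g \<nu> * character \<nu> \<theta>) has_sum g \<theta>) UNIV"
  using A_represents[of g \<sigma>] by (simp add: represents_def)

lemma N_has_sum: "g \<in> A \<sigma> \<Longrightarrow> ((\<lambda>\<nu>. norm (coef g \<nu>) * exp (\<sigma> * |\<nu>|\<^sub>h)) has_sum N \<sigma> g) UNIV"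
  using A_wsum[of g \<sigma>] by (simp add: N_def wsum_def)

lemma wsum_abs_sum: "0 \<le> \<sigma> \<Longrightarrow> wsum \<sigma> F \<Longrightarrow> abs_sum F"
  unfolding wsum_def abs_sum_def
  by (erule Infinite_Sum.abs_summable_on_comparison_test')
     (auto intro!: mult_le_cancel_left1[THEN iffD2])

lemma A_I:
  assumes "0 \<le> \<sigma>" "wsum \<sigma> F" "\<And>\<theta>. ((\<lambda>\<nu>. F \<nu> * character \<nu> \<theta>) has_sum g \<theta>) UNIV"
  shows "g \<in> A \<sigma>" "coef g = F"
proof -
  have "represents F g" using assms wsum_abs_sum by (auto simp: represents_def)
  then show "g \<in> A \<sigma>" "coef g = F" using assms(2) by (auto simp: A_def coef_eq)
qed

lemma N_le_has_sum:
  assumes "g \<in> A \<sigma>" "(b has_sum B) UNIV" "\<And>\<nu>. norm (coef g \<nu>) * exp (\<sigma> * |\<nu>|\<^sub>h) \<le> b \<nu>"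
  shows "N \<sigma> g \<le> B"
  using has_sum_mono[OF N_has_sum[OF assms(1)] assms(2)] assms(3) by blast

lemma N_nonneg [simp]: "0 \<le> N \<sigma> g"
  unfolding N_def by (intro infsum_nonneg) auto

lemma A_mono:
  assumes "0 \<le> \<sigma>" "\<sigma> \<le> \<tau>" "g \<in> A \<tau>"
  shows "g \<in> A \<sigma>" and "N \<sigma> g \<le> N \<tau> g"
proof -
  have le: "norm (coef g \<nu>) * exp (\<sigma> * |\<nu>|\<^sub>h) \<le> norm (coef g \<nu>) * exp (\<tau> * |\<nu>|\<^sub>h)" for \<nu>
    using assms by (intro mult_left_mono) (auto intro: mult_right_mono)
  have "wsum \<sigma> (coef g)" unfolding wsum_def
    using summable_on_comparison_test[OF A_wsum[OF assms(3), unfolded wsum_def] le] by auto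
  then show "g \<in> A \<sigma>" using A_represents[OF assms(3)] unfolding A_def by blast
  then show "N \<sigma> g \<le> N \<tau> g" by (rule N_le_has_sum[OF _ N_has_sum[OF assms(3)] le])
qed

lemma norm_le_N:
  assumes "0 \<le> \<sigma>" "g \<in> A \<sigma>"
  shows "norm (g \<theta>) \<le> N \<sigma> g"
proof (rule norm_infsum_le[OF A_has_sum[OF assms(2)] N_has_sum[OF assms(2)]])
  fix \<nu>
  have "norm (coef g \<nu>) * 1 \<le> norm (coef g \<nu>) * exp (\<sigma> * |\<nu>|\<^sub>h)"
    using assms by (intro mult_left_mono) auto
  then show "norm (coef g \<nu> * character \<nu> \<theta>) \<le> norm (coef g \<nu>) * exp (\<sigma> * |\<nu>|\<^sub>h)"
    by (simp add: norm_mult)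
qed

lemma A_eqI:
  assumes "f \<in> A \<sigma>" "g \<in> A \<tau>" "\<And>\<nu>. coef f \<nu> = coef g \<nu>"
  shows "f = g"
proof
  fix \<theta>
  have "coef f = coef g" using assms(3) by blast
  then show "f \<theta> = g \<theta>"
    using A_has_sum[OF assms(1), of \<theta>] A_has_sum[OF assms(2), of \<theta>] has_sum_unique by metis
qed

lemma A_add:
  assumes "0 \<le> \<sigma>" "f \<in> A \<sigma>" "g \<in> A \<sigma>"
  shows "f + g \<in> A \<sigma>" "coef (f + g) = (\<lambda>\<nu>. coef f \<nu> + coef g \<nu>)" "N \<sigma> (f + g) \<le> N \<sigma> f + N \<sigma> g"
proof -
  have le: "norm (coef f \<nu> + coef g \<nu>) * exp (\<sigma> * |\<nu>|\<^sub>h)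
     \<le> norm (coef f \<nu>) * exp (\<sigma> * |\<nu>|\<^sub>h) + norm (coef g \<nu>) * exp (\<sigma> * |\<nu>|\<^sub>h)" for \<nu>
    by (simp add: norm_triangle_ineq flip: distrib_right)
  have hs: "((\<lambda>\<nu>. norm (coef f \<nu>) * exp (\<sigma> * |\<nu>|\<^sub>h) + norm (coef g \<nu>) * exp (\<sigma> * |\<nu>|\<^sub>h))
       has_sum N \<sigma> f + N \<sigma> g) UNIV"
    by (intro has_sum_add N_has_sum assms)
  have "wsum \<sigma> (\<lambda>\<nu>. coef f \<nu> + coef g \<nu>)" unfolding wsum_def
    using summable_on_comparison_test[OF has_sum_imp_summable[OF hs] le] by auto
  moreover have "((\<lambda>\<nu>. (coef f \<nu> + coef g \<nu>) * character \<nu> \<theta>) has_sum (f + g) \<theta>) UNIV" for \<theta>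
    using has_sum_add[OF A_has_sum[OF assms(2)] A_has_sum[OF assms(3)], of \<theta> \<theta>]
    by (simp add: algebra_simps fun_apply)
  ultimately show 1: "f + g \<in> A \<sigma>" and 2: "coef (f + g) = (\<lambda>\<nu>. coef f \<nu> + coef g \<nu>)"
    using A_I[OF assms(1)] by blast+
  show "N \<sigma> (f + g) \<le> N \<sigma> f + N \<sigma> g"
    by (rule N_le_has_sum[OF 1 hs]) (use 2 le in auto)
qed

text \<open>Derivatives, frequency cutoffs and division by small divisors are all of this form, so that one
  estimate serves them all and they commute.\<close>

definition mul :: "(freq \<Rightarrow> complex) \<Rightarrow> tfun \<Rightarrow> tfun" where
  "mul m g = (\<lambda>\<theta>. \<Sum>\<^sub>\<infinity>\<nu>. m \<nu> * coef g \<nu> * character \<nu> \<theta>)"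

text \<open>The weight of the target space times the symbol has to be dominated by the weight of the source
  space; the excess \<open>\<tau> - \<sigma>\<close> of the widths is what pays for an unbounded symbol.\<close>

lemma mul_A:
  assumes "0 \<le> \<sigma>" "g \<in> A \<tau>" and m: "\<And>\<nu>. norm (m \<nu>) * exp (\<sigma> * |\<nu>|\<^sub>h) \<le> C * exp (\<tau> * |\<nu>|\<^sub>h)"
  shows "mul m g \<in> A \<sigma>" "coef (mul m g) = (\<lambda>\<nu>. m \<nu> * coef g \<nu>)" "N \<sigma> (mul m g) \<le> C * N \<tau> g"
proof -
  have le: "norm (m \<nu> * coef g \<nu>) * exp (\<sigma> * |\<nu>|\<^sub>h) \<le> C * (norm (coef g \<nu>) * exp (\<tau> * |\<nu>|\<^sub>h))" for \<nu>
    using mult_left_mono[OF m[of \<nu>], of "norm (coef g \<nu>)"] by (simp add: norm_mult algebra_simps)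
  have hs: "((\<lambda>\<nu>. C * (norm (coef g \<nu>) * exp (\<tau> * |\<nu>|\<^sub>h))) has_sum C * N \<tau> g) UNIV"
    by (intro has_sum_cmult_right N_has_sum assms)
  have ws: "wsum \<sigma> (\<lambda>\<nu>. m \<nu> * coef g \<nu>)" unfolding wsum_def
    using summable_on_comparison_test[OF has_sum_imp_summable[OF hs] le] by auto
  have "((\<lambda>\<nu>. m \<nu> * coef g \<nu> * character \<nu> \<theta>) has_sum mul m g \<theta>) UNIV" for \<theta>
  proof -
    have "norm (m \<nu> * coef g \<nu> * character \<nu> \<theta>) = norm (m \<nu> * coef g \<nu>)" for \<nu>
      by (simp add: norm_mult)
    then have "(\<lambda>\<nu>. norm (m \<nu> * coef g \<nu> * character \<nu> \<theta>)) summable_on UNIV"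
      using wsum_abs_sum[OF assms(1) ws] unfolding abs_sum_def by (simp only:)
    then show ?thesis unfolding mul_def by (rule has_sum_infsum[OF abs_summable_summable])
  qed
  from A_I[OF assms(1) ws this]
  show 1: "mul m g \<in> A \<sigma>" and 2: "coef (mul m g) = (\<lambda>\<nu>. m \<nu> * coef g \<nu>)" by auto
  show "N \<sigma> (mul m g) \<le> C * N \<tau> g"
    by (rule N_le_has_sum[OF 1 hs]) (use 2 le in auto)
qed

lemma mul_A_contract:
  assumes "0 \<le> \<sigma>" "g \<in> A \<sigma>" and m: "\<And>\<nu>. norm (m \<nu>) \<le> C"
  shows "mul m g \<in> A \<sigma>" "coef (mul m g) = (\<lambda>\<nu>. m \<nu> * coef g \<nu>)" "N \<sigma> (mul m g) \<le> C * N \<sigma> g"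
  using mul_A[OF assms(1,2), of m C] m by (auto intro: mult_right_mono)

lemma A_finite_support:
  assumes "finite S" "0 \<le> \<sigma>" "\<And>\<theta>. g \<theta> = (\<Sum>\<nu>\<in>S. c \<nu> * character \<nu> \<theta>)"
  shows "g \<in> A \<sigma>" "coef g = (\<lambda>\<nu>. if \<nu> \<in> S then c \<nu> else 0)"
    "N \<sigma> g = (\<Sum>\<nu>\<in>S. norm (c \<nu>) * exp (\<sigma> * |\<nu>|\<^sub>h))"
proof -
  let ?F = "\<lambda>\<nu>. if \<nu> \<in> S then c \<nu> else 0"
  have hs: "((\<lambda>\<nu>. norm (?F \<nu>) * exp (\<sigma> * |\<nu>|\<^sub>h)) has_sum
     (\<Sum>\<nu>\<in>S. norm (c \<nu>) * exp (\<sigma> * |\<nu>|\<^sub>h))) UNIV"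
    using assms(1) by (intro has_sum_finite_neutralI[of S]) auto
  then have ws: "wsum \<sigma> ?F" unfolding wsum_def by (rule has_sum_imp_summable)
  have rep: "((\<lambda>\<nu>. ?F \<nu> * character \<nu> \<theta>) has_sum g \<theta>) UNIV" for \<theta>
    using assms(1) by (intro has_sum_finite_neutralI[of S]) (auto simp: assms(3))
  from A_I[OF assms(2) ws rep] show 1: "g \<in> A \<sigma>" and 2: "coef g = ?F" by auto
  show "N \<sigma> g = (\<Sum>\<nu>\<in>S. norm (c \<nu>) * exp (\<sigma> * |\<nu>|\<^sub>h))"
    using hs unfolding N_def 2 by (rule infsumI)
qed

abbreviation cst :: "complex \<Rightarrow> tfun" where "cst c \<equiv> (\<lambda>_. c)"

lemma A_cst [simp]: "0 \<le> \<sigma> \<Longrightarrow> cst c \<in> A \<sigma>"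
  and coef_cst: "coef (cst c) = (\<lambda>\<nu>. if \<nu> = 0 then c else 0)"
  and N_cst [simp]: "0 \<le> \<sigma> \<Longrightarrow> N \<sigma> (cst c) = norm c"
  using A_finite_support[of "{0}" \<sigma> "cst c" "\<lambda>_. c"]
    A_finite_support(2)[of "{0}" 0 "cst c" "\<lambda>_. c"] by (auto simp: fun_eq_iff)

lemma A_character [simp]: "0 \<le> \<sigma> \<Longrightarrow> character \<nu> \<in> A \<sigma>"
  and coef_character: "coef (character \<nu>) = (\<lambda>\<mu>. if \<mu> = \<nu> then 1 else 0)"
  and N_character: "0 \<le> \<sigma> \<Longrightarrow> N \<sigma> (character \<nu>) = exp (\<sigma> * |\<nu>|\<^sub>h)"
  using A_finite_support[of "{\<nu>}" \<sigma> "character \<nu>" "\<lambda>_. 1"]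
    A_finite_support(2)[of "{\<nu>}" 0 "character \<nu>" "\<lambda>_. 1"] by (auto simp: fun_eq_iff)

lemma A_0 [simp]: "0 \<le> \<sigma> \<Longrightarrow> 0 \<in> A \<sigma>" and N_0 [simp]: "0 \<le> \<sigma> \<Longrightarrow> N \<sigma> 0 = 0"
  and A_1 [simp]: "0 \<le> \<sigma> \<Longrightarrow> 1 \<in> A \<sigma>" and N_1 [simp]: "0 \<le> \<sigma> \<Longrightarrow> N \<sigma> 1 = 1"
  using A_cst[of \<sigma> 0] N_cst[of \<sigma> 0] A_cst[of \<sigma> 1] N_cst[of \<sigma> 1]
  by (simp_all add: zero_fun_def one_fun_def)

text \<open>The coefficients of a product are the convolution of the coefficients, and the weight is
  submultiplicative because the star-norm is subadditive.\<close>

lemma A_mult: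
  assumes "0 \<le> \<sigma>" "f \<in> A \<sigma>" "g \<in> A \<sigma>"
  shows "f * g \<in> A \<sigma>" "N \<sigma> (f * g) \<le> N \<sigma> f * N \<sigma> g"
    "((\<lambda>\<mu>. coef f \<mu> * coef g (\<nu> - \<mu>)) has_sum coef (f * g) \<nu>) UNIV"
proof -
  let ?F = "coef f" and ?G = "coef g"
  let ?w = "\<lambda>\<nu>. exp (\<sigma> * |\<nu>|\<^sub>h)"
  let ?a = "\<lambda>\<nu>. norm (?F \<nu>) * ?w \<nu>" and ?b = "\<lambda>\<nu>. norm (?G \<nu>) * ?w \<nu>"
  let ?f = "\<lambda>\<mu> \<nu>. ?a \<mu> * ?b (\<nu> - \<mu>)"
  define p where "p = (\<lambda>\<nu>. \<Sum>\<^sub>\<infinity>\<mu>. ?f \<mu> \<nu>)"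
  have f0: "0 \<le> ?f \<mu> \<nu>" for \<mu> \<nu> by simp
  have shift: "((\<lambda>\<nu>. k (\<nu> - \<mu>)) has_sum c) UNIV" if "(k has_sum c) UNIV"
    for k :: "freq \<Rightarrow> 'z::real_normed_vector" and c \<mu>
    using has_sum_shift[of k "- \<mu>" c] that by simp
  have in1: "(?f \<mu> has_sum ?a \<mu> * N \<sigma> g) UNIV" for \<mu>
    by (rule has_sum_cmult_right[OF shift[OF N_has_sum[OF assms(3)]]])
  note dbl = nonneg_double_sum[OF f0 in1 has_sum_cmult_left[OF N_has_sum[OF assms(2)]]]
  have pin: "((\<lambda>\<mu>. ?f \<mu> \<nu>) has_sum p \<nu>) UNIV" for \<nu> unfolding p_def by (rule dbl(2))
  have p: "(p has_sum N \<sigma> f * N \<sigma> g) UNIV" unfolding p_def by (rule dbl(3))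
  have w1: "1 \<le> ?w \<nu>" for \<nu> using assms(1) by simp
  have wle: "?w \<nu> \<le> ?w \<mu> * ?w (\<nu> - \<mu>)" for \<nu> \<mu>
    using mult_left_mono[OF size_add_le[of \<mu> "\<nu> - \<mu>"] assms(1)]
    by (simp add: algebra_simps flip: exp_add)
  have le0: "norm (?F \<mu> * ?G (\<nu> - \<mu>)) * ?w \<nu> \<le> ?f \<mu> \<nu>" for \<nu> \<mu>
    using mult_left_mono[OF wle[of \<nu> \<mu>], of "norm (?F \<mu> * ?G (\<nu> - \<mu>))"]
    by (simp add: norm_mult algebra_simps)
  have le1: "norm (?F \<mu> * ?G (\<nu> - \<mu>)) \<le> ?f \<mu> \<nu>" for \<nu> \<mu>
    using order_trans[OF mult_left_mono[OF w1 norm_ge_zero] le0] by simp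
  define H where "H = (\<lambda>\<nu>. \<Sum>\<^sub>\<infinity>\<mu>. ?F \<mu> * ?G (\<nu> - \<mu>))"
  have Hin: "((\<lambda>\<mu>. ?F \<mu> * ?G (\<nu> - \<mu>)) has_sum H \<nu>) UNIV" for \<nu>
    unfolding H_def
    by (rule has_sum_infsum[OF abs_summable_summable[OF
          Infinite_Sum.abs_summable_on_comparison_test'[OF has_sum_imp_summable[OF pin] le1]]])
  have Hle: "norm (H \<nu>) * ?w \<nu> \<le> p \<nu>" for \<nu>
  proof -
    have "norm (H \<nu> * of_real (?w \<nu>)) \<le> p \<nu>"
      by (rule norm_infsum_le[OF has_sum_cmult_left[OF Hin] pin])
         (use le0 in \<open>simp add: norm_mult\<close>)
    then show ?thesis by (simp add: norm_mult)
  qed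
  have ws: "wsum \<sigma> H" unfolding wsum_def
    using summable_on_comparison_test[OF has_sum_imp_summable[OF p] Hle] by auto
  have rep: "((\<lambda>\<nu>. H \<nu> * character \<nu> \<theta>) has_sum (f * g) \<theta>) UNIV" for \<theta>
  proof -
    let ?t = "\<lambda>\<mu> \<nu>. ?F \<mu> * ?G (\<nu> - \<mu>) * character \<nu> \<theta>"
    have "?t \<mu> = (\<lambda>\<nu>. ?F \<mu> * character \<mu> \<theta> * (?G (\<nu> - \<mu>) * character (\<nu> - \<mu>) \<theta>))" for \<mu>
    proof
      fix \<nu>
      show "?t \<mu> \<nu> = ?F \<mu> * character \<mu> \<theta> * (?G (\<nu> - \<mu>) * character (\<nu> - \<mu>) \<theta>)"
        using character_add[of \<mu> "\<nu> - \<mu>" \<theta>] by simp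
    qed
    then have t1: "(?t \<mu> has_sum ?F \<mu> * character \<mu> \<theta> * g \<theta>) UNIV" for \<mu>
      using has_sum_cmult_right[OF shift[OF A_has_sum[OF assms(3)]]] by simp
    have "((\<lambda>\<nu>. H \<nu> * character \<nu> \<theta>) has_sum f \<theta> * g \<theta>) UNIV"
      by (rule dominated_double_sum[OF dbl(1) _ t1 has_sum_cmult_left[OF A_has_sum[OF assms(2)]]
            has_sum_cmult_left[OF Hin]]) (use le1 in \<open>simp add: norm_mult\<close>)
    then show ?thesis by (simp add: fun_apply)
  qed
  from A_I[OF assms(1) ws, of "f * g"] rep have 1: "f * g \<in> A \<sigma>" and 2: "coef (f * g) = H" by auto
  show "f * g \<in> A \<sigma>" by (rule 1)
  show "((\<lambda>\<mu>. ?F \<mu> * ?G (\<nu> - \<mu>)) has_sum coef (f * g) \<nu>) UNIV" using Hin 2 by simp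
  show "N \<sigma> (f * g) \<le> N \<sigma> f * N \<sigma> g"
    by (rule N_le_has_sum[OF 1 p]) (use 2 Hle in simp)
qed

lemma A_uminus:
  assumes "0 \<le> \<sigma>" "g \<in> A \<sigma>"
  shows "- g \<in> A \<sigma>" "coef (- g) = (\<lambda>\<nu>. - coef g \<nu>)" "N \<sigma> (- g) = N \<sigma> g"
proof -
  have "mul (\<lambda>_. -1) g = - g"
  proof
    fix \<theta>
    show "mul (\<lambda>_. -1) g \<theta> = (- g) \<theta>"
      using A_has_sum[OF assms(2), of \<theta>] by (simp add: mul_def has_sum_iff infsum_uminus fun_apply)
  qed
  with mul_A_contract[OF assms, of "\<lambda>_. -1" 1]
  show "- g \<in> A \<sigma>" "coef (- g) = (\<lambda>\<nu>. - coef g \<nu>)" by auto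
  then show "N \<sigma> (- g) = N \<sigma> g" by (simp add: N_def)
qed

lemma A_diff:
  assumes "0 \<le> \<sigma>" "f \<in> A \<sigma>" "g \<in> A \<sigma>"
  shows "f - g \<in> A \<sigma>" "coef (f - g) = (\<lambda>\<nu>. coef f \<nu> - coef g \<nu>)" "N \<sigma> (f - g) \<le> N \<sigma> f + N \<sigma> g"
  using A_add[OF assms(1,2) A_uminus(1)[OF assms(1,3)]] A_uminus[OF assms(1,3)] by auto

lemma A_sum:
  assumes "0 \<le> \<sigma>" "\<And>i. i \<in> I \<Longrightarrow> g i \<in> A \<sigma>"
  shows "(\<Sum>i\<in>I. g i) \<in> A \<sigma>" "coef (\<Sum>i\<in>I. g i) \<nu> = (\<Sum>i\<in>I. coef (g i) \<nu>)"
    "N \<sigma> (\<Sum>i\<in>I. g i) \<le> (\<Sum>i\<in>I. N \<sigma> (g i))"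
proof -
  have "(\<Sum>i\<in>I. g i) \<in> A \<sigma> \<and> coef (\<Sum>i\<in>I. g i) \<nu> = (\<Sum>i\<in>I. coef (g i) \<nu>) \<and>
     N \<sigma> (\<Sum>i\<in>I. g i) \<le> (\<Sum>i\<in>I. N \<sigma> (g i))"
    using assms(2)
  proof (induction I rule: infinite_finite_induct)
    case (insert i I)
    then have "g i \<in> A \<sigma>" "(\<Sum>i\<in>I. g i) \<in> A \<sigma>" by auto
    from A_add[OF assms(1) this] insert show ?case by auto
  qed (use assms(1) coef_cst[of 0] in \<open>auto simp: zero_fun_def\<close>)
  then show "(\<Sum>i\<in>I. g i) \<in> A \<sigma>" "coef (\<Sum>i\<in>I. g i) \<nu> = (\<Sum>i\<in>I. coef (g i) \<nu>)"
    "N \<sigma> (\<Sum>i\<in>I. g i) \<le> (\<Sum>i\<in>I. N \<sigma> (g i))" by auto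
qed

lemma A_cmult:
  assumes "0 \<le> \<sigma>" "g \<in> A \<sigma>"
  shows "cst c * g \<in> A \<sigma>" "coef (cst c * g) = (\<lambda>\<nu>. c * coef g \<nu>)" "N \<sigma> (cst c * g) \<le> norm c * N \<sigma> g"
proof -
  have "mul (\<lambda>_. c) g = cst c * g"
  proof
    fix \<theta>
    show "mul (\<lambda>_. c) g \<theta> = (cst c * g) \<theta>"
      using has_sum_cmult_right[OF A_has_sum[OF assms(2), of \<theta>], of c]
      by (simp add: mul_def has_sum_iff mult.assoc fun_apply)
  qed
  with mul_A_contract[OF assms, of "\<lambda>_. c" "norm c"]
  show "cst c * g \<in> A \<sigma>" "coef (cst c * g) = (\<lambda>\<nu>. c * coef g \<nu>)" "N \<sigma> (cst c * g) \<le> norm c * N \<sigma> g"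
    by auto
qed

text \<open>Completeness, in the form needed for the exponential series and for the limit of the iteration.\<close>

lemma A_suminf:
  fixes g :: "nat \<Rightarrow> tfun"
  assumes "0 \<le> \<sigma>" "\<And>k. g k \<in> A \<sigma>" "summable (\<lambda>k. N \<sigma> (g k))" "\<And>\<theta>. (\<lambda>k. g k \<theta>) sums G \<theta>"
  shows "G \<in> A \<sigma>" "(\<lambda>k. coef (g k) \<nu>) sums coef G \<nu>" "N \<sigma> G \<le> suminf (\<lambda>k. N \<sigma> (g k))"
proof -
  let ?w = "\<lambda>\<nu>. exp (\<sigma> * |\<nu>|\<^sub>h)"
  let ?S = "suminf (\<lambda>k. N \<sigma> (g k))"
  have S: "((\<lambda>k. N \<sigma> (g k)) has_sum ?S) UNIV"
    by (rule sums_nonneg_imp_has_sum) (use assms(3) in auto)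
  define p where "p = (\<lambda>\<nu>. \<Sum>\<^sub>\<infinity>k. norm (coef (g k) \<nu>) * ?w \<nu>)"
  have f0: "0 \<le> norm (coef (g k) \<nu>) * ?w \<nu>" for k \<nu> by simp
  note dbl = nonneg_double_sum[OF f0 N_has_sum[OF assms(2)] S]
  have pin: "((\<lambda>k. norm (coef (g k) \<nu>) * ?w \<nu>) has_sum p \<nu>) UNIV" for \<nu> unfolding p_def by (rule dbl(2))
  have p: "(p has_sum ?S) UNIV" unfolding p_def by (rule dbl(3))
  define H where "H = (\<lambda>\<nu>. \<Sum>\<^sub>\<infinity>k. coef (g k) \<nu>)"
  have w1: "1 \<le> ?w \<nu>" for \<nu> using assms(1) by simp
  have le1: "norm (coef (g k) \<nu>) \<le> norm (coef (g k) \<nu>) * ?w \<nu>" for k \<nu>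
    using mult_left_mono[OF w1 norm_ge_zero] by simp
  have Hin: "((\<lambda>k. coef (g k) \<nu>) has_sum H \<nu>) UNIV" for \<nu>
    unfolding H_def
    by (rule has_sum_infsum[OF abs_summable_summable[OF
          Infinite_Sum.abs_summable_on_comparison_test'[OF has_sum_imp_summable[OF pin] le1]]])
  have Hle: "norm (H \<nu>) * ?w \<nu> \<le> p \<nu>" for \<nu>
  proof -
    have "norm (H \<nu> * of_real (?w \<nu>)) \<le> p \<nu>"
      by (rule norm_infsum_le[OF has_sum_cmult_left[OF Hin] pin]) (simp add: norm_mult)
    then show ?thesis by (simp add: norm_mult)
  qed
  have ws: "wsum \<sigma> H" unfolding wsum_def
    using summable_on_comparison_test[OF has_sum_imp_summable[OF p] Hle] by auto
  have rep: "((\<lambda>\<nu>. H \<nu> * character \<nu> \<theta>) has_sum G \<theta>) UNIV" for \<theta>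
  proof -
    have "norm (g k \<theta>) \<le> N \<sigma> (g k)" for k using norm_le_N assms(1,2) by blast
    then have "summable (\<lambda>k. norm (g k \<theta>))"
      by (intro summable_comparison_test[OF _ assms(3)]) auto
    then have out: "((\<lambda>k. g k \<theta>) has_sum G \<theta>) UNIV"
      using norm_summable_imp_has_sum[OF _ assms(4)] by blast
    show ?thesis
      by (rule dominated_double_sum[OF dbl(1) _ A_has_sum[OF assms(2)] out has_sum_cmult_left[OF Hin]])
         (use le1 in \<open>simp add: norm_mult\<close>)
  qed
  from A_I[OF assms(1) ws rep] have 1: "G \<in> A \<sigma>" and 2: "coef G = H" by auto
  show "G \<in> A \<sigma>" by (rule 1)
  show "(\<lambda>k. coef (g k) \<nu>) sums coef G \<nu>" using has_sum_imp_sums[OF Hin] 2 by simp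
  show "N \<sigma> G \<le> ?S" by (rule N_le_has_sum[OF 1 p]) (use 2 Hle in simp)
qed

lemma A_power:
  assumes "0 \<le> \<sigma>" "g \<in> A \<sigma>"
  shows "g ^ k \<in> A \<sigma>" "N \<sigma> (g ^ k) \<le> N \<sigma> g ^ k"
proof -
  have "g ^ k \<in> A \<sigma> \<and> N \<sigma> (g ^ k) \<le> N \<sigma> g ^ k"
  proof (induction k)
    case (Suc k)
    then have 1: "g * g ^ k \<in> A \<sigma>" "N \<sigma> (g * g ^ k) \<le> N \<sigma> g * N \<sigma> (g ^ k)"
      and "N \<sigma> g * N \<sigma> (g ^ k) \<le> N \<sigma> g * N \<sigma> g ^ k"
      using A_mult[OF assms(1,2), of "g ^ k"] by (auto intro: mult_left_mono)
    then show ?case unfolding power_Suc using order_trans by blast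
  qed (use assms in auto)
  then show "g ^ k \<in> A \<sigma>" "N \<sigma> (g ^ k) \<le> N \<sigma> g ^ k" by auto
qed

lemma power_fun_apply [simp]: "(g ^ k) \<theta> = (g \<theta> :: complex) ^ k"
  by (induction k) (auto simp: fun_apply)

definition fexp :: "tfun \<Rightarrow> tfun" where "fexp g = (\<lambda>\<theta>. exp (g \<theta>))"

lemma A_exp_term:
  assumes "0 \<le> \<sigma>" "g \<in> A \<sigma>"
  shows "cst (1 / fact k) * g ^ k \<in> A \<sigma>" "N \<sigma> (cst (1 / fact k) * g ^ k) \<le> N \<sigma> g ^ k / fact k"
  using A_cmult[OF assms(1) A_power(1)[OF assms], of "1 / fact k" k]
    mult_left_mono[OF A_power(2)[OF assms, of k], of "1 / fact k"] by (auto simp: norm_divide)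

lemma exp_sums: "(\<lambda>k. x ^ k / fact k) sums exp (x :: real)"
  using exp_converges[of x] by (simp add: field_simps)

lemma exp_sums_complex: "(\<lambda>k. 1 / fact k * x ^ k) sums exp (x :: complex)"
  using exp_converges[of x] by (simp add: scaleR_conv_of_real field_simps)

lemma A_fexp:
  assumes "0 \<le> \<sigma>" "g \<in> A \<sigma>"
  shows "fexp g \<in> A \<sigma>" "N \<sigma> (fexp g) \<le> exp (N \<sigma> g)"
    "(\<lambda>k. coef (cst (1 / fact k) * g ^ k) \<nu>) sums coef (fexp g) \<nu>"
proof -
  let ?t = "\<lambda>k. cst (1 / fact k) * g ^ k"
  have sm: "summable (\<lambda>k. N \<sigma> (?t k))"
    by (rule summable_comparison_test[OF _ sums_summable[OF exp_sums[of "N \<sigma> g"]]])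
       (use A_exp_term(2)[OF assms] in auto)
  note * = A_suminf[OF assms(1) A_exp_term(1)[OF assms] sm, of "fexp g"]
  show "fexp g \<in> A \<sigma>" by (rule *) (use exp_sums_complex in \<open>simp add: fexp_def fun_apply\<close>)
  show "(\<lambda>k. coef (cst (1 / fact k) * g ^ k) \<nu>) sums coef (fexp g) \<nu>"
    by (rule *) (use exp_sums_complex in \<open>simp add: fexp_def fun_apply\<close>)
  have "N \<sigma> (fexp g) \<le> suminf (\<lambda>k. N \<sigma> (?t k))"
    by (rule *) (use exp_sums_complex in \<open>simp add: fexp_def fun_apply\<close>)
  also have "\<dots> \<le> suminf (\<lambda>k. N \<sigma> g ^ k / fact k)"
    by (rule suminf_le[OF A_exp_term(2)[OF assms] sm sums_summable[OF exp_sums]])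
  also have "\<dots> = exp (N \<sigma> g)" using exp_sums sums_unique by metis
  finally show "N \<sigma> (fexp g) \<le> exp (N \<sigma> g)" .
qed

text \<open>The series starts with the quadratic term, and \<open>fact (k + 2) \<ge> fact k\<close>.\<close>

lemma A_fexp_remainder:
  assumes "0 \<le> \<sigma>" "g \<in> A \<sigma>"
  shows "fexp g - 1 - g \<in> A \<sigma>" "N \<sigma> (fexp g - 1 - g) \<le> (N \<sigma> g)\<^sup>2 * exp (N \<sigma> g)"
proof -
  let ?t = "\<lambda>k. cst (1 / fact (k + 2)) * g ^ (k + 2)"
  let ?b = "\<lambda>k. (N \<sigma> g)\<^sup>2 * (N \<sigma> g ^ k / fact k)"
  have le: "N \<sigma> (?t k) \<le> ?b k" for k
  proof -
    have "N \<sigma> (?t k) \<le> N \<sigma> g ^ (k + 2) / fact (k + 2)" by (rule A_exp_term(2)[OF assms])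
    also have "\<dots> \<le> N \<sigma> g ^ (k + 2) / fact k"
      by (intro divide_left_mono fact_mono) auto
    finally show ?thesis by (simp add: power_add power2_eq_square mult_ac)
  qed
  have bs: "?b sums ((N \<sigma> g)\<^sup>2 * exp (N \<sigma> g))" by (rule sums_mult[OF exp_sums])
  have sm: "summable (\<lambda>k. N \<sigma> (?t k))"
    by (rule summable_comparison_test[OF _ sums_summable[OF bs]]) (use le in auto)
  have pt: "(\<lambda>k. ?t k \<theta>) sums (fexp g - 1 - g) \<theta>" for \<theta>
    using sums_split_initial_segment[OF exp_sums_complex[of "g \<theta>"], of 2]
    by (simp add: fexp_def numeral_2_eq_2 fun_apply diff_diff_eq)
  note * = A_suminf[OF assms(1) A_exp_term(1)[OF assms] sm pt]
  show "fexp g - 1 - g \<in> A \<sigma>" by (rule *)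
  have "N \<sigma> (fexp g - 1 - g) \<le> suminf (\<lambda>k. N \<sigma> (?t k))" by (rule *)
  also have "\<dots> \<le> suminf ?b" by (rule suminf_le[OF le sm sums_summable[OF bs]])
  also have "\<dots> = (N \<sigma> g)\<^sup>2 * exp (N \<sigma> g)" using bs sums_unique by metis
  finally show "N \<sigma> (fexp g - 1 - g) \<le> (N \<sigma> g)\<^sup>2 * exp (N \<sigma> g)" .
qed


section \<open>Entire functions and derivations\<close>

text \<open>All functions of the iteration lie in this class: it is closed under the ring operations, the
  exponential, differentiation and division by divisors that stay away from zero.  Widths
  therefore occur only in norm estimates.\<close>

definition entire :: "tfun set" where "entire = {g. \<forall>\<sigma>\<ge>0. g \<in> A \<sigma>}"

lemma entireD: "g \<in> entire \<Longrightarrow> 0 \<le> \<sigma> \<Longrightarrow> g \<in> A \<sigma>"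
  by (simp add: entire_def)

lemma entire_add [intro, simp]: "f \<in> entire \<Longrightarrow> g \<in> entire \<Longrightarrow> f + g \<in> entire"
  and entire_diff [intro, simp]: "f \<in> entire \<Longrightarrow> g \<in> entire \<Longrightarrow> f - g \<in> entire"
  and entire_uminus [intro, simp]: "f \<in> entire \<Longrightarrow> - f \<in> entire"
  and entire_mult [intro, simp]: "f \<in> entire \<Longrightarrow> g \<in> entire \<Longrightarrow> f * g \<in> entire"
  and entire_sum [intro, simp]: "(\<And>i. i \<in> I \<Longrightarrow> u i \<in> entire) \<Longrightarrow> (\<Sum>i\<in>I. u i) \<in> entire"
  and entire_fexp [intro, simp]: "f \<in> entire \<Longrightarrow> fexp f \<in> entire"
  by (auto simp: entire_def intro: A_add A_diff A_uminus A_mult A_sum A_fexp)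

lemma entire_cst [intro, simp]: "cst c \<in> entire"
  and entire_0 [intro, simp]: "0 \<in> entire"
  and entire_1 [intro, simp]: "1 \<in> entire"
  and entire_character [intro, simp]: "character \<nu> \<in> entire"
  by (auto simp: entire_def)

lemma entire_power [intro, simp]: "f \<in> entire \<Longrightarrow> f ^ k \<in> entire"
  by (induction k) auto

lemma entire_eqI:
  assumes "f \<in> entire" "g \<in> entire" "\<And>\<nu>. coef f \<nu> = coef g \<nu>"
  shows "f = g"
  using A_eqI[OF entireD entireD] assms by (metis order_refl)

lemma coef_entire:
  "f \<in> entire \<Longrightarrow> g \<in> entire \<Longrightarrow> coef (f + g) \<nu> = coef f \<nu> + coef g \<nu>"
  "f \<in> entire \<Longrightarrow> g \<in> entire \<Longrightarrow> coef (f - g) \<nu> = coef f \<nu> - coef g \<nu>"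
  "f \<in> entire \<Longrightarrow> coef (- f) \<nu> = - coef f \<nu>"
  "f \<in> entire \<Longrightarrow> coef (cst c * f) \<nu> = c * coef f \<nu>"
  by (simp_all add: A_add(2)[of 0] A_diff(2)[of 0] A_uminus(2)[of 0] A_cmult(2)[of 0] entireD)

lemma coef_entire_sum: "(\<And>i. i \<in> I \<Longrightarrow> u i \<in> entire) \<Longrightarrow> coef (\<Sum>i\<in>I. u i) \<nu> = (\<Sum>i\<in>I. coef (u i) \<nu>)"
  by (intro A_sum(2)[of 0]) (auto simp: entireD)

text \<open>Symbols of at most exponential growth; they preserve \<open>entire\<close>.\<close>

definition tame :: "(freq \<Rightarrow> complex) \<Rightarrow> bool" where
  "tame m \<longleftrightarrow> (\<exists>C b. 0 \<le> b \<and> (\<forall>\<nu>. norm (m \<nu>) \<le> C * exp (b * |\<nu>|\<^sub>h)))"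

lemma entire_mul:
  assumes "tame m" "g \<in> entire"
  shows "mul m g \<in> entire" "coef (mul m g) \<nu> = m \<nu> * coef g \<nu>"
proof -
  from assms(1) obtain C b where b: "0 \<le> b" "\<And>\<nu>. norm (m \<nu>) \<le> C * exp (b * |\<nu>|\<^sub>h)"
    by (auto simp: tame_def)
  have le: "norm (m \<nu>) * exp (\<sigma> * |\<nu>|\<^sub>h) \<le> C * exp ((\<sigma> + b) * |\<nu>|\<^sub>h)" for \<sigma> \<nu>
    using mult_right_mono[OF b(2), of "exp (\<sigma> * |\<nu>|\<^sub>h)" \<nu>] by (simp add: algebra_simps exp_add)
  show "mul m g \<in> entire"
    using mul_A(1)[OF _ entireD[OF assms(2)] le] b(1) by (auto simp: entire_def)
  show "coef (mul m g) \<nu> = m \<nu> * coef g \<nu>"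
    using mul_A(2)[OF order_refl entireD[OF assms(2)] le[of _ 0]] b(1) by simp
qed

lemma tame_bounded: "(\<And>\<nu>. norm (m \<nu>) \<le> C) \<Longrightarrow> tame m"
  unfolding tame_def by (intro exI[of _ C] exI[of _ 0]) auto

lemma tame_mult:
  assumes "tame m" "tame k"
  shows "tame (\<lambda>\<nu>. m \<nu> * k \<nu>)"
proof -
  from assms obtain C b C' b' where b: "0 \<le> b" "\<And>\<nu>. norm (m \<nu>) \<le> C * exp (b * |\<nu>|\<^sub>h)"
    "0 \<le> b'" "\<And>\<nu>. norm (k \<nu>) \<le> C' * exp (b' * |\<nu>|\<^sub>h)"
    by (auto simp: tame_def)
  have "norm (m \<nu> * k \<nu>) \<le> (C * C') * exp ((b + b') * |\<nu>|\<^sub>h)" for \<nu>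
  proof -
    have "norm (m \<nu> * k \<nu>) \<le> (C * exp (b * |\<nu>|\<^sub>h)) * (C' * exp (b' * |\<nu>|\<^sub>h))"
      unfolding norm_mult using b(2)[of \<nu>] order_trans[OF norm_ge_zero b(2)[of \<nu>]]
      by (intro mult_mono b) auto
    then show ?thesis by (simp add: algebra_simps exp_add)
  qed
  then show ?thesis unfolding tame_def using b(1,3) by (intro exI[of _ "C * C'"] exI[of _ "b + b'"]) auto
qed

lemma mul_add: "tame m \<Longrightarrow> f \<in> entire \<Longrightarrow> g \<in> entire \<Longrightarrow> mul m (f + g) = mul m f + mul m g"
  by (rule entire_eqI) (auto simp: entire_mul coef_entire algebra_simps)

lemma mul_diff: "tame m \<Longrightarrow> f \<in> entire \<Longrightarrow> g \<in> entire \<Longrightarrow> mul m (f - g) = mul m f - mul m g"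
  by (rule entire_eqI) (auto simp: entire_mul coef_entire algebra_simps)

lemma mul_uminus: "tame m \<Longrightarrow> f \<in> entire \<Longrightarrow> mul m (- f) = - mul m f"
  by (rule entire_eqI) (auto simp: entire_mul coef_entire algebra_simps)

lemma mul_cmult: "tame m \<Longrightarrow> f \<in> entire \<Longrightarrow> mul m (cst c * f) = cst c * mul m f"
  by (rule entire_eqI) (auto simp: entire_mul coef_entire)

lemma mul_sum: "tame m \<Longrightarrow> (\<And>i. i \<in> I \<Longrightarrow> u i \<in> entire) \<Longrightarrow> mul m (\<Sum>i\<in>I. u i) = (\<Sum>i\<in>I. mul m (u i))"
  by (rule entire_eqI) (auto simp: entire_mul coef_entire_sum sum_distrib_left)

lemma mul_zero [simp]: "mul m 0 = 0"
  using coef_cst[of 0] by (auto simp: mul_def zero_fun_def fun_eq_iff)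

lemma mul_mul: "tame m \<Longrightarrow> tame k \<Longrightarrow> f \<in> entire \<Longrightarrow> mul m (mul k f) = mul (\<lambda>\<nu>. m \<nu> * k \<nu>) f"
  by (rule entire_eqI) (auto simp: entire_mul tame_mult)

lemma mul_commute: "tame m \<Longrightarrow> tame k \<Longrightarrow> f \<in> entire \<Longrightarrow> mul m (mul k f) = mul k (mul m f)"
  by (simp add: mul_mul mult.commute)

text \<open>Additivity in the frequency is exactly the Leibniz rule, by the convolution formula.\<close>

definition derivation_symbol :: "(freq \<Rightarrow> complex) \<Rightarrow> bool" where
  "derivation_symbol m \<longleftrightarrow> (\<forall>\<nu> \<mu>. m (\<nu> + \<mu>) = m \<nu> + m \<mu>) \<and> (\<exists>C\<ge>0. \<forall>\<nu>. norm (m \<nu>) \<le> C * |\<nu>|\<^sub>h)"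

lemma derivation_tame [simp]: "derivation_symbol m \<Longrightarrow> tame m"
proof -
  assume "derivation_symbol m"
  then obtain C where C: "C \<ge> 0" "\<And>\<nu>. norm (m \<nu>) \<le> C * |\<nu>|\<^sub>h" by (auto simp: derivation_symbol_def)
  have "norm (m \<nu>) \<le> C * exp (1 * |\<nu>|\<^sub>h)" for \<nu>
    using C(2)[of \<nu>] mult_left_mono[OF _ C(1), of "|\<nu>|\<^sub>h" "exp (1 * |\<nu>|\<^sub>h)"] exp_ge_add_one_self[of "|\<nu>|\<^sub>h"]
    by simp
  then show "tame m" unfolding tame_def by (intro exI[of _ C] exI[of _ 1]) auto
qed

lemma derivation_zero: "derivation_symbol m \<Longrightarrow> m 0 = 0"
  unfolding derivation_symbol_def by (metis add.right_neutral add_left_cancel)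

lemma leibniz:
  assumes m: "derivation_symbol m" and "f \<in> entire" "g \<in> entire"
  shows "mul m (f * g) = mul m f * g + f * mul m g"
proof (rule entire_eqI)
  note t = derivation_tame[OF m]
  show "mul m (f * g) \<in> entire" "mul m f * g + f * mul m g \<in> entire"
    using assms t by (auto simp: entire_mul)
  fix \<nu>
  have hs: "((\<lambda>\<mu>. coef a \<mu> * coef b (\<nu> - \<mu>)) has_sum coef (a * b) \<nu>) UNIV"
    if "a \<in> entire" "b \<in> entire" for a b
    using A_mult(3)[of 0 a b \<nu>] that by (simp add: entireD)
  have "((\<lambda>\<mu>. coef (mul m f) \<mu> * coef g (\<nu> - \<mu>) + coef f \<mu> * coef (mul m g) (\<nu> - \<mu>))
      has_sum coef (mul m f * g) \<nu> + coef (f * mul m g) \<nu>) UNIV"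
    using assms t by (intro has_sum_add hs) (auto simp: entire_mul)
  moreover have "coef (mul m f) \<mu> * coef g (\<nu> - \<mu>) + coef f \<mu> * coef (mul m g) (\<nu> - \<mu>)
      = m \<nu> * (coef f \<mu> * coef g (\<nu> - \<mu>))" for \<mu>
  proof -
    have "m (\<mu> + (\<nu> - \<mu>)) = m \<mu> + m (\<nu> - \<mu>)"
      using m unfolding derivation_symbol_def by blast
    then have m\<nu>: "m \<nu> = m \<mu> + m (\<nu> - \<mu>)" by simp
    show ?thesis unfolding m\<nu> using assms t by (simp add: entire_mul algebra_simps)
  qed
  ultimately have "((\<lambda>\<mu>. m \<nu> * (coef f \<mu> * coef g (\<nu> - \<mu>)))
      has_sum coef (mul m f * g) \<nu> + coef (f * mul m g) \<nu>) UNIV" by simp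
  moreover have "((\<lambda>\<mu>. m \<nu> * (coef f \<mu> * coef g (\<nu> - \<mu>))) has_sum m \<nu> * coef (f * g) \<nu>) UNIV"
    by (intro has_sum_cmult_right hs assms)
  ultimately show "coef (mul m (f * g)) \<nu> = coef (mul m f * g + f * mul m g) \<nu>"
    using assms t by (simp add: entire_mul coef_entire has_sum_unique)
qed

lemma derivation_cst: "derivation_symbol m \<Longrightarrow> mul m (cst c) = 0"
  by (rule entire_eqI) (auto simp: entire_mul coef_cst derivation_zero coef_cst[of 0, folded zero_fun_def])

lemma derivation_1: "derivation_symbol m \<Longrightarrow> mul m 1 = 0"
  using derivation_cst[of m 1] by (simp add: one_fun_def)

lemma derivation_power:
  assumes m: "derivation_symbol m" and f: "f \<in> entire"
  shows "mul m (f ^ Suc k) = of_nat (Suc k) * f ^ k * mul m f"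
proof (induction k)
  case (Suc k)
  have "mul m (f ^ Suc (Suc k)) = mul m f * f ^ Suc k + f * mul m (f ^ Suc k)"
    using leibniz[OF m f, of "f ^ Suc k"] f by simp
  also have "\<dots> = of_nat (Suc (Suc k)) * f ^ Suc k * mul m f"
    unfolding Suc.IH by (simp add: algebra_simps)
  finally show ?case .
qed simp

text \<open>Termwise differentiation of the exponential series, compared coefficient by coefficient: both
  sides are limits of the same series, shifted by one.\<close>

lemma derivation_fexp:
  assumes m: "derivation_symbol m" and f: "f \<in> entire"
  shows "mul m (fexp f) = fexp f * mul m f"
proof (rule entire_eqI)
  note t = derivation_tame[OF m]
  show "mul m (fexp f) \<in> entire" "fexp f * mul m f \<in> entire"
    using f t by (auto simp: entire_mul)
  fix \<nu>
  let ?t = "\<lambda>k. cst (1 / fact k) * f ^ k"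
  let ?s = "\<lambda>k. ?t k * mul m f"
  have fA: "f \<in> A 0" "mul m f \<in> A 0" using f t by (auto simp: entireD entire_mul)
  have sA: "?s k \<in> A 0" for k using f t by (intro entireD) (auto simp: entire_mul)
  have le: "N 0 (?s k) \<le> N 0 f ^ k / fact k * N 0 (mul m f)" for k
    using A_mult(2)[OF order_refl A_exp_term(1)[OF order_refl fA(1)] fA(2), of k]
      mult_right_mono[OF A_exp_term(2)[OF order_refl fA(1), of k] N_nonneg, of 0 "mul m f"]
    by linarith
  have sm: "summable (\<lambda>k. N 0 (?s k))"
    by (rule summable_comparison_test[OF _ summable_mult2[OF sums_summable[OF exp_sums[of "N 0 f"]]]])
       (use le in auto)
  have pt: "(\<lambda>k. ?s k \<theta>) sums (fexp f * mul m f) \<theta>" for \<theta>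
    using sums_mult2[OF exp_sums_complex, of "f \<theta>" "mul m f \<theta>"] by (simp add: fexp_def fun_apply)
  have L: "(\<lambda>k. coef (?s k) \<nu>) sums coef (fexp f * mul m f) \<nu>"
    by (rule A_suminf(2)[OF order_refl sA sm pt])
  have "(\<lambda>k. m \<nu> * coef (?t k) \<nu>) sums (m \<nu> * coef (fexp f) \<nu>)"
    by (intro sums_mult A_fexp(3)[OF order_refl fA(1)])
  then have R: "(\<lambda>k. coef (mul m (?t k)) \<nu>) sums coef (mul m (fexp f)) \<nu>"
    using f t by (simp add: entire_mul)
  have t0: "coef (mul m (?t 0)) \<nu> = 0"
  proof -
    have "?t 0 = cst 1" by (simp add: fun_eq_iff fun_apply)
    then show ?thesis using derivation_cst[OF m, of 1] coef_cst[of 0] by (simp add: zero_fun_def)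
  qed
  have tS: "mul m (?t (Suc k)) = ?s k" for k
  proof -
    have "mul m (?t (Suc k)) = cst (1 / fact (Suc k)) * (of_nat (Suc k) * f ^ k * mul m f)"
      using derivation_power[OF m f, of k] f t by (simp add: mul_cmult del: power_Suc fact_Suc)
    also have "\<dots> = ?s k"
    proof
      fix \<theta>
      have "(of_nat (Suc k) :: complex) \<noteq> 0" by (rule of_nat_neq_0)
      then show "(cst (1 / fact (Suc k)) * (of_nat (Suc k) * f ^ k * mul m f)) \<theta> = ?s k \<theta>"
        by (simp add: fun_apply fact_Suc del: of_nat_Suc)
    qed
    finally show ?thesis .
  qed
  have "(\<lambda>k. coef (?s k) \<nu>) sums (coef (mul m (fexp f)) \<nu> - coef (mul m (?t 0)) \<nu>)"
    using sums_split_initial_segment[OF R, of 1] tS by simp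
  with L t0 show "coef (mul m (fexp f)) \<nu> = coef (fexp f * mul m f) \<nu>"
    using sums_unique2 by fastforce
qed

section \<open>Real-valued functions\<close>

definition realv :: "tfun \<Rightarrow> bool" where "realv g \<longleftrightarrow> (\<forall>\<theta>. Im (g \<theta>) = 0)"

text \<open>The conjugate function has the reflected conjugate coefficients, and coefficients are unique.\<close>

lemma coef_real:
  assumes "g \<in> A \<sigma>" "realv g"
  shows "coef g (- \<nu>) = cnj (coef g \<nu>)"
proof -
  have "((\<lambda>\<nu>. cnj (coef g (- \<nu>)) * character \<nu> \<theta>) has_sum g \<theta>) UNIV" for \<theta>
  proof -
    have "cnj (g \<theta>) = g \<theta>" using assms(2) by (simp add: realv_def complex_eq_iff)
    then have "((\<lambda>\<nu>. cnj (coef g \<nu> * character \<nu> \<theta>)) has_sum g \<theta>) UNIV"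
      using A_has_sum[OF assms(1), of \<theta>] has_sum_cnj_iff by metis
    then show ?thesis
      by (subst has_sum_reflect[symmetric]) (simp add: character_uminus)
  qed
  moreover have "abs_sum (\<lambda>\<nu>. cnj (coef g (- \<nu>)))"
    using A_abs_sum[OF assms(1)] has_sum_reflect[of "\<lambda>\<nu>. norm (coef g \<nu>)"]
    unfolding abs_sum_def summable_on_def by simp
  ultimately have "represents (\<lambda>\<nu>. cnj (coef g (- \<nu>))) g" by (simp add: represents_def)
  from coef_eq[OF this] have "coef g \<nu> = cnj (coef g (- \<nu>))" by (rule fun_cong)
  then show ?thesis by simp
qed

lemma real_coefI:
  assumes "\<And>\<nu>. F (- \<nu>) = cnj (F \<nu>)" "\<And>\<theta>. ((\<lambda>\<nu>. F \<nu> * character \<nu> \<theta>) has_sum g \<theta>) UNIV"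
  shows "realv g"
  unfolding realv_def
proof
  fix \<theta>
  have "((\<lambda>\<nu>. cnj (F (- \<nu>) * character (- \<nu>) \<theta>)) has_sum cnj (g \<theta>)) UNIV"
    using has_sum_reflect[THEN iffD2, OF assms(2)] by (subst has_sum_cnj_iff) simp
  then have "((\<lambda>\<nu>. F \<nu> * character \<nu> \<theta>) has_sum cnj (g \<theta>)) UNIV"
    using assms(1) by (simp add: character_uminus)
  with assms(2)[of \<theta>] have "g \<theta> = cnj (g \<theta>)" using has_sum_unique by blast
  then show "Im (g \<theta>) = 0" by (simp add: complex_eq_iff)
qed

lemma real_mul:
  assumes "tame m" "g \<in> entire" "realv g" "\<And>\<nu>. m (- \<nu>) = cnj (m \<nu>)"
  shows "realv (mul m g)"
proof (rule real_coefI)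
  fix \<theta> \<nu>
  show "((\<lambda>\<nu>. coef (mul m g) \<nu> * character \<nu> \<theta>) has_sum mul m g \<theta>) UNIV"
    using entire_mul(1)[OF assms(1,2)] A_has_sum entireD by blast
  show "coef (mul m g) (- \<nu>) = cnj (coef (mul m g) \<nu>)"
    using assms entireD[OF assms(2), of 0] by (simp add: entire_mul coef_real)
qed

lemma real_add: "realv f \<Longrightarrow> realv g \<Longrightarrow> realv (f + g)"
  and real_diff: "realv f \<Longrightarrow> realv g \<Longrightarrow> realv (f - g)"
  and real_uminus: "realv f \<Longrightarrow> realv (- f)"
  and real_mult: "realv f \<Longrightarrow> realv g \<Longrightarrow> realv (f * g)"
  and real_0: "realv 0" and real_1: "realv 1"
  by (auto simp: realv_def fun_apply)

lemma real_sum: "(\<And>i. i \<in> I \<Longrightarrow> realv (u i)) \<Longrightarrow> realv (\<Sum>i\<in>I. u i)"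
  by (induction I rule: infinite_finite_induct) (auto simp: real_0 real_add)

end

section \<open>Derivatives along the flow and along the coordinates\<close>

lemma has_sum_finite_sum:
  fixes f :: "'a \<Rightarrow> 'b \<Rightarrow> 'c::topological_comm_monoid_add"
  assumes "\<And>j. j \<in> J \<Longrightarrow> (f j has_sum s j) B"
  shows "((\<lambda>x. \<Sum>j\<in>J. f j x) has_sum (\<Sum>j\<in>J. s j)) B"
  using assms by (induction J rule: infinite_finite_induct) (auto intro: has_sum_add)

locale small_divisor_setting = star_weighted +
  fixes \<omega> :: "int \<Rightarrow> real" and \<Omega> :: real
  assumes omega_le: "\<bar>\<omega> j\<bar> \<le> \<Omega>"
begin

lemma Omega_nonneg: "0 \<le> \<Omega>"
  using omega_le[of 0] by linarith

definition D :: "tfun \<Rightarrow> tfun" where "D = mul (\<lambda>\<nu>. \<i> * of_real (freq_dot \<omega> \<nu>))"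

definition pd :: "int \<Rightarrow> tfun \<Rightarrow> tfun" where "pd j = mul (\<lambda>\<nu>. \<i> * of_int (lk \<nu> j))"

lemma l1_le: "l1 \<nu> \<le> |\<nu>|\<^sub>h / h 0"
  using l1_le_size[of \<nu>] by (simp add: field_simps)

lemma symbol_D: "derivation_symbol (\<lambda>\<nu>. \<i> * of_real (freq_dot \<omega> \<nu>))"
proof -
  have "\<bar>freq_dot \<omega> \<nu>\<bar> \<le> \<Omega> / h 0 * |\<nu>|\<^sub>h" for \<nu>
    using abs_freq_dot_le[of \<omega> \<Omega> \<nu>] omega_le mult_left_mono[OF l1_le[of \<nu>] Omega_nonneg] by simp
  then show ?thesis unfolding derivation_symbol_def using Omega_nonneg
    by (auto simp: freq_dot_add algebra_simps norm_mult intro!: exI[of _ "\<Omega> / h 0"] divide_nonneg_pos)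
qed

lemma abs_lookup_le: "\<bar>real_of_int (lk \<nu> j)\<bar> \<le> l1 \<nu>"
  using lookup_le_l1[of "{j}" \<nu>] by simp

lemma symbol_pd: "derivation_symbol (\<lambda>\<nu>. \<i> * of_int (lk \<nu> j))"
proof -
  have "\<bar>real_of_int (lk \<nu> j)\<bar> \<le> 1 / h 0 * |\<nu>|\<^sub>h" for \<nu>
    using abs_lookup_le[of \<nu> j] l1_le[of \<nu>] by simp
  then show ?thesis unfolding derivation_symbol_def
    by (auto simp: lookup_add algebra_simps norm_mult intro!: exI[of _ "1 / h 0"] simp: less_imp_le)
qed

lemma entire_D [simp, intro]: "f \<in> entire \<Longrightarrow> D f \<in> entire"
  and entire_pd [simp, intro]: "f \<in> entire \<Longrightarrow> pd j f \<in> entire"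
  by (simp_all add: D_def pd_def entire_mul symbol_D symbol_pd)

lemma coef_D: "f \<in> entire \<Longrightarrow> coef (D f) \<nu> = \<i> * of_real (freq_dot \<omega> \<nu>) * coef f \<nu>"
  and coef_pd: "f \<in> entire \<Longrightarrow> coef (pd j f) \<nu> = \<i> * of_int (lk \<nu> j) * coef f \<nu>"
  by (simp_all add: D_def pd_def entire_mul symbol_D symbol_pd)

lemma D_rules:
  "f \<in> entire \<Longrightarrow> g \<in> entire \<Longrightarrow> D (f + g) = D f + D g"
  "f \<in> entire \<Longrightarrow> g \<in> entire \<Longrightarrow> D (f - g) = D f - D g"
  "f \<in> entire \<Longrightarrow> D (- f) = - D f"
  "(\<And>i. i \<in> I \<Longrightarrow> v i \<in> entire) \<Longrightarrow> D (\<Sum>i\<in>I. v i) = (\<Sum>i\<in>I. D (v i))"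
  "f \<in> entire \<Longrightarrow> D (cst c * f) = cst c * D f"
  "D 0 = 0" "D 1 = 0"
  by (simp_all only: mul_zero D_def mul_add mul_diff mul_uminus leibniz mul_sum mul_cmult derivation_1 symbol_D derivation_tame)

lemma pd_rules:
  "f \<in> entire \<Longrightarrow> g \<in> entire \<Longrightarrow> pd j (f + g) = pd j f + pd j g"
  "f \<in> entire \<Longrightarrow> g \<in> entire \<Longrightarrow> pd j (f - g) = pd j f - pd j g"
  "f \<in> entire \<Longrightarrow> pd j (- f) = - pd j f"
  "(\<And>i. i \<in> I \<Longrightarrow> v i \<in> entire) \<Longrightarrow> pd j (\<Sum>i\<in>I. v i) = (\<Sum>i\<in>I. pd j (v i))"
  "f \<in> entire \<Longrightarrow> pd j (cst c * f) = cst c * pd j f"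
  "pd j 0 = 0" "pd j 1 = 0"
  by (simp_all only: mul_zero pd_def mul_add mul_diff mul_uminus leibniz mul_sum mul_cmult derivation_1 symbol_pd derivation_tame)

lemma D_mult: "f \<in> entire \<Longrightarrow> g \<in> entire \<Longrightarrow> D (f * g) = D f * g + f * D g"
  and pd_mult: "f \<in> entire \<Longrightarrow> g \<in> entire \<Longrightarrow> pd j (f * g) = pd j f * g + f * pd j g"
  by (simp_all only: D_def pd_def leibniz symbol_D symbol_pd)

lemma D_cst: "D (cst c) = 0" and pd_cst: "pd j (cst c) = 0"
  by (simp_all only: D_def pd_def derivation_cst symbol_D symbol_pd)

lemma pd_fexp: "f \<in> entire \<Longrightarrow> pd j (fexp f) = fexp f * pd j f"
  by (simp add: pd_def derivation_fexp symbol_pd)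

lemma pd_character: "pd j (character \<nu>) = cst (\<i> * of_int (lk \<nu> j)) * character \<nu>"
  by (rule entire_eqI) (auto simp: coef_pd coef_entire coef_character)

lemma D_pd: "f \<in> entire \<Longrightarrow> D (pd j f) = pd j (D f)"
  and pd_pd: "f \<in> entire \<Longrightarrow> pd i (pd j f) = pd j (pd i f)"
  by (simp_all add: D_def pd_def mul_commute symbol_D symbol_pd)

lemma coef_D_0: "f \<in> entire \<Longrightarrow> coef (D f) 0 = 0"
  and coef_pd_0: "f \<in> entire \<Longrightarrow> coef (pd j f) 0 = 0"
  by (simp_all add: coef_D coef_pd)

text \<open>The Cauchy estimate in terms of coefficients: a factor \<open>\<bar>\<nu>\<bar>\<close> costs \<open>1 / \<delta>\<close> for a loss of width \<open>\<delta>\<close>.\<close>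

lemma size_exp_le: 
  assumes "0 < \<delta>" shows "|\<nu>|\<^sub>h * exp (\<sigma> * |\<nu>|\<^sub>h) \<le> 1 / \<delta> * exp ((\<sigma> + \<delta>) * |\<nu>|\<^sub>h)"
proof -
  have "\<delta> * |\<nu>|\<^sub>h \<le> exp (\<delta> * |\<nu>|\<^sub>h)" using exp_ge_add_one_self[of "\<delta> * |\<nu>|\<^sub>h"] by linarith
  then have "|\<nu>|\<^sub>h \<le> 1 / \<delta> * exp (\<delta> * |\<nu>|\<^sub>h)" using assms by (simp add: field_simps)
  from mult_right_mono[OF this, of "exp (\<sigma> * |\<nu>|\<^sub>h)"] show ?thesis
    by (simp add: algebra_simps flip: exp_add)
qed

lemma N_D:
  assumes "0 \<le> \<sigma>" "0 < \<delta>" "f \<in> A (\<sigma> + \<delta>)"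
  shows "D f \<in> A \<sigma>" "coef (D f) = (\<lambda>\<nu>. \<i> * of_real (freq_dot \<omega> \<nu>) * coef f \<nu>)"
    "N \<sigma> (D f) \<le> \<Omega> / (h 0 * \<delta>) * N (\<sigma> + \<delta>) f"
proof -
  have "norm (\<i> * of_real (freq_dot \<omega> \<nu>)) * exp (\<sigma> * |\<nu>|\<^sub>h) \<le> \<Omega> / (h 0 * \<delta>) * exp ((\<sigma> + \<delta>) * |\<nu>|\<^sub>h)" for \<nu>
  proof -
    have "norm (\<i> * complex_of_real (freq_dot \<omega> \<nu>)) * exp (\<sigma> * |\<nu>|\<^sub>h) \<le> (\<Omega> * ( |\<nu>|\<^sub>h / h 0)) * exp (\<sigma> * |\<nu>|\<^sub>h)"
      using abs_freq_dot_le[of \<omega> \<Omega> \<nu>] omega_le mult_left_mono[OF l1_le[of \<nu>] Omega_nonneg]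
      by (intro mult_right_mono) (auto simp: norm_mult)
    also have "\<dots> = (\<Omega> / h 0) * ( |\<nu>|\<^sub>h * exp (\<sigma> * |\<nu>|\<^sub>h))" by simp
    also have "\<dots> \<le> (\<Omega> / h 0) * (1 / \<delta> * exp ((\<sigma> + \<delta>) * |\<nu>|\<^sub>h))"
      using Omega_nonneg by (intro mult_left_mono size_exp_le assms) (auto simp: less_imp_le)
    finally show ?thesis by simp
  qed
  from mul_A[OF assms(1,3) this] show "D f \<in> A \<sigma>"
    "coef (D f) = (\<lambda>\<nu>. \<i> * of_real (freq_dot \<omega> \<nu>) * coef f \<nu>)"
    "N \<sigma> (D f) \<le> \<Omega> / (h 0 * \<delta>) * N (\<sigma> + \<delta>) f"
    by (auto simp: D_def)
qed

text \<open>The sum over the directions costs no more than a single derivative, because \<open>\<Sum>\<^sub>j \<bar>\<nu>\<^sub>j\<bar>\<close> is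
  controlled by the star-norm.  This is what puts gradients into \<open>\<ell>\<^sup>1\<close>, uniformly in \<open>J\<close>.\<close>

lemma N_pd_sum:
  assumes "0 \<le> \<sigma>" "0 < \<delta>" "f \<in> entire" "finite J"
  shows "(\<Sum>j\<in>J. N \<sigma> (pd j f)) \<le> 1 / (h 0 * \<delta>) * N (\<sigma> + \<delta>) f"
proof -
  have 1: "((\<lambda>\<nu>. \<Sum>j\<in>J. norm (coef (pd j f) \<nu>) * exp (\<sigma> * |\<nu>|\<^sub>h)) has_sum (\<Sum>j\<in>J. N \<sigma> (pd j f))) UNIV"
    using assms by (intro has_sum_finite_sum N_has_sum entireD) auto
  have 2: "((\<lambda>\<nu>. 1 / (h 0 * \<delta>) * (norm (coef f \<nu>) * exp ((\<sigma> + \<delta>) * |\<nu>|\<^sub>h)))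
     has_sum 1 / (h 0 * \<delta>) * N (\<sigma> + \<delta>) f) UNIV"
    using assms by (intro has_sum_cmult_right N_has_sum entireD) auto
  show ?thesis
  proof (rule has_sum_mono[OF 1 2])
    fix \<nu>
    have "(\<Sum>j\<in>J. norm (coef (pd j f) \<nu>) * exp (\<sigma> * |\<nu>|\<^sub>h))
      = (\<Sum>j\<in>J. \<bar>real_of_int (lk \<nu> j)\<bar>) * (norm (coef f \<nu>) * exp (\<sigma> * |\<nu>|\<^sub>h))"
      using assms(3) by (simp add: coef_pd norm_mult sum_distrib_left mult_ac)
    also have "\<dots> \<le> ( |\<nu>|\<^sub>h / h 0) * (norm (coef f \<nu>) * exp (\<sigma> * |\<nu>|\<^sub>h))"
      using lookup_le_l1[OF assms(4), of \<nu>] l1_le[of \<nu>] by (intro mult_right_mono) auto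
    also have "\<dots> = (norm (coef f \<nu>) / h 0) * ( |\<nu>|\<^sub>h * exp (\<sigma> * |\<nu>|\<^sub>h))" by simp
    also have "\<dots> \<le> (norm (coef f \<nu>) / h 0) * (1 / \<delta> * exp ((\<sigma> + \<delta>) * |\<nu>|\<^sub>h))"
      by (intro mult_left_mono size_exp_le assms) (auto simp: less_imp_le)
    finally show "(\<Sum>j\<in>J. norm (coef (pd j f) \<nu>) * exp (\<sigma> * |\<nu>|\<^sub>h))
        \<le> 1 / (h 0 * \<delta>) * (norm (coef f \<nu>) * exp ((\<sigma> + \<delta>) * |\<nu>|\<^sub>h))" by simp
  qed
qed

section \<open>Frequency cutoffs and small divisors\<close>

text \<open>The zero frequency belongs to neither part, so a function splits into its average, its low
  part and its high part; \<open>Dinv\<close> inverts \<open>D\<close> on the low part.\<close>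

definition low :: "real \<Rightarrow> tfun \<Rightarrow> tfun" where
  "low K = mul (\<lambda>\<nu>. if \<nu> \<noteq> 0 \<and> |\<nu>|\<^sub>h \<le> K then 1 else 0)"

definition high :: "real \<Rightarrow> tfun \<Rightarrow> tfun" where
  "high K = mul (\<lambda>\<nu>. if \<nu> \<noteq> 0 \<and> K < |\<nu>|\<^sub>h then 1 else 0)"

definition Dinv :: "real \<Rightarrow> tfun \<Rightarrow> tfun" where
  "Dinv K = mul (\<lambda>\<nu>. if \<nu> \<noteq> 0 \<and> |\<nu>|\<^sub>h \<le> K then 1 / (\<i> * of_real (freq_dot \<omega> \<nu>)) else 0)"

definition divisors_ge :: "real \<Rightarrow> real \<Rightarrow> bool" where
  "divisors_ge K \<beta> \<longleftrightarrow> 0 < \<beta> \<and> (\<forall>\<nu>. \<nu> \<noteq> 0 \<longrightarrow> |\<nu>|\<^sub>h \<le> K \<longrightarrow> \<beta> \<le> \<bar>freq_dot \<omega> \<nu>\<bar>)"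

lemma norm_Dinv_symbol:
  assumes "divisors_ge K \<beta>"
  shows "norm (if \<nu> \<noteq> 0 \<and> |\<nu>|\<^sub>h \<le> K then 1 / (\<i> * complex_of_real (freq_dot \<omega> \<nu>)) else 0) \<le> 1 / \<beta>"
proof (cases "\<nu> \<noteq> 0 \<and> |\<nu>|\<^sub>h \<le> K")
  case True
  then have "0 < \<beta>" "\<beta> \<le> \<bar>freq_dot \<omega> \<nu>\<bar>" using assms by (auto simp: divisors_ge_def)
  then have "1 / \<bar>freq_dot \<omega> \<nu>\<bar> \<le> 1 / \<beta>" by (intro divide_left_mono mult_pos_pos) auto
  then show ?thesis using True by (simp add: norm_divide norm_mult)
qed (use assms in \<open>auto simp: divisors_ge_def\<close>)

lemma tame_low [simp]: "tame (\<lambda>\<nu>. if \<nu> \<noteq> 0 \<and> |\<nu>|\<^sub>h \<le> K then 1 else 0)"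
  and tame_high [simp]: "tame (\<lambda>\<nu>. if \<nu> \<noteq> 0 \<and> K < |\<nu>|\<^sub>h then 1 else 0)"
  by (rule tame_bounded[of _ 1]; simp)+

lemma tame_Dinv: "divisors_ge K \<beta> \<Longrightarrow> 
    tame (\<lambda>\<nu>. if \<nu> \<noteq> 0 \<and> |\<nu>|\<^sub>h \<le> K then 1 / (\<i> * complex_of_real (freq_dot \<omega> \<nu>)) else 0)"
  by (rule tame_bounded[OF norm_Dinv_symbol])

lemma entire_low [simp, intro]: "f \<in> entire \<Longrightarrow> low K f \<in> entire"
  and entire_high [simp, intro]: "f \<in> entire \<Longrightarrow> high K f \<in> entire"
  and coef_low: "f \<in> entire \<Longrightarrow> coef (low K f) \<nu> = (if \<nu> \<noteq> 0 \<and> |\<nu>|\<^sub>h \<le> K then 1 else 0) * coef f \<nu>"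
  and coef_high: "f \<in> entire \<Longrightarrow> coef (high K f) \<nu> = (if \<nu> \<noteq> 0 \<and> K < |\<nu>|\<^sub>h then 1 else 0) * coef f \<nu>"
  unfolding low_def high_def by (simp_all only: entire_mul tame_low tame_high)

lemma entire_Dinv: "divisors_ge K \<beta> \<Longrightarrow> f \<in> entire \<Longrightarrow> Dinv K f \<in> entire"
  and coef_Dinv: "divisors_ge K \<beta> \<Longrightarrow> f \<in> entire \<Longrightarrow> coef (Dinv K f) \<nu> =
     (if \<nu> \<noteq> 0 \<and> |\<nu>|\<^sub>h \<le> K then 1 / (\<i> * of_real (freq_dot \<omega> \<nu>)) else 0) * coef f \<nu>"
  unfolding Dinv_def by (simp_all only: entire_mul tame_Dinv)

lemma split_low_high:
  assumes "f \<in> entire" shows "f = cst (coef f 0) + low K f + high K f"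
  using assms by (intro entire_eqI) (auto simp: coef_entire coef_low coef_high coef_cst)

lemma D_Dinv: "divisors_ge K \<beta> \<Longrightarrow> f \<in> entire \<Longrightarrow> D (Dinv K f) = low K f"
  and Dinv_D: "divisors_ge K \<beta> \<Longrightarrow> f \<in> entire \<Longrightarrow> Dinv K (D f) = low K f"
  by (rule entire_eqI; force simp: divisors_ge_def entire_Dinv coef_D coef_Dinv coef_low)+

lemma low_Dinv: "divisors_ge K \<beta> \<Longrightarrow> f \<in> entire \<Longrightarrow> low K (Dinv K f) = Dinv K f"
  by (rule entire_eqI) (auto simp: entire_Dinv coef_Dinv coef_low)

lemma low_low: "f \<in> entire \<Longrightarrow> low K (low K f) = low K f"
  by (rule entire_eqI) (auto simp: coef_low)

lemma low_rules:
  "f \<in> entire \<Longrightarrow> g \<in> entire \<Longrightarrow> low K (f + g) = low K f + low K g"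
  "f \<in> entire \<Longrightarrow> low K (- f) = - low K f"
  "f \<in> entire \<Longrightarrow> g \<in> entire \<Longrightarrow> low K (f - g) = low K f - low K g"
  unfolding low_def by (simp_all only: mul_add mul_uminus mul_diff tame_low)

lemma N_low: "0 \<le> \<sigma> \<Longrightarrow> f \<in> entire \<Longrightarrow> N \<sigma> (low K f) \<le> N \<sigma> f"
  unfolding low_def using mul_A_contract(3)[of \<sigma> f "\<lambda>\<nu>. if \<nu> \<noteq> 0 \<and> |\<nu>|\<^sub>h \<le> K then 1 else 0" 1]
  by (simp add: entireD)

text \<open>High frequencies pay for a smaller width with an exponentially small factor.\<close>

lemma N_high:
  assumes "0 \<le> \<sigma>" "0 \<le> \<delta>" "f \<in> entire"
  shows "N \<sigma> (high K f) \<le> exp (- (\<delta> * K)) * N (\<sigma> + \<delta>) f"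
  unfolding high_def
proof (rule mul_A(3))
  fix \<nu>
  have "exp (\<sigma> * |\<nu>|\<^sub>h) \<le> exp (- (\<delta> * K)) * exp ((\<sigma> + \<delta>) * |\<nu>|\<^sub>h)" if "K < |\<nu>|\<^sub>h"
    using mult_left_mono[OF less_imp_le[OF that] assms(2)] by (simp add: algebra_simps flip: exp_add)
  then show "norm (if \<nu> \<noteq> 0 \<and> K < |\<nu>|\<^sub>h then 1 else 0 :: complex) * exp (\<sigma> * |\<nu>|\<^sub>h)
      \<le> exp (- (\<delta> * K)) * exp ((\<sigma> + \<delta>) * |\<nu>|\<^sub>h)" by auto
qed (use assms in \<open>auto simp: entireD\<close>)

lemma N_Dinv: "divisors_ge K \<beta> \<Longrightarrow> 0 \<le> \<sigma> \<Longrightarrow> f \<in> entire \<Longrightarrow> N \<sigma> (Dinv K f) \<le> 1 / \<beta> * N \<sigma> f"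
  unfolding Dinv_def by (intro mul_A_contract(3) norm_Dinv_symbol) (auto simp: entireD)

section \<open>Vectors and matrices of functions\<close>

text \<open>Absolute sums over the components.  For matrices this norm is submultiplicative and invariant
  under transposition, and none of the bounds depends on the size of the index set \<open>J\<close>.\<close>

definition VN :: "real \<Rightarrow> int set \<Rightarrow> (int \<Rightarrow> tfun) \<Rightarrow> real" where
  "VN \<sigma> J y = (\<Sum>j\<in>J. N \<sigma> (y j))"

definition MN :: "real \<Rightarrow> int set \<Rightarrow> (int \<Rightarrow> int \<Rightarrow> tfun) \<Rightarrow> real" where
  "MN \<sigma> J M = (\<Sum>i\<in>J. \<Sum>j\<in>J. N \<sigma> (M i j))"

lemma VN_nonneg [simp]: "0 \<le> VN \<sigma> J y" and MN_nonneg [simp]: "0 \<le> MN \<sigma> J M"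
  by (auto simp: VN_def MN_def intro!: sum_nonneg)

lemma MN_transpose: "MN \<sigma> J (\<lambda>i j. M j i) = MN \<sigma> J M"
  unfolding MN_def by (rule sum.swap)

lemma VN_add: "0 \<le> \<sigma> \<Longrightarrow> (\<And>j. j \<in> J \<Longrightarrow> x j \<in> entire) \<Longrightarrow> (\<And>j. j \<in> J \<Longrightarrow> y j \<in> entire) \<Longrightarrow>
   VN \<sigma> J (\<lambda>j. x j + y j) \<le> VN \<sigma> J x + VN \<sigma> J y"
  unfolding VN_def sum.distrib[symmetric] by (intro sum_mono A_add(3)) (auto simp: entireD)

lemma VN_diff: "0 \<le> \<sigma> \<Longrightarrow> (\<And>j. j \<in> J \<Longrightarrow> x j \<in> entire) \<Longrightarrow> (\<And>j. j \<in> J \<Longrightarrow> y j \<in> entire) \<Longrightarrow>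
   VN \<sigma> J (\<lambda>j. x j - y j) \<le> VN \<sigma> J x + VN \<sigma> J y"
  unfolding VN_def sum.distrib[symmetric] by (intro sum_mono A_diff(3)) (auto simp: entireD)

lemma VN_le:
  assumes "\<And>j. j \<in> J \<Longrightarrow> N \<sigma> (x j) \<le> c * N \<tau> (y j)"
  shows "VN \<sigma> J x \<le> c * VN \<tau> J y"
  unfolding VN_def sum_distrib_left using assms by (intro sum_mono)

lemma MN_le:
  assumes "\<And>i j. i \<in> J \<Longrightarrow> j \<in> J \<Longrightarrow> N \<sigma> (x i j) \<le> c * N \<tau> (y i j)"
  shows "MN \<sigma> J x \<le> c * MN \<tau> J y"
  unfolding MN_def sum_distrib_left using assms by (intro sum_mono)

lemma VN_mono: "0 \<le> \<sigma> \<Longrightarrow> \<sigma> \<le> \<tau> \<Longrightarrow> (\<And>j. j \<in> J \<Longrightarrow> x j \<in> entire) \<Longrightarrow> VN \<sigma> J x \<le> VN \<tau> J x"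
  unfolding VN_def by (intro sum_mono A_mono(2)) (auto simp: entireD)

lemma MN_mono: "0 \<le> \<sigma> \<Longrightarrow> \<sigma> \<le> \<tau> \<Longrightarrow> (\<And>i j. i \<in> J \<Longrightarrow> j \<in> J \<Longrightarrow> x i j \<in> entire) \<Longrightarrow> MN \<sigma> J x \<le> MN \<tau> J x"
  unfolding MN_def by (intro sum_mono A_mono(2)) (auto simp: entireD)

lemma N_le_VN: "finite J \<Longrightarrow> j \<in> J \<Longrightarrow> N \<sigma> (y j) \<le> VN \<sigma> J y"
  unfolding VN_def by (rule member_le_sum) auto

lemma matvec:
  assumes "0 \<le> \<sigma>" "finite J" and M: "\<And>i j. i \<in> J \<Longrightarrow> j \<in> J \<Longrightarrow> M i j \<in> entire"
    and y: "\<And>j. j \<in> J \<Longrightarrow> y j \<in> entire"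
  shows "VN \<sigma> J (\<lambda>i. \<Sum>j\<in>J. M i j * y j) \<le> MN \<sigma> J M * VN \<sigma> J y"
proof -
  have "N \<sigma> (\<Sum>j\<in>J. M i j * y j) \<le> (\<Sum>j\<in>J. N \<sigma> (M i j)) * VN \<sigma> J y" if i: "i \<in> J" for i
  proof -
    have "N \<sigma> (\<Sum>j\<in>J. M i j * y j) \<le> (\<Sum>j\<in>J. N \<sigma> (M i j * y j))"
      using assms i by (intro A_sum(3)) (auto simp: entireD)
    also have "\<dots> \<le> (\<Sum>j\<in>J. N \<sigma> (M i j) * VN \<sigma> J y)"
    proof (rule sum_mono)
      fix j assume j: "j \<in> J"
      have "N \<sigma> (M i j * y j) \<le> N \<sigma> (M i j) * N \<sigma> (y j)"
        using assms i j by (intro A_mult(2)) (auto simp: entireD)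
      also have "\<dots> \<le> N \<sigma> (M i j) * VN \<sigma> J y"
        using j assms(2) by (intro mult_left_mono N_le_VN) auto
      finally show "N \<sigma> (M i j * y j) \<le> N \<sigma> (M i j) * VN \<sigma> J y" .
    qed
    finally show ?thesis by (simp add: sum_distrib_right)
  qed
  then show ?thesis unfolding VN_def[of _ _ "\<lambda>i. \<Sum>j\<in>J. M i j * y j"] MN_def sum_distrib_right
    by (intro sum_mono) (simp add: sum_distrib_right)
qed

definition kron :: "int \<Rightarrow> int \<Rightarrow> tfun" where "kron i j = (if i = j then 1 else 0)"

lemma entire_kron [simp]: "kron i j \<in> entire" by (simp add: kron_def)

lemma D_kron [simp]: "D (kron i j) = 0" and pd_kron [simp]: "pd k (kron i j) = 0"
  by (auto simp: kron_def D_rules pd_rules)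

lemma sum_kron: "finite J \<Longrightarrow> i \<in> J \<Longrightarrow> (\<Sum>j\<in>J. kron i j * y j) = y i"
  by (subst sum.cong[OF refl, of _ _ "\<lambda>j. if i = j then y j else 0"]) (auto simp: kron_def)

text \<open>Upper and lower bound for a perturbation of the identity; the lower bound takes
  the place of an inverse matrix.\<close>

lemma near_identity_matvec:
  assumes "0 \<le> \<sigma>" "finite J" and M: "\<And>i j. i \<in> J \<Longrightarrow> j \<in> J \<Longrightarrow> M i j \<in> entire"
    and y: "\<And>j. j \<in> J \<Longrightarrow> y j \<in> entire" and a: "MN \<sigma> J M \<le> a"
  shows "VN \<sigma> J (\<lambda>i. \<Sum>j\<in>J. (kron i j + M i j) * y j) \<le> (1 + a) * VN \<sigma> J y"
    and "(1 - a) * VN \<sigma> J y \<le> VN \<sigma> J (\<lambda>i. \<Sum>j\<in>J. (kron i j + M i j) * y j)"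
proof -
  let ?m = "\<lambda>i. \<Sum>j\<in>J. M i j * y j" and ?v = "\<lambda>i. \<Sum>j\<in>J. (kron i j + M i j) * y j"
  have eq: "?v i = y i + ?m i" if "i \<in> J" for i
    using sum_kron[OF assms(2) that] by (simp add: distrib_right sum.distrib)
  have m: "VN \<sigma> J ?m \<le> a * VN \<sigma> J y"
    using matvec[where M = M and y = y, OF assms(1,2) M y] mult_right_mono[OF a, of "VN \<sigma> J y"] by simp
  have ent: "?m i \<in> entire" "?v i \<in> entire" if "i \<in> J" for i using that M y by auto
  have "VN \<sigma> J ?v = VN \<sigma> J (\<lambda>i. y i + ?m i)" unfolding VN_def by (intro sum.cong) (auto simp: eq)
  also have "\<dots> \<le> VN \<sigma> J y + VN \<sigma> J ?m" by (intro VN_add assms ent)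
  finally show "VN \<sigma> J ?v \<le> (1 + a) * VN \<sigma> J y" using m by (simp add: algebra_simps)
  have "VN \<sigma> J y = VN \<sigma> J (\<lambda>i. ?v i - ?m i)" unfolding VN_def by (intro sum.cong) (auto simp: eq)
  also have "\<dots> \<le> VN \<sigma> J ?v + VN \<sigma> J ?m" by (intro VN_diff assms ent)
  finally show "(1 - a) * VN \<sigma> J y \<le> VN \<sigma> J ?v" using m by (simp add: algebra_simps)
qed

lemma near_identity_matmat:
  assumes "0 \<le> \<sigma>" "finite J" and M: "\<And>i j. i \<in> J \<Longrightarrow> j \<in> J \<Longrightarrow> M i j \<in> entire"
    and Y: "\<And>i j. i \<in> J \<Longrightarrow> j \<in> J \<Longrightarrow> Y i j \<in> entire" and a: "MN \<sigma> J M \<le> a"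
  shows "MN \<sigma> J (\<lambda>k j. \<Sum>i\<in>J. (kron k i + M k i) * Y i j) \<le> (1 + a) * MN \<sigma> J Y"
proof -
  have MV: "MN \<sigma> J Z = (\<Sum>j\<in>J. VN \<sigma> J (\<lambda>i. Z i j))" for Z
    unfolding MN_def VN_def by (rule sum.swap)
  show ?thesis unfolding MV sum_distrib_left
    by (intro sum_mono near_identity_matvec(1) assms)
qed

lemma N_pd_matrix:
  assumes "0 \<le> \<sigma>" "0 < \<delta>" "finite J" "\<And>j. j \<in> J \<Longrightarrow> f j \<in> entire"
  shows "MN \<sigma> J (\<lambda>i j. pd j (f i)) \<le> 1 / (h 0 * \<delta>) * VN (\<sigma> + \<delta>) J f"
  unfolding MN_def VN_def sum_distrib_left by (intro sum_mono N_pd_sum assms)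

end

context star_weighted
begin
lemma fexp_add: "fexp (f + g) = fexp f * fexp g"
  by (simp add: fexp_def fun_eq_iff fun_apply exp_add)
end

context small_divisor_setting
begin

section \<open>The residual of the equation\<close>

abbreviation icomp :: "freq \<Rightarrow> int \<Rightarrow> tfun" where "icomp \<nu> k \<equiv> cst (\<i> * of_int (lk \<nu> k))"

text \<open>This is \<open>exp (i \<nu> \<cdot> (\<phi> + u))\<close> as a function of \<open>\<phi>\<close>; for complex \<open>u\<close> it is the analytic continuation.\<close>

definition wave :: "freq \<Rightarrow> (int \<Rightarrow> tfun) \<Rightarrow> tfun" where
  "wave \<nu> u = character \<nu> * fexp (\<Sum>k\<in>Poly_Mapping.keys \<nu>. icomp \<nu> k * u k)"

text \<open>The \<open>i\<close>-th component of \<open>(\<partial>f)(\<phi> + u)\<close> for the part of \<open>f\<close> with frequencies in \<open>S\<close>.\<close>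

definition force :: "(freq \<Rightarrow> complex) \<Rightarrow> freq set \<Rightarrow> (int \<Rightarrow> tfun) \<Rightarrow> int \<Rightarrow> tfun" where
  "force F S u i = (\<Sum>\<nu>\<in>S. cst (F \<nu>) * icomp \<nu> i * wave \<nu> u)"

definition resid :: "(freq \<Rightarrow> complex) \<Rightarrow> freq set \<Rightarrow> real \<Rightarrow> (int \<Rightarrow> tfun) \<Rightarrow> int \<Rightarrow> tfun" where
  "resid F S \<epsilon> u i = D (D (u i)) + cst (of_real \<epsilon>) * force F S u i"

lemma icomp_sum_superset:
  assumes "finite J" "Poly_Mapping.keys \<nu> \<subseteq> J"
  shows "(\<Sum>k\<in>Poly_Mapping.keys \<nu>. icomp \<nu> k * u k) = (\<Sum>k\<in>J. icomp \<nu> k * u k)"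
  using assms by (intro sum.mono_neutral_left) (auto simp: in_keys_iff fun_eq_iff fun_apply)

lemma wave_superset:
  assumes "finite J" "Poly_Mapping.keys \<nu> \<subseteq> J"
  shows "wave \<nu> u = character \<nu> * fexp (\<Sum>k\<in>J. icomp \<nu> k * u k)"
  unfolding wave_def icomp_sum_superset[OF assms] ..

lemma wave_add: "wave \<nu> (\<lambda>k. u k + w k) = wave \<nu> u * fexp (\<Sum>k\<in>Poly_Mapping.keys \<nu>. icomp \<nu> k * w k)"
  by (simp add: wave_def distrib_left sum.distrib fexp_add mult.assoc)

lemma entire_wave [simp, intro]: "(\<And>k. u k \<in> entire) \<Longrightarrow> wave \<nu> u \<in> entire"
  by (simp add: wave_def)

lemma entire_force [simp, intro]: "(\<And>k. u k \<in> entire) \<Longrightarrow> force F S u i \<in> entire"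
  by (simp add: force_def)

lemma entire_resid [simp, intro]: "(\<And>k. u k \<in> entire) \<Longrightarrow> resid F S \<epsilon> u i \<in> entire"
  by (simp add: resid_def)

end

section \<open>Algebra of the Newton step\<close>

locale newton_step = small_divisor_setting +
  fixes J :: "int set" and S :: "freq set" and F :: "freq \<Rightarrow> complex" and \<epsilon> :: real
    and u :: "int \<Rightarrow> tfun"
  assumes finJ [simp]: "finite J" and finS [simp]: "finite S"
    and keysJ: "\<nu> \<in> S \<Longrightarrow> Poly_Mapping.keys \<nu> \<subseteq> J"
    and u_entire [simp]: "u k \<in> entire"
begin

text \<open>In matrix notation \<open>V = 1 + \<partial>u\<close>, \<open>g = V\<^sup>T e\<close>, \<open>G = V\<^sup>T V\<close> and \<open>K = V\<^sup>T DV - (DV)\<^sup>T V\<close>; \<open>hess\<close> is the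
  Hessian of the truncated potential at \<open>\<phi> + u\<close>.\<close>

definition V :: "int \<Rightarrow> int \<Rightarrow> tfun" where "V i j = kron i j + pd j (u i)"

abbreviation e :: "int \<Rightarrow> tfun" where "e \<equiv> resid F S \<epsilon> u"

definition g :: "int \<Rightarrow> tfun" where "g k = (\<Sum>i\<in>J. V i k * e i)"

definition G :: "int \<Rightarrow> int \<Rightarrow> tfun" where "G k j = (\<Sum>i\<in>J. V i k * V i j)"

definition K :: "int \<Rightarrow> int \<Rightarrow> tfun" where "K k j = (\<Sum>i\<in>J. V i k * D (V i j) - D (V i k) * V i j)"

definition hess :: "int \<Rightarrow> int \<Rightarrow> tfun" where
  "hess i l = (\<Sum>\<nu>\<in>S. cst (F \<nu>) * icomp \<nu> i * icomp \<nu> l * wave \<nu> u)"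

lemma entire_V [simp]: "V i j \<in> entire" by (simp add: V_def)
lemma entire_g [simp]: "g k \<in> entire" by (simp add: g_def)
lemma entire_G [simp]: "G k j \<in> entire" by (simp add: G_def)
lemma entire_K [simp]: "K k j \<in> entire" by (simp add: K_def)
lemma entire_hess [simp]: "hess i l \<in> entire" by (simp add: hess_def)

lemma D_V: "D (V i j) = pd j (D (u i))"
  by (simp add: V_def D_rules D_pd)

lemma pd_V: "pd k (V i j) = pd j (V i k)"
  by (simp add: V_def pd_rules pd_pd)

lemma pd_wave:
  assumes "\<nu> \<in> S" "j \<in> J"
  shows "pd j (wave \<nu> u) = (\<Sum>k\<in>J. icomp \<nu> k * V k j) * wave \<nu> u"
proof -
  note w = wave_superset[OF finJ keysJ[OF assms(1)]]
  have "(\<Sum>k\<in>J. icomp \<nu> k * kron k j) = (\<Sum>k\<in>J. if k = j then icomp \<nu> j else 0)"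
    by (intro sum.cong) (auto simp: kron_def)
  also have "\<dots> = icomp \<nu> j" using assms(2) by simp
  finally have "(\<Sum>k\<in>J. icomp \<nu> k * V k j) = icomp \<nu> j + (\<Sum>k\<in>J. icomp \<nu> k * pd j (u k))"
    by (simp add: V_def distrib_left sum.distrib)
  then show ?thesis
    unfolding w by (simp add: pd_mult pd_cst pd_character pd_fexp pd_rules algebra_simps)
qed

lemma pd_force:
  assumes "j \<in> J"
  shows "pd j (force F S u i) = (\<Sum>l\<in>J. hess i l * V l j)"
proof -
  have "pd j (force F S u i) = (\<Sum>\<nu>\<in>S. cst (F \<nu>) * (icomp \<nu> i * pd j (wave \<nu> u)))"
    unfolding force_def mult.assoc by (simp add: pd_rules)
  also have "\<dots> = (\<Sum>\<nu>\<in>S. \<Sum>l\<in>J. cst (F \<nu>) * icomp \<nu> i * icomp \<nu> l * wave \<nu> u * V l j)"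
    by (intro sum.cong refl) (simp add: pd_wave assms sum_distrib_left sum_distrib_right mult_ac)
  also have "\<dots> = (\<Sum>l\<in>J. hess i l * V l j)"
    unfolding hess_def sum_distrib_right by (rule sum.swap)
  finally show ?thesis .
qed

text \<open>Differentiating the residual gives the linearised operator applied to the columns of \<open>V\<close>:
  translations of \<open>\<phi>\<close> almost solve the linearised equation.\<close>

lemma pd_e:
  assumes "j \<in> J"
  shows "pd j (e i) = D (D (V i j)) + cst (of_real \<epsilon>) * (\<Sum>l\<in>J. hess i l * V l j)"
  by (simp add: resid_def pd_rules pd_force assms D_V D_pd)

text \<open>By the chain rule this is the average of a partial derivative of the potential along \<open>\<phi> + u\<close>.\<close>

lemma force_average:
  assumes "j \<in> J"
  shows "coef (\<Sum>i\<in>J. V i j * force F S u i) 0 = 0"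
proof -
  define \<Psi> where "\<Psi> = (\<Sum>\<nu>\<in>S. cst (F \<nu>) * wave \<nu> u)"
  have "pd j \<Psi> = (\<Sum>\<nu>\<in>S. \<Sum>k\<in>J. V k j * (cst (F \<nu>) * icomp \<nu> k * wave \<nu> u))"
    unfolding \<Psi>_def by (simp add: pd_rules pd_wave assms sum_distrib_left sum_distrib_right mult_ac)
  also have "\<dots> = (\<Sum>i\<in>J. V i j * force F S u i)"
    unfolding force_def sum_distrib_left by (rule sum.swap)
  finally have "(\<Sum>i\<in>J. V i j * force F S u i) = pd j \<Psi>" ..
  then show ?thesis by (simp add: coef_pd_0 \<Psi>_def)
qed

text \<open>For the kinetic part, \<open>V\<^sup>T D\<^sup>2 u = D (V\<^sup>T D u) - \<partial> (\<bar>D u\<bar>\<^sup>2 / 2)\<close> consists of derivatives only.\<close>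

lemma g_average:
  assumes "j \<in> J" shows "coef (g j) 0 = 0"
proof -
  have 1: "(\<Sum>i\<in>J. V i j * D (D (u i))) = D (\<Sum>i\<in>J. V i j * D (u i)) - cst (1/2) * pd j (\<Sum>i\<in>J. D (u i) * D (u i))"
  proof -
    have "cst (1/2) * (x + x) = x" for x :: tfun by (simp add: fun_eq_iff fun_apply)
    moreover have "pd j (\<Sum>i\<in>J. D (u i) * D (u i)) = (\<Sum>i\<in>J. D (V i j) * D (u i) + D (V i j) * D (u i))"
      by (simp add: pd_rules pd_mult D_V mult.commute del: mult_2 mult_2_right)
    ultimately have "cst (1/2) * pd j (\<Sum>i\<in>J. D (u i) * D (u i)) = (\<Sum>i\<in>J. D (V i j) * D (u i))"
      by (simp only: sum_distrib_left)
    then show ?thesis by (simp add: D_rules D_mult sum.distrib)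
  qed
  have "g j = (\<Sum>i\<in>J. V i j * D (D (u i))) + cst (of_real \<epsilon>) * (\<Sum>i\<in>J. V i j * force F S u i)"
    unfolding g_def resid_def by (simp add: distrib_left sum.distrib sum_distrib_left mult_ac)
  then show ?thesis using force_average[OF assms]
    by (simp add: 1 coef_entire coef_D_0 coef_pd_0)
qed

text \<open>Each entry is a difference of partial derivatives, since second partial derivatives commute
  (invariant tori are isotropic).\<close>

lemma K_average:
  assumes "j \<in> J" "k \<in> J" shows "coef (K k j) 0 = 0"
proof -
  have "K k j = (\<Sum>i\<in>J. pd j (V i k * D (u i)) - pd k (V i j * D (u i)))"
    unfolding K_def by (intro sum.cong refl) (simp add: D_V pd_mult pd_V[of j _ k] algebra_simps)
  then show ?thesis by (simp add: coef_entire_sum coef_entire coef_pd_0)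
qed

text \<open>The contributions of the Hessian cancel by its symmetry; what remains is linear in the residual.\<close>

lemma D_K:
  assumes "j \<in> J" "k \<in> J"
  shows "D (K k j) = (\<Sum>i\<in>J. V i k * pd j (e i)) - (\<Sum>i\<in>J. V i j * pd k (e i))"
proof -
  let ?h = "\<lambda>k j. \<Sum>i\<in>J. \<Sum>l\<in>J. V i k * (hess i l * V l j)"
  have sym: "?h k j = ?h j k"
  proof -
    have "hess i l = hess l i" for i l unfolding hess_def by (simp add: mult_ac)
    then have "?h j k = (\<Sum>i\<in>J. \<Sum>l\<in>J. V l k * (hess l i * V i j))" by (simp add: mult_ac)
    then show ?thesis by (subst (asm) sum.swap) simp
  qed
  have VP: "(\<Sum>i\<in>J. V i k * pd j (e i)) = (\<Sum>i\<in>J. V i k * D (D (V i j))) + cst (of_real \<epsilon>) * ?h k j"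
    if "j \<in> J" for j k
    using that by (simp add: pd_e distrib_left sum.distrib sum_distrib_left mult_ac)
  have "D (K k j) = (\<Sum>i\<in>J. V i k * D (D (V i j))) - (\<Sum>i\<in>J. V i j * D (D (V i k)))"
    unfolding K_def sum_subtractf[symmetric] by (simp add: D_rules D_mult algebra_simps)
  then show ?thesis using assms by (simp add: VP sym)
qed

text \<open>The correction \<open>V z\<close>, set to zero outside \<open>J\<close> so that the displacement keeps finite support.\<close>

definition corr :: "(int \<Rightarrow> tfun) \<Rightarrow> int \<Rightarrow> tfun" where
  "corr z i = (if i \<in> J then (\<Sum>j\<in>J. V i j * z j) else 0)"

definition taylor :: "(int \<Rightarrow> tfun) \<Rightarrow> int \<Rightarrow> tfun" where
  "taylor w i = force F S (\<lambda>k. u k + w k) i - force F S u i - (\<Sum>l\<in>J. hess i l * w l)"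

text \<open>Once the Taylor remainder of the force is taken off, the new residual is affine in \<open>z\<close>.\<close>

definition linres :: "(int \<Rightarrow> tfun) \<Rightarrow> int \<Rightarrow> tfun" where
  "linres z i = resid F S \<epsilon> (\<lambda>k. u k + corr z k) i - cst (of_real \<epsilon>) * taylor (corr z) i"

text \<open>By \<open>pd_e\<close> the terms in which \<open>z\<close> is not differentiated combine to \<open>(\<partial>e) z\<close>.\<close>

lemma linres_eq:
  assumes z: "\<And>j. z j \<in> entire" and i: "i \<in> J"
  shows "linres z i = e i + (\<Sum>j\<in>J. pd j (e i) * z j) +
     (\<Sum>j\<in>J. D (V i j) * D (z j) + D (V i j) * D (z j) + V i j * D (D (z j)))"
proof -
  let ?c = "cst (of_real \<epsilon>)"
  have 1: "D (D (corr z i)) = (\<Sum>j\<in>J. D (D (V i j)) * z j) +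
     (\<Sum>j\<in>J. D (V i j) * D (z j) + D (V i j) * D (z j) + V i j * D (D (z j)))"
    using z i by (simp add: corr_def D_rules D_mult sum.distrib[symmetric] algebra_simps)
  have "(\<Sum>l\<in>J. hess i l * corr z l) = (\<Sum>l\<in>J. \<Sum>j\<in>J. hess i l * V l j * z j)"
    by (intro sum.cong refl) (simp add: corr_def sum_distrib_left mult_ac)
  also have "\<dots> = (\<Sum>j\<in>J. (\<Sum>l\<in>J. hess i l * V l j) * z j)"
    unfolding sum_distrib_right by (rule sum.swap)
  finally have 2: "?c * (\<Sum>l\<in>J. hess i l * corr z l) = (\<Sum>j\<in>J. (?c * (\<Sum>l\<in>J. hess i l * V l j)) * z j)"
    by (simp only:) (subst sum_distrib_left, simp only: mult.assoc)
  have ce: "corr z k \<in> entire" for k using z by (simp add: corr_def)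
  have "linres z i = D (D (u i)) + D (D (corr z i)) + ?c * force F S u i + ?c * (\<Sum>l\<in>J. hess i l * corr z l)"
    using ce by (simp add: linres_def resid_def taylor_def D_rules algebra_simps)
  also have "\<dots> = e i + (\<Sum>j\<in>J. (D (D (V i j)) + ?c * (\<Sum>l\<in>J. hess i l * V l j)) * z j)
     + (\<Sum>j\<in>J. D (V i j) * D (z j) + D (V i j) * D (z j) + V i j * D (D (z j)))"
    unfolding 1 2 resid_def by (simp only: distrib_right sum.distrib add_ac)
  also have "(\<Sum>j\<in>J. (D (D (V i j)) + ?c * (\<Sum>l\<in>J. hess i l * V l j)) * z j) = (\<Sum>j\<in>J. pd j (e i) * z j)"
    by (intro sum.cong refl) (simp add: pd_e)
  finally show ?thesis .
qed

text \<open>The first-order terms \<open>2 V\<^sup>T DV Dz\<close> are rewritten as \<open>D (V\<^sup>T V) Dz + K Dz\<close>, which completes the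
  divergence form \<open>D (G D z)\<close>.\<close>

lemma transpose_linres:
  assumes z: "\<And>j. z j \<in> entire" and k: "k \<in> J"
  shows "(\<Sum>i\<in>J. V i k * linres z i) = g k + (\<Sum>j\<in>J. (\<Sum>i\<in>J. V i k * pd j (e i)) * z j)
     + D (\<Sum>j\<in>J. G k j * D (z j)) + (\<Sum>j\<in>J. K k j * D (z j))"
proof -
  let ?a = "\<lambda>i j. V i k * (D (V i j) * D (z j) + D (V i j) * D (z j) + V i j * D (D (z j)))"
  have 1: "(\<Sum>i\<in>J. V i k * linres z i) = g k + (\<Sum>i\<in>J. \<Sum>j\<in>J. V i k * pd j (e i) * z j) + (\<Sum>i\<in>J. \<Sum>j\<in>J. ?a i j)"
    using z by (simp add: linres_eq g_def distrib_left sum.distrib sum_distrib_left mult.assoc)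
  have 2: "(\<Sum>i\<in>J. \<Sum>j\<in>J. V i k * pd j (e i) * z j) = (\<Sum>j\<in>J. (\<Sum>i\<in>J. V i k * pd j (e i)) * z j)"
    unfolding sum_distrib_right by (rule sum.swap)
  have "D (\<Sum>j\<in>J. G k j * D (z j)) + (\<Sum>j\<in>J. K k j * D (z j)) = (\<Sum>j\<in>J. \<Sum>i\<in>J. ?a i j)"
  proof -
    have "D (\<Sum>j\<in>J. G k j * D (z j)) + (\<Sum>j\<in>J. K k j * D (z j))
      = (\<Sum>j\<in>J. D (G k j) * D (z j) + G k j * D (D (z j)) + K k j * D (z j))"
      using z by (simp add: D_rules D_mult sum.distrib)
    also have "\<dots> = (\<Sum>j\<in>J. \<Sum>i\<in>J. ?a i j)"
    proof (intro sum.cong refl)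
      fix j
      have "D (G k j) = (\<Sum>i\<in>J. D (V i k) * V i j + V i k * D (V i j))"
        by (simp add: G_def D_rules D_mult)
      then show "D (G k j) * D (z j) + G k j * D (D (z j)) + K k j * D (z j) = (\<Sum>i\<in>J. ?a i j)"
        unfolding G_def K_def by (simp only: sum_distrib_right sum.distrib[symmetric])
          (intro sum.cong refl, simp add: algebra_simps)
    qed
    finally show ?thesis .
  qed
  also have "\<dots> = (\<Sum>i\<in>J. \<Sum>j\<in>J. ?a i j)" by (rule sum.swap)
  finally show ?thesis unfolding 1 2 by (simp add: add_ac)
qed

end

context small_divisor_setting
begin

section \<open>Solving the truncated linear equation\<close>

lemma MN_add: "0 \<le> \<sigma> \<Longrightarrow> (\<And>i j. i \<in> J \<Longrightarrow> j \<in> J \<Longrightarrow> x i j \<in> entire) \<Longrightarrow>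
   (\<And>i j. i \<in> J \<Longrightarrow> j \<in> J \<Longrightarrow> y i j \<in> entire) \<Longrightarrow>
   MN \<sigma> J (\<lambda>i j. x i j + y i j) \<le> MN \<sigma> J x + MN \<sigma> J y"
  unfolding MN_def sum.distrib[symmetric] by (intro sum_mono A_add(3)) (auto simp: entireD)

lemma MN_diff: "0 \<le> \<sigma> \<Longrightarrow> (\<And>i j. i \<in> J \<Longrightarrow> j \<in> J \<Longrightarrow> x i j \<in> entire) \<Longrightarrow>
   (\<And>i j. i \<in> J \<Longrightarrow> j \<in> J \<Longrightarrow> y i j \<in> entire) \<Longrightarrow>
   MN \<sigma> J (\<lambda>i j. x i j - y i j) \<le> MN \<sigma> J x + MN \<sigma> J y"
  unfolding MN_def sum.distrib[symmetric] by (intro sum_mono A_diff(3)) (auto simp: entireD)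

lemma kron_commute: "kron i j = kron j i"
  by (simp add: kron_def)

lemma VN_uminus: "0 \<le> \<sigma> \<Longrightarrow> (\<And>j. j \<in> J \<Longrightarrow> x j \<in> entire) \<Longrightarrow> VN \<sigma> J (\<lambda>j. - x j) = VN \<sigma> J x"
  unfolding VN_def by (intro sum.cong refl A_uminus(3)) (auto simp: entireD)

lemma VN_cong: "(\<And>j. j \<in> J \<Longrightarrow> x j = y j) \<Longrightarrow> VN \<sigma> J x = VN \<sigma> J y"
  unfolding VN_def by (intro sum.cong) auto

lemma MN_cong: "(\<And>i j. i \<in> J \<Longrightarrow> j \<in> J \<Longrightarrow> x i j = y i j) \<Longrightarrow> MN \<sigma> J x = MN \<sigma> J y"
  unfolding MN_def by (intro sum.cong refl) auto

lemma real_kron: "realv (kron i j)"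
  by (simp add: kron_def real_0 real_1)

lemma real_D: "f \<in> entire \<Longrightarrow> realv f \<Longrightarrow> realv (D f)"
  and real_pd: "f \<in> entire \<Longrightarrow> realv f \<Longrightarrow> realv (pd j f)"
  unfolding D_def pd_def
  by (intro real_mul; simp add: symbol_D symbol_pd freq_dot_uminus)+

lemma real_low: "f \<in> entire \<Longrightarrow> realv f \<Longrightarrow> realv (low C f)"
  unfolding low_def by (intro real_mul) auto

lemma real_Dinv: "divisors_ge C \<beta> \<Longrightarrow> f \<in> entire \<Longrightarrow> realv f \<Longrightarrow> realv (Dinv C f)"
  unfolding Dinv_def by (intro real_mul tame_Dinv) (auto simp: freq_dot_uminus)

lemma real_cst: "Im c = 0 \<Longrightarrow> realv (cst c)"
  by (simp add: realv_def)

lemma wave_cnj: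
  assumes "\<And>k. realv (u k)"
  shows "cnj (wave \<nu> u \<theta>) = wave (- \<nu>) u \<theta>"
proof -
  have ap: "(\<Sum>k\<in>K. w k) \<theta> = (\<Sum>k\<in>K. w k \<theta>)" for K and w :: "int \<Rightarrow> tfun"
    by (induction K rule: infinite_finite_induct) (auto simp: fun_apply)
  have "cnj (u k \<theta>) = u k \<theta>" for k
    using assms[of k] by (simp add: realv_def complex_eq_iff)
  then show ?thesis
    by (simp add: wave_def fexp_def fun_apply ap character_uminus exp_cnj sum_negf)
qed

lemma sum_fun_apply: "(\<Sum>k\<in>K. w k) \<theta> = (\<Sum>k\<in>K. w k \<theta>)" for w :: "'b \<Rightarrow> tfun"
  by (induction K rule: infinite_finite_induct) (auto simp: fun_apply)

lemma real_force:
  assumes u: "\<And>k. realv (u k)" and F: "\<And>\<nu>. F (- \<nu>) = cnj (F \<nu>)" and S: "uminus ` S = S"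
  shows "realv (force F S u i)"
  unfolding realv_def
proof
  fix \<theta>
  let ?t = "\<lambda>\<nu>. F \<nu> * (\<i> * of_int (lk \<nu> i)) * wave \<nu> u \<theta>"
  have f: "force F S u i \<theta> = sum ?t S" by (simp add: force_def sum_fun_apply fun_apply)
  have "cnj (sum ?t S) = (\<Sum>\<nu>\<in>S. ?t (- \<nu>))"
    unfolding cnj_sum by (intro sum.cong refl) (simp add: F wave_cnj[OF u])
  also have "\<dots> = sum ?t (uminus ` S)"
    by (subst sum.reindex) (auto simp: inj_on_def)
  finally have "cnj (sum ?t S) = sum ?t S" unfolding S .
  moreover have "Im x = 0" if "cnj x = x" for x using that by (simp add: complex_eq_iff)
  ultimately show "Im (force F S u i \<theta>) = 0" unfolding f by blast
qed

lemma real_resid: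
  assumes "\<And>k. realv (u k)" "\<And>k. u k \<in> entire" "\<And>\<nu>. F (- \<nu>) = cnj (F \<nu>)" "uminus ` S = S"
  shows "realv (resid F S \<epsilon> u i)"
  unfolding resid_def using assms
  by (intro real_add real_mult real_cst real_D real_force) auto

end

context newton_step
begin

definition Sm :: "int \<Rightarrow> int \<Rightarrow> tfun" where "Sm k j = G k j - kron k j"

lemma entire_Sm [simp]: "Sm k j \<in> entire" by (simp add: Sm_def)

lemma V_transpose: "V i k = kron k i + pd k (u i)"
  by (simp add: V_def kron_commute)

lemma MN_Sm:
  assumes "0 \<le> \<sigma>" "MN \<sigma> J (\<lambda>i j. pd j (u i)) \<le> 1 / 8"
  shows "MN \<sigma> J Sm \<le> 1 / 2"
proof -
  let ?A = "\<lambda>i j. pd j (u i)"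
  have "MN \<sigma> J Sm = MN \<sigma> J (\<lambda>k j. ?A j k + (\<Sum>i\<in>J. (kron k i + ?A i k) * ?A i j))"
  proof (rule MN_cong)
    fix k j assume "k \<in> J" "j \<in> J"
    have "(\<Sum>i\<in>J. V i k * kron i j) = V j k"
      using sum_kron[OF finJ \<open>j \<in> J\<close>, of "\<lambda>i. V i k"] by (simp add: mult.commute kron_commute)
    moreover have "G k j = (\<Sum>i\<in>J. V i k * kron i j + V i k * ?A i j)"
      unfolding G_def V_def[of _ j] by (simp only: distrib_left)
    ultimately have "Sm k j = V j k - kron k j + (\<Sum>i\<in>J. V i k * ?A i j)"
      by (simp add: Sm_def sum.distrib)
    then show "Sm k j = ?A j k + (\<Sum>i\<in>J. (kron k i + ?A i k) * ?A i j)"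
      unfolding V_transpose by simp
  qed
  also have "\<dots> \<le> MN \<sigma> J (\<lambda>k j. ?A j k) + MN \<sigma> J (\<lambda>k j. \<Sum>i\<in>J. (kron k i + ?A i k) * ?A i j)"
    using assms by (intro MN_add) auto
  also have "MN \<sigma> J (\<lambda>k j. ?A j k) = MN \<sigma> J ?A" by (rule MN_transpose)
  finally have "MN \<sigma> J Sm \<le> MN \<sigma> J ?A + MN \<sigma> J (\<lambda>k j. \<Sum>i\<in>J. (kron k i + ?A i k) * ?A i j)" .
  moreover have "MN \<sigma> J (\<lambda>k j. \<Sum>i\<in>J. (kron k i + ?A i k) * ?A i j) \<le> (1 + 1/8) * MN \<sigma> J ?A"
    using assms by (intro near_identity_matmat) (auto simp: MN_transpose[of \<sigma> J ?A])
  moreover have "a + b \<le> 1/2" if "b \<le> (1 + 1/8) * a" "a \<le> 1/8" for a b :: real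
    using that by simp
  ultimately show ?thesis using assms(2) by (meson order_trans)
qed

lemma VT_bounds:
  assumes "0 \<le> \<sigma>" "MN \<sigma> J (\<lambda>i j. pd j (u i)) \<le> 1 / 8" "\<And>j. y j \<in> entire"
  shows "VN \<sigma> J (\<lambda>k. \<Sum>i\<in>J. V i k * y i) \<le> 9 / 8 * VN \<sigma> J y"
    "7 / 8 * VN \<sigma> J y \<le> VN \<sigma> J (\<lambda>k. \<Sum>i\<in>J. V i k * y i)"
    "VN \<sigma> J (\<lambda>i. \<Sum>j\<in>J. V i j * y j) \<le> 9 / 8 * VN \<sigma> J y"
  using near_identity_matvec[of \<sigma> J "\<lambda>k i. pd k (u i)" y "1/8"]
    near_identity_matvec(1)[of \<sigma> J "\<lambda>i j. pd j (u i)" y "1/8"] assms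
  by (simp_all add: V_transpose[symmetric] V_def[symmetric] MN_transpose[of \<sigma> J "\<lambda>i j. pd j (u i)"])

lemma VT_matrix_bound:
  assumes "0 \<le> \<sigma>" "MN \<sigma> J (\<lambda>i j. pd j (u i)) \<le> 1 / 8" "\<And>i j. Y i j \<in> entire"
  shows "MN \<sigma> J (\<lambda>k j. \<Sum>i\<in>J. V i k * Y i j) \<le> 9 / 8 * MN \<sigma> J Y"
  using near_identity_matmat[of \<sigma> J "\<lambda>k i. pd k (u i)" Y "1/8"] assms
  by (simp add: V_transpose[symmetric] MN_transpose[of \<sigma> J "\<lambda>i j. pd j (u i)"])

text \<open>With \<open>y = D z\<close> and \<open>q = Dinv g\<close>, the equation \<open>D (G D z) = - g\<close> integrates to \<open>y + Sm y = - q\<close> up to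
  a constant.  Projecting to low frequencies removes the constant and makes \<open>y\<close> itself the
  \<open>D\<close>-derivative of a function; this leaves the contraction \<open>y = - q - lowS y\<close>.\<close>

definition lowS :: "real \<Rightarrow> (int \<Rightarrow> tfun) \<Rightarrow> int \<Rightarrow> tfun" where
  "lowS C y k = low C (\<Sum>j\<in>J. Sm k j * y j)"

primrec approx :: "real \<Rightarrow> (int \<Rightarrow> tfun) \<Rightarrow> nat \<Rightarrow> int \<Rightarrow> tfun" where
  "approx C q 0 = (\<lambda>k. 0)"
| "approx C q (Suc n) = (\<lambda>k. - q k - lowS C (approx C q n) k)"

lemma VN_lowS:
  assumes "0 \<le> \<sigma>" "MN \<sigma> J Sm \<le> 1 / 2" "\<And>j. y j \<in> entire"
  shows "VN \<sigma> J (lowS C y) \<le> 1 / 2 * VN \<sigma> J y"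
proof -
  have "VN \<sigma> J (lowS C y) \<le> 1 * VN \<sigma> J (\<lambda>k. \<Sum>j\<in>J. Sm k j * y j)"
    using assms by (intro VN_le) (auto simp: lowS_def intro!: N_low)
  also have "\<dots> \<le> MN \<sigma> J Sm * VN \<sigma> J y" using assms matvec[of \<sigma> J Sm y] by simp
  also have "\<dots> \<le> 1 / 2 * VN \<sigma> J y" using assms by (intro mult_right_mono) auto
  finally show ?thesis .
qed

text \<open>Finitely many iterations of the contraction reach any tolerance, and every iterate is entire by
  construction.\<close>

lemma approx_solution:
  assumes \<sigma>: "0 \<le> \<sigma>" "MN \<sigma> J Sm \<le> 1 / 2" and q: "\<And>j. q j \<in> entire" "\<And>j. low C (q j) = q j"
    "\<And>j. realv (q j)" and real: "\<And>k. realv (u k)" and tol: "0 < tol"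
  shows "\<exists>y. (\<forall>j. y j \<in> entire \<and> low C (y j) = y j \<and> realv (y j)) \<and> VN \<sigma> J y \<le> 2 * VN \<sigma> J q \<and>
    VN \<sigma> J (\<lambda>k. y k + q k + lowS C y k) \<le> tol"
proof -
  let ?y = "approx C q"
  have ent: "?y n j \<in> entire" for n j
    by (induction n arbitrary: j) (auto simp: q lowS_def)
  have lowS_ent: "lowS C (?y n) j \<in> entire" for n j using ent by (simp add: lowS_def)
  have lowy: "low C (?y n j) = ?y n j" for n j
  proof (cases n)
    case 0
    then show ?thesis by (simp add: low_def)
  next
    case (Suc m)
    have "low C (lowS C (?y m) j) = lowS C (?y m) j"
      unfolding lowS_def using ent by (intro low_low) auto
    then show ?thesis using Suc lowS_ent q by (simp add: low_rules)
  qed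
  have realSm: "realv (Sm k j)" for k j
    unfolding Sm_def G_def V_def
    by (intro real_diff real_sum real_mult real_add real_kron real_pd real) auto
  have realy: "realv (?y n j)" for n j
  proof (induction n arbitrary: j)
    case (Suc n)
    have "realv (lowS C (?y n) j)" unfolding lowS_def
      using Suc ent by (intro real_low real_sum real_mult realSm) auto
    then show ?case using q by (simp add: real_diff real_uminus)
  qed (simp add: real_0)
  have bd: "VN \<sigma> J (?y n) \<le> 2 * VN \<sigma> J q" for n
  proof (induction n)
    case (Suc n)
    have "VN \<sigma> J (?y (Suc n)) \<le> VN \<sigma> J (\<lambda>j. - q j) + VN \<sigma> J (lowS C (?y n))"
      using \<sigma> q lowS_ent by (simp only: approx.simps, intro VN_diff) auto
    then show ?case using VN_lowS[where C = C and y = "?y n", OF \<sigma> ent] Suc q \<sigma> by (simp add: VN_uminus)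
  qed (use \<sigma> in \<open>simp add: VN_def sum_nonneg\<close>)
  have lin: "lowS C x k - lowS C y k = lowS C (\<lambda>k. x k - y k) k" if "\<And>j. x j \<in> entire" "\<And>j. y j \<in> entire" for x y k
    unfolding lowS_def using that
    by (simp add: right_diff_distrib sum_subtractf low_rules)
  have diff: "VN \<sigma> J (\<lambda>k. ?y n k - ?y (Suc n) k) \<le> (1/2) ^ n * VN \<sigma> J q" for n
  proof (induction n)
    case 0
    have "VN \<sigma> J (\<lambda>k. ?y 0 k - ?y (Suc 0) k) = VN \<sigma> J q"
      by (rule VN_cong) (simp add: lowS_def low_def)
    then show ?case by simp
  next
    case (Suc n)
    have "VN \<sigma> J (\<lambda>k. ?y (Suc n) k - ?y (Suc (Suc n)) k) = VN \<sigma> J (\<lambda>k. - lowS C (\<lambda>k. ?y n k - ?y (Suc n) k) k)"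
    proof (rule VN_cong)
      fix k
      define Y where "Y = ?y (Suc n)"
      have Y: "Y k = - q k - lowS C (?y n) k" "?y (Suc (Suc n)) k = - q k - lowS C Y k"
        by (simp_all add: Y_def)
      have "?y (Suc n) k - ?y (Suc (Suc n)) k = - (lowS C (?y n) k - lowS C Y k)"
        unfolding Y Y_def[symmetric] by simp
      also have "\<dots> = - lowS C (\<lambda>k. ?y n k - Y k) k"
        using lin[where x = "?y n" and y = Y] ent[of n] ent[of "Suc n"] by (simp only: Y_def) 
      finally show "?y (Suc n) k - ?y (Suc (Suc n)) k = - lowS C (\<lambda>k. ?y n k - ?y (Suc n) k) k"
        unfolding Y_def .
    qed
    also have "\<dots> = VN \<sigma> J (lowS C (\<lambda>k. ?y n k - ?y (Suc n) k))"
      using \<sigma> ent by (intro VN_uminus) (auto simp: lowS_def simp del: approx.simps)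
    also have "\<dots> \<le> 1 / 2 * VN \<sigma> J (\<lambda>k. ?y n k - ?y (Suc n) k)"
      using ent by (intro VN_lowS \<sigma>) (auto simp del: approx.simps)
    finally show ?case using Suc by simp
  qed
  have "(\<lambda>n. (1/2) ^ n * VN \<sigma> J q) \<longlonglongrightarrow> 0 * VN \<sigma> J q"
    by (intro tendsto_mult LIMSEQ_power_zero) auto
  then have "eventually (\<lambda>n. (1/2) ^ n * VN \<sigma> J q < tol) sequentially"
    using tol by (intro order_tendstoD) auto
  then obtain n where n: "(1/2) ^ n * VN \<sigma> J q < tol" by (auto simp: eventually_sequentially)
  have "VN \<sigma> J (\<lambda>k. ?y n k + q k + lowS C (?y n) k) = VN \<sigma> J (\<lambda>k. ?y n k - ?y (Suc n) k)"
    by (rule VN_cong) (simp add: algebra_simps)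
  with diff[of n] n have "VN \<sigma> J (\<lambda>k. ?y n k + q k + lowS C (?y n) k) \<le> tol" by linarith
  then show ?thesis using ent lowy realy bd by (intro exI[of _ "?y n"]) auto
qed

text \<open>For the \<open>y\<close> of \<open>approx_solution\<close> all terms on the right are small: two are high frequencies, one is the tolerance of the
  approximate solution, and two are bilinear in the residual and the correction.\<close>

lemma transposed_residual:
  assumes C: "divisors_ge C \<beta>" and y: "\<And>j. y j \<in> entire" "\<And>j. low C (y j) = y j" and k: "k \<in> J"
  shows "(\<Sum>i\<in>J. V i k * linres (\<lambda>j. Dinv C (y j)) i) =
     high C (g k) + D (high C (\<Sum>j\<in>J. Sm k j * y j)) + D (y k + Dinv C (g k) + lowS C y k)
     + (\<Sum>j\<in>J. (\<Sum>i\<in>J. V i k * pd j (e i)) * Dinv C (y j)) + (\<Sum>j\<in>J. K k j * y j)"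
proof -
  let ?s = "\<Sum>j\<in>J. Sm k j * y j"
  have z: "Dinv C (y j) \<in> entire" "D (Dinv C (y j)) = y j" for j
    using C y by (simp_all add: entire_Dinv D_Dinv)
  have s: "?s \<in> entire" using y by simp
  have "(\<Sum>j\<in>J. G k j * y j) = (\<Sum>j\<in>J. kron k j * y j) + ?s"
    by (simp add: Sm_def sum.distrib[symmetric] algebra_simps)
  also have "\<dots> = y k + ?s" using sum_kron[OF finJ k] by simp
  also have "\<dots> = (y k + Dinv C (g k) + lowS C y k) - Dinv C (g k) + (?s - low C ?s)"
    by (simp add: lowS_def)
  also have "?s - low C ?s = cst (coef ?s 0) + high C ?s"
    using split_low_high[OF s, of C] by (simp add: algebra_simps)
  finally have Gy: "(\<Sum>j\<in>J. G k j * y j) = 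
     (y k + Dinv C (g k) + lowS C y k) - Dinv C (g k) + (cst (coef ?s 0) + high C ?s)" .
  have "D (\<Sum>j\<in>J. G k j * y j) = D (y k + Dinv C (g k) + lowS C y k) - low C (g k) + D (high C ?s)"
    unfolding Gy using C y s by (simp add: D_rules D_cst entire_Dinv D_Dinv lowS_def)
  moreover have "low C (g k) = g k - high C (g k)"
    using split_low_high[OF entire_g[of k], of C] g_average[OF k]
    by (simp add: zero_fun_def[symmetric] algebra_simps)
  ultimately have "g k + D (\<Sum>j\<in>J. G k j * y j) =
      high C (g k) + D (high C ?s) + D (y k + Dinv C (g k) + lowS C y k)" by simp
  then show ?thesis
    using transpose_linres[of "\<lambda>j. Dinv C (y j)", OF z(1) k] by (simp only: z(2)) (simp add: ac_simps)
qed

end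

context small_divisor_setting
begin

section \<open>Size of the linear residual\<close>

lemma VN_D: "0 \<le> \<sigma> \<Longrightarrow> 0 < \<delta> \<Longrightarrow> (\<And>j. j \<in> J \<Longrightarrow> f j \<in> entire) \<Longrightarrow>
   VN \<sigma> J (\<lambda>j. D (f j)) \<le> \<Omega> / (h 0 * \<delta>) * VN (\<sigma> + \<delta>) J f"
  by (intro VN_le N_D(3)) (auto simp: entireD)

lemma VN_high: "0 \<le> \<sigma> \<Longrightarrow> 0 \<le> \<delta> \<Longrightarrow> (\<And>j. j \<in> J \<Longrightarrow> f j \<in> entire) \<Longrightarrow>
   VN \<sigma> J (\<lambda>j. high C (f j)) \<le> exp (- (\<delta> * C)) * VN (\<sigma> + \<delta>) J f"
  by (intro VN_le N_high) auto

text \<open>The five contributions to the linear residual, with \<open>B = 1 / \<beta>\<close>, \<open>d = 1 / \<delta>\<close>, \<open>H = 1 / h 0\<close> and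
  \<open>O' = \<Omega> / h 0\<close>; the factor \<open>7/8\<close> comes from the lower bound for \<open>V\<^sup>T\<close>.\<close>

lemma newton_constants:
  fixes \<eta> B d H O' :: real
  assumes "0 \<le> \<eta>" "1 \<le> B" "1 \<le> d" "0 \<le> H" "0 \<le> O'"
    and x: "7 / 8 * x \<le> 9/8 * \<eta>\<^sup>2 + O' * d * (9/8 * B * \<eta>\<^sup>2) + O' * d * \<eta>\<^sup>2
       + (9/8 * (H * d) * \<eta>) * (9/4 * B\<^sup>2 * \<eta>)
       + (B * (9/4 * (H * d) * \<eta>) + \<eta> * (9/4 * (O' * d * (1/8)))) * (9/4 * B * \<eta>)"
  shows "x \<le> 10 * (1 + O' + H) * (\<eta>\<^sup>2 * B\<^sup>2 * d)"
proof -
  let ?X = "\<eta>\<^sup>2 * B\<^sup>2 * d"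
  have B2: "1 \<le> B\<^sup>2" "B \<le> B\<^sup>2" using assms(2) by (auto simp: power2_eq_square mult_le_cancel_left1 mult_le_cancel_right1 intro: order_trans)
  have e2: "0 \<le> \<eta>\<^sup>2" "0 \<le> \<eta>\<^sup>2 * d" using assms by auto
  have 1: "\<eta>\<^sup>2 \<le> ?X"
  proof -
    have "\<eta>\<^sup>2 * 1 * 1 \<le> \<eta>\<^sup>2 * B\<^sup>2 * d" using B2 assms by (intro mult_mono) auto
    then show ?thesis by simp
  qed
  have "d * (B * \<eta>\<^sup>2) \<le> ?X"
    using mult_left_mono[OF B2(2) e2(2)] by (simp add: mult_ac)
  then have 2: "O' * d * (B * \<eta>\<^sup>2) \<le> O' * ?X" using mult_left_mono[OF _ assms(5)] by (fastforce simp: mult_ac)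
  have "d * \<eta>\<^sup>2 \<le> ?X"
    using mult_left_mono[OF B2(1) e2(2)] by (simp add: mult_ac)
  then have 3: "O' * d * \<eta>\<^sup>2 \<le> O' * ?X" using mult_left_mono[OF _ assms(5)] by (fastforce simp: mult_ac)
  have X: "0 \<le> ?X" using assms by auto
  have OX: "0 \<le> O' * ?X" "0 \<le> H * ?X" using X assms by auto
  have "7 / 8 * x \<le> 9/8 * \<eta>\<^sup>2 + 9/8 * (O' * d * (B * \<eta>\<^sup>2)) + O' * d * \<eta>\<^sup>2 + 81/32 * (H * ?X)
     + 81/16 * (H * ?X) + 81/128 * (O' * d * (B * \<eta>\<^sup>2))"
    using x by (simp add: power2_eq_square algebra_simps)
  also have "\<dots> \<le> 9/8 * ?X + 353/128 * (O' * ?X) + 243/32 * (H * ?X)"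
  proof -
    have gen: "9/8 * a + 9/8 * p + r + 81/32 * Z + 81/16 * Z + 81/128 * p
        \<le> 9/8 * X + 353/128 * Y + 243/32 * Z"
      if "a \<le> X" "p \<le> Y" "r \<le> Y" for a p r X Y Z :: real
      using that by linarith
    show ?thesis by (rule gen[OF 1 2 3])
  qed
  also have "\<dots> \<le> 7/8 * (10 * ?X + 10 * (O' * ?X) + 10 * (H * ?X))"
  proof -
    have gen: "9/8 * X + 353/128 * Y + 243/32 * Z \<le> 7/8 * (10 * X + 10 * Y + 10 * Z)"
      if "0 \<le> X" "0 \<le> Y" "0 \<le> Z" for X Y Z :: real
      using that by (simp add: algebra_simps)
    show ?thesis by (rule gen[OF X OX])
  qed
  finally show ?thesis by (simp add: algebra_simps)
qed

end

context newton_step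
begin

lemma entire_corr: "(\<And>j. z j \<in> entire) \<Longrightarrow> corr z i \<in> entire"
  by (simp add: corr_def)

text \<open>\<open>K\<close> has average zero, so its low part is \<open>Dinv (D K)\<close>, which is linear in the residual; its high
  part is exponentially small.\<close>

lemma MN_K:
  assumes \<sigma>: "0 \<le> \<sigma>" and \<delta>: "0 < \<delta>" and C: "divisors_ge C \<beta>"
    and A: "MN (\<sigma> + 2 * \<delta>) J (\<lambda>i j. pd j (u i)) \<le> 1 / 8"
    and e: "VN (\<sigma> + 2 * \<delta>) J e \<le> \<eta>" and cut: "exp (- (\<delta> * C)) \<le> \<eta>"
  shows "MN \<sigma> J (\<lambda>k j. \<Sum>i\<in>J. V i k * pd j (e i)) \<le> 9/8 * (1 / (h 0 * \<delta>)) * \<eta>"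
    and "MN \<sigma> J K \<le> 1 / \<beta> * (9/4 * (1 / (h 0 * \<delta>)) * \<eta>) + \<eta> * (9/4 * (\<Omega> / (h 0 * \<delta>) * (1/8)))"
proof -
  let ?A = "\<lambda>i j. pd j (u i)"
  let ?P = "\<lambda>k j. \<Sum>i\<in>J. V i k * pd j (e i)"
  let ?Q = "\<lambda>k j. \<Sum>i\<in>J. V i k * D (V i j)"
  have ent_e: "e i \<in> entire" for i by simp
  have A': "MN \<tau> J ?A \<le> 1 / 8" if "0 \<le> \<tau>" "\<tau> \<le> \<sigma> + 2 * \<delta>" for \<tau>
    using MN_mono[OF that, of J ?A] A by simp
  have e': "VN (\<sigma> + \<delta>) J e \<le> \<eta>"
    using VN_mono[of "\<sigma> + \<delta>" "\<sigma> + 2 * \<delta>" J e] \<sigma> \<delta> e ent_e by simp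
  have \<eta>: "0 \<le> \<eta>" using cut exp_gt_zero[of "- (\<delta> * C)"] by linarith
  have "MN \<sigma> J ?P \<le> 9/8 * MN \<sigma> J (\<lambda>i j. pd j (e i))"
    using \<sigma> \<delta> by (intro VT_matrix_bound A') auto
  also have "MN \<sigma> J (\<lambda>i j. pd j (e i)) \<le> 1 / (h 0 * \<delta>) * VN (\<sigma> + \<delta>) J e"
    using \<sigma> \<delta> ent_e by (intro N_pd_matrix) auto
  also have "\<dots> \<le> 1 / (h 0 * \<delta>) * \<eta>" using e' \<delta> by (intro mult_left_mono) (auto simp: less_imp_le)
  finally show P: "MN \<sigma> J ?P \<le> 9/8 * (1 / (h 0 * \<delta>)) * \<eta>" by simp
  have "MN \<sigma> J (\<lambda>k j. D (K k j)) = MN \<sigma> J (\<lambda>k j. ?P k j - ?P j k)"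
    by (intro MN_cong) (simp add: D_K)
  also have "\<dots> \<le> MN \<sigma> J ?P + MN \<sigma> J (\<lambda>k j. ?P j k)"
    using \<sigma> by (intro MN_diff) auto
  also have "MN \<sigma> J (\<lambda>k j. ?P j k) = MN \<sigma> J ?P" by (rule MN_transpose)
  finally have DK: "MN \<sigma> J (\<lambda>k j. D (K k j)) \<le> 9/4 * (1 / (h 0 * \<delta>)) * \<eta>" using P by simp
  have "MN (\<sigma> + \<delta>) J K = MN (\<sigma> + \<delta>) J (\<lambda>k j. ?Q k j - ?Q j k)"
    by (intro MN_cong) (simp add: K_def sum_subtractf mult.commute)
  also have "\<dots> \<le> MN (\<sigma> + \<delta>) J ?Q + MN (\<sigma> + \<delta>) J (\<lambda>k j. ?Q j k)"
    using \<sigma> \<delta> by (intro MN_diff) auto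
  also have "MN (\<sigma> + \<delta>) J (\<lambda>k j. ?Q j k) = MN (\<sigma> + \<delta>) J ?Q" by (rule MN_transpose)
  finally have K1: "MN (\<sigma> + \<delta>) J K \<le> MN (\<sigma> + \<delta>) J ?Q + MN (\<sigma> + \<delta>) J ?Q" .
  have Q1: "MN (\<sigma> + \<delta>) J ?Q \<le> 9/8 * MN (\<sigma> + \<delta>) J (\<lambda>i j. D (V i j))"
    using \<sigma> \<delta> by (intro VT_matrix_bound A') auto
  have Q2: "MN (\<sigma> + \<delta>) J (\<lambda>i j. D (V i j)) \<le> \<Omega> / (h 0 * \<delta>) * MN (\<sigma> + 2 * \<delta>) J ?A"
  proof (rule MN_le)
    fix i j
    have "D (V i j) = D (pd j (u i))" by (simp add: D_V D_pd)
    then show "N (\<sigma> + \<delta>) (D (V i j)) \<le> \<Omega> / (h 0 * \<delta>) * N (\<sigma> + 2 * \<delta>) (pd j (u i))"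
      using N_D(3)[of "\<sigma> + \<delta>" \<delta> "pd j (u i)"] \<sigma> \<delta> by (simp add: entireD add.commute add.left_commute)
  qed
  have O: "0 \<le> \<Omega> / (h 0 * \<delta>)" using Omega_nonneg \<delta> by (intro divide_nonneg_pos) auto
  have "\<Omega> / (h 0 * \<delta>) * MN (\<sigma> + 2 * \<delta>) J ?A \<le> \<Omega> / (h 0 * \<delta>) * (1/8)"
    using O A by (intro mult_left_mono)
  with K1 Q1 Q2 have K2: "MN (\<sigma> + \<delta>) J K \<le> 9/4 * (\<Omega> / (h 0 * \<delta>) * (1/8))" by linarith
  have "MN \<sigma> J K \<le> MN \<sigma> J (\<lambda>k j. Dinv C (D (K k j))) + MN \<sigma> J (\<lambda>k j. high C (K k j))"
  proof -
    have "MN \<sigma> J K = MN \<sigma> J (\<lambda>k j. Dinv C (D (K k j)) + high C (K k j))"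
    proof (rule MN_cong)
      fix k j assume "k \<in> J" "j \<in> J"
      then show "K k j = Dinv C (D (K k j)) + high C (K k j)"
        using split_low_high[OF entire_K[of k j], of C] K_average[of j k] C
        by (simp add: Dinv_D zero_fun_def[symmetric])
    qed
    also have "\<dots> \<le> MN \<sigma> J (\<lambda>k j. Dinv C (D (K k j))) + MN \<sigma> J (\<lambda>k j. high C (K k j))"
      using \<sigma> C by (intro MN_add) (auto intro: entire_Dinv)
    finally show ?thesis .
  qed
  also have "MN \<sigma> J (\<lambda>k j. Dinv C (D (K k j))) \<le> 1 / \<beta> * MN \<sigma> J (\<lambda>k j. D (K k j))"
    using \<sigma> C by (intro MN_le N_Dinv) auto
  also have "\<dots> \<le> 1 / \<beta> * (9/4 * (1 / (h 0 * \<delta>)) * \<eta>)"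
    using DK C by (intro mult_left_mono) (auto simp: divisors_ge_def)
  also have "MN \<sigma> J (\<lambda>k j. high C (K k j)) \<le> exp (- (\<delta> * C)) * MN (\<sigma> + \<delta>) J K"
    using \<sigma> \<delta> by (intro MN_le N_high) auto
  also have "\<dots> \<le> \<eta> * (9/4 * (\<Omega> / (h 0 * \<delta>) * (1/8)))"
    using K2 cut \<eta> by (intro mult_mono) auto
  finally show "MN \<sigma> J K \<le> 1 / \<beta> * (9/4 * (1 / (h 0 * \<delta>)) * \<eta>) + \<eta> * (9/4 * (\<Omega> / (h 0 * \<delta>) * (1/8)))"
    by simp
qed

text \<open>Both \<open>exp (- \<delta> C)\<close> and the residual are at most \<open>\<eta>\<close>, which makes every term of
  \<open>transposed_residual\<close> quadratic in \<open>\<eta>\<close>.  The width drops from \<open>\<sigma> + 2 \<delta>\<close> to \<open>\<sigma>\<close>: one \<open>\<delta>\<close> for a cutoff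
  and one for a derivative.\<close>

lemma newton_estimate:
  assumes \<sigma>: "0 \<le> \<sigma>" and \<delta>: "0 < \<delta>" "\<delta> \<le> 1" and C: "divisors_ge C \<beta>" "\<beta> \<le> 1"
    and A: "MN (\<sigma> + 2 * \<delta>) J (\<lambda>i j. pd j (u i)) \<le> 1 / 8"
    and e: "VN (\<sigma> + 2 * \<delta>) J e \<le> \<eta>" and cut: "exp (- (\<delta> * C)) \<le> \<eta>"
    and real: "\<And>k. realv (u k)" "\<And>k. realv (e k)"
  shows "\<exists>z. (\<forall>j. z j \<in> entire \<and> realv (z j)) \<and>
     VN (\<sigma> + 2 * \<delta>) J (corr z) \<le> 3 * (\<eta> / \<beta>\<^sup>2) \<and>
     VN \<sigma> J (linres z) \<le> 10 * (1 + \<Omega> / h 0 + 1 / h 0) * (\<eta>\<^sup>2 / (\<beta>\<^sup>2 * \<delta>))"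
proof -
  let ?\<rho> = "\<sigma> + 2 * \<delta>" and ?a = "\<Omega> / (h 0 * \<delta>)" and ?b = "1 / (h 0 * \<delta>)"
  have \<rho>: "0 \<le> ?\<rho>" and \<sigma>\<delta>: "0 \<le> \<sigma> + \<delta>" using \<sigma> \<delta> by auto
  have \<beta>: "0 < \<beta>" using C by (simp add: divisors_ge_def)
  have \<eta>: "0 < \<eta>" using cut exp_gt_zero[of "- (\<delta> * C)"] by linarith
  have a: "0 \<le> ?a" using Omega_nonneg \<delta> by (intro divide_nonneg_pos) auto
  have A': "MN \<sigma> J (\<lambda>i j. pd j (u i)) \<le> 1 / 8"
    using MN_mono[of \<sigma> ?\<rho> J "\<lambda>i j. pd j (u i)"] A \<sigma> \<delta> by simp
  have Sm: "MN ?\<rho> J Sm \<le> 1 / 2" by (rule MN_Sm[OF \<rho> A])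
  have gb: "VN ?\<rho> J g \<le> 9/8 * \<eta>"
    using VT_bounds(1)[OF \<rho> A, of e] e by (simp add: g_def[abs_def])
  define q where "q = (\<lambda>k. Dinv C (g k))"
  have q: "q k \<in> entire" "low C (q k) = q k" for k
    using C by (auto simp: q_def entire_Dinv low_Dinv)
  have rg: "realv (g k)" for k
    unfolding g_def V_def by (intro real_sum real_mult real_add real_kron real_pd real) auto
  have rq: "realv (q k)" for k
    unfolding q_def using C by (intro real_Dinv rg) auto
  have qb: "VN ?\<rho> J q \<le> 1 / \<beta> * (9/8 * \<eta>)"
  proof -
    have "VN ?\<rho> J q \<le> 1 / \<beta> * VN ?\<rho> J g"
      unfolding q_def using \<rho> C by (intro VN_le N_Dinv) auto
    also have "\<dots> \<le> 1 / \<beta> * (9/8 * \<eta>)" using gb \<beta> by (intro mult_left_mono) auto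
    finally show ?thesis .
  qed
  obtain y where y: "\<And>j. y j \<in> entire" "\<And>j. low C (y j) = y j" "\<And>j. realv (y j)"
    and yb: "VN ?\<rho> J y \<le> 2 * VN ?\<rho> J q"
    and r: "VN ?\<rho> J (\<lambda>k. y k + q k + lowS C y k) \<le> \<eta>\<^sup>2"
    using approx_solution[where q = q, OF \<rho> Sm q rq real(1), of "\<eta>\<^sup>2"] \<eta> by auto
  have yb: "VN ?\<rho> J y \<le> 9/4 * (1 / \<beta>) * \<eta>" using yb qb by simp
  have yb': "VN \<sigma> J y \<le> 9/4 * (1 / \<beta>) * \<eta>"
    using VN_mono[of \<sigma> ?\<rho> J y] \<sigma> \<delta> y yb by simp
  define z where "z = (\<lambda>j. Dinv C (y j))"
  have z: "z j \<in> entire" "realv (z j)" for j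
    unfolding z_def using C y by (auto intro: entire_Dinv real_Dinv)
  have zb: "VN ?\<rho> J z \<le> 9/4 * (1 / \<beta>)\<^sup>2 * \<eta>"
  proof -
    have "VN ?\<rho> J z \<le> 1 / \<beta> * VN ?\<rho> J y"
      unfolding z_def using \<rho> C y by (intro VN_le N_Dinv) auto
    also have "\<dots> \<le> 1 / \<beta> * (9/4 * (1 / \<beta>) * \<eta>)" using yb \<beta> by (intro mult_left_mono) auto
    finally show ?thesis by (simp only: power2_eq_square ac_simps)
  qed
  have zb': "VN \<sigma> J z \<le> 9/4 * (1 / \<beta>)\<^sup>2 * \<eta>"
    using VN_mono[of \<sigma> ?\<rho> J z] \<sigma> \<delta> z zb by simp
  have "VN ?\<rho> J (corr z) = VN ?\<rho> J (\<lambda>i. \<Sum>j\<in>J. V i j * z j)"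
    by (rule VN_cong) (simp add: corr_def)
  also have "\<dots> \<le> 9/8 * VN ?\<rho> J z" by (rule VT_bounds(3)[OF \<rho> A z(1)])
  also have "\<dots> \<le> 9/8 * (9/4 * (1 / \<beta>)\<^sup>2 * \<eta>)" using zb by (intro mult_left_mono) auto
  also have "\<dots> \<le> 3 * (\<eta> / \<beta>\<^sup>2)"
  proof -
    have "9/8 * (9/4 * (1 / \<beta>)\<^sup>2 * \<eta>) = 81/32 * (\<eta> / \<beta>\<^sup>2)" by (simp add: power_one_over)
    moreover have "0 \<le> \<eta> / \<beta>\<^sup>2" using \<eta> by simp
    ultimately show ?thesis by linarith
  qed
  finally have cz: "VN ?\<rho> J (corr z) \<le> 3 * (\<eta> / \<beta>\<^sup>2)" .
  define s where "s = (\<lambda>k. \<Sum>j\<in>J. Sm k j * y j)"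
  define t1 where "t1 = (\<lambda>k. high C (g k))"
  define t2 where "t2 = (\<lambda>k. D (high C (s k)))"
  define t3 where "t3 = (\<lambda>k. D (y k + q k + lowS C y k))"
  define t4 where "t4 = (\<lambda>k. \<Sum>j\<in>J. (\<Sum>i\<in>J. V i k * pd j (e i)) * z j)"
  define t5 where "t5 = (\<lambda>k. \<Sum>j\<in>J. K k j * y j)"
  have s: "s k \<in> entire" for k using y by (simp add: s_def)
  have ls: "lowS C y k \<in> entire" for k using y by (simp add: lowS_def)
  have ent: "t1 k \<in> entire" "t2 k \<in> entire" "t3 k \<in> entire" "t4 k \<in> entire" "t5 k \<in> entire" for k
    using y z q s ls by (auto simp: t1_def t2_def t3_def t4_def t5_def)
  have b1: "VN \<sigma> J t1 \<le> 9/8 * \<eta>\<^sup>2"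
  proof -
    have "VN \<sigma> J t1 \<le> exp (- (\<delta> * C)) * VN (\<sigma> + \<delta>) J g"
      unfolding t1_def using \<sigma> \<delta> by (intro VN_high) auto
    also have "VN (\<sigma> + \<delta>) J g \<le> VN ?\<rho> J g" using \<sigma>\<delta> \<delta> by (intro VN_mono) auto
    also have "\<dots> \<le> 9/8 * \<eta>" by (rule gb)
    also have "exp (- (\<delta> * C)) * (9/8 * \<eta>) \<le> \<eta> * (9/8 * \<eta>)" using cut \<eta> by (intro mult_right_mono) auto
    finally show ?thesis by (simp add: power2_eq_square)
  qed
  have b2: "VN \<sigma> J t2 \<le> ?a * (9/8 * (1 / \<beta>) * \<eta>\<^sup>2)"
  proof -
    have "VN \<sigma> J t2 \<le> ?a * VN (\<sigma> + \<delta>) J (\<lambda>k. high C (s k))"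
      unfolding t2_def using \<sigma> \<delta> s by (intro VN_D) auto
    moreover have "VN (\<sigma> + \<delta>) J (\<lambda>k. high C (s k)) \<le> \<eta> * (1/2 * (9/4 * (1 / \<beta>) * \<eta>))"
    proof -
      have "VN (\<sigma> + \<delta>) J (\<lambda>k. high C (s k)) \<le> exp (- (\<delta> * C)) * VN (\<sigma> + \<delta> + \<delta>) J s"
        using \<sigma>\<delta> \<delta> s by (intro VN_high) auto
      moreover have "\<sigma> + \<delta> + \<delta> = ?\<rho>" by simp
      moreover have "VN ?\<rho> J s \<le> MN ?\<rho> J Sm * VN ?\<rho> J y"
        unfolding s_def using \<rho> y by (intro matvec) auto
      moreover have "MN ?\<rho> J Sm * VN ?\<rho> J y \<le> 1/2 * (9/4 * (1 / \<beta>) * \<eta>)"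
        using Sm yb by (intro mult_mono) auto
      ultimately show ?thesis
        using mult_mono[OF cut, of "VN ?\<rho> J s" "1/2 * (9/4 * (1 / \<beta>) * \<eta>)"] \<eta> by simp
    qed
    ultimately have "VN \<sigma> J t2 \<le> ?a * (\<eta> * (1/2 * (9/4 * (1 / \<beta>) * \<eta>)))"
      using mult_left_mono[OF _ a] order_trans by blast
    then show ?thesis by (simp add: power2_eq_square mult_ac)
  qed
  have b3: "VN \<sigma> J t3 \<le> ?a * \<eta>\<^sup>2"
  proof -
    have "VN \<sigma> J t3 \<le> ?a * VN (\<sigma> + \<delta>) J (\<lambda>k. y k + q k + lowS C y k)"
      unfolding t3_def using \<sigma> \<delta> y q ls by (intro VN_D) auto
    moreover have "VN (\<sigma> + \<delta>) J (\<lambda>k. y k + q k + lowS C y k) \<le> VN ?\<rho> J (\<lambda>k. y k + q k + lowS C y k)"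
      using \<sigma>\<delta> \<delta> y q ls by (intro VN_mono) auto
    ultimately show ?thesis using mult_left_mono[OF order_trans[OF _ r] a] order_trans by blast
  qed
  note MNK = MN_K[OF \<sigma> \<delta>(1) C(1) A e cut]
  have b4: "VN \<sigma> J t4 \<le> (9/8 * ?b * \<eta>) * (9/4 * (1 / \<beta>)\<^sup>2 * \<eta>)"
  proof -
    have "VN \<sigma> J t4 \<le> MN \<sigma> J (\<lambda>k j. \<Sum>i\<in>J. V i k * pd j (e i)) * VN \<sigma> J z"
      unfolding t4_def using \<sigma> z by (intro matvec) auto
    also have "\<dots> \<le> (9/8 * ?b * \<eta>) * (9/4 * (1 / \<beta>)\<^sup>2 * \<eta>)"
      using MNK(1) zb' order_trans[OF MN_nonneg MNK(1)] by (intro mult_mono) auto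
    finally show ?thesis .
  qed
  have b5: "VN \<sigma> J t5 \<le> (1 / \<beta> * (9/4 * ?b * \<eta>) + \<eta> * (9/4 * (?a * (1/8)))) * (9/4 * (1 / \<beta>) * \<eta>)"
  proof -
    have "VN \<sigma> J t5 \<le> MN \<sigma> J K * VN \<sigma> J y"
      unfolding t5_def using \<sigma> y by (intro matvec) auto
    also have "\<dots> \<le> (1 / \<beta> * (9/4 * ?b * \<eta>) + \<eta> * (9/4 * (?a * (1/8)))) * (9/4 * (1 / \<beta>) * \<eta>)"
      using MNK(2) order_trans[OF MN_nonneg MNK(2)] yb' by (intro mult_mono) auto
    finally show ?thesis .
  qed
  have lz: "linres z i \<in> entire" for i
    using entire_corr[of z, OF z(1)] by (simp add: linres_def taylor_def)
  have "7/8 * VN \<sigma> J (linres z) \<le> VN \<sigma> J (\<lambda>k. \<Sum>i\<in>J. V i k * linres z i)"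
    by (rule VT_bounds(2)[OF \<sigma> A' lz])
  also have "\<dots> = VN \<sigma> J (\<lambda>k. t1 k + t2 k + t3 k + t4 k + t5 k)"
    using transposed_residual[OF C(1) y(1,2)]
    by (intro VN_cong) (simp add: t1_def t2_def t3_def t4_def t5_def s_def q_def z_def)
  also have "\<dots> \<le> VN \<sigma> J t1 + VN \<sigma> J t2 + VN \<sigma> J t3 + VN \<sigma> J t4 + VN \<sigma> J t5"
  proof -
    have "VN \<sigma> J (\<lambda>k. t1 k + t2 k + t3 k + t4 k + t5 k) \<le> VN \<sigma> J (\<lambda>k. t1 k + t2 k + t3 k + t4 k) + VN \<sigma> J t5"
      using \<sigma> ent by (intro VN_add) auto
    moreover have "VN \<sigma> J (\<lambda>k. t1 k + t2 k + t3 k + t4 k) \<le> VN \<sigma> J (\<lambda>k. t1 k + t2 k + t3 k) + VN \<sigma> J t4"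
      using \<sigma> ent by (intro VN_add) auto
    moreover have "VN \<sigma> J (\<lambda>k. t1 k + t2 k + t3 k) \<le> VN \<sigma> J (\<lambda>k. t1 k + t2 k) + VN \<sigma> J t3"
      using \<sigma> ent by (intro VN_add) auto
    moreover have "VN \<sigma> J (\<lambda>k. t1 k + t2 k) \<le> VN \<sigma> J t1 + VN \<sigma> J t2"
      using \<sigma> ent by (intro VN_add) auto
    ultimately show ?thesis by linarith
  qed
  finally have total: "7/8 * VN \<sigma> J (linres z) \<le> 9/8 * \<eta>\<^sup>2 + ?a * (9/8 * (1 / \<beta>) * \<eta>\<^sup>2) + ?a * \<eta>\<^sup>2
     + (9/8 * ?b * \<eta>) * (9/4 * (1 / \<beta>)\<^sup>2 * \<eta>)
     + (1 / \<beta> * (9/4 * ?b * \<eta>) + \<eta> * (9/4 * (?a * (1/8)))) * (9/4 * (1 / \<beta>) * \<eta>)"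
    using b1 b2 b3 b4 b5 by linarith
  have ab: "?a = \<Omega> / h 0 * (1 / \<delta>)" "?b = 1 / h 0 * (1 / \<delta>)" by simp_all
  have "VN \<sigma> J (linres z) \<le> 10 * (1 + \<Omega> / h 0 + 1 / h 0) * (\<eta>\<^sup>2 * (1 / \<beta>)\<^sup>2 * (1 / \<delta>))"
    using total unfolding ab
    by (intro newton_constants) (use \<eta> \<beta> C \<delta> Omega_nonneg in \<open>auto simp: less_imp_le intro!: divide_nonneg_pos\<close>)
  also have "\<eta>\<^sup>2 * (1 / \<beta>)\<^sup>2 * (1 / \<delta>) = \<eta>\<^sup>2 / (\<beta>\<^sup>2 * \<delta>)" by (simp add: power_one_over)
  finally have "VN \<sigma> J (linres z) \<le> 10 * (1 + \<Omega> / h 0 + 1 / h 0) * (\<eta>\<^sup>2 / (\<beta>\<^sup>2 * \<delta>))" .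
  with z cz show ?thesis by blast
qed

end

context small_divisor_setting
begin

section \<open>Estimates of the force\<close>

text \<open>The potential has width \<open>2 s\<close> and the displacement at most \<open>3/2 s\<close>.  Half of the gap absorbs the
  growth of \<open>exp (i \<nu> \<cdot> u)\<close> for small \<open>u\<close>, and the other half, \<open>s / 4\<close>, the powers of \<open>\<nu>\<close> produced by
  differentiation.\<close>

lemma l1_exp_le:
  assumes "0 < s"
  shows "l1 \<nu> \<le> 4 / (s * h 0) * exp (s / 4 * |\<nu>|\<^sub>h)"
    and "l1 \<nu> ^ 3 \<le> 27 * (4 / (s * h 0)) ^ 3 * exp (s / 4 * |\<nu>|\<^sub>h)"
proof -
  define x where "x = s / 4 * |\<nu>|\<^sub>h"
  have x: "0 \<le> x" using assms by (simp add: x_def)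
  have c: "0 \<le> 4 / (s * h 0)" using assms by (simp add: less_imp_le)
  have "l1 \<nu> \<le> |\<nu>|\<^sub>h / h 0" by (rule l1_le)
  also have "\<dots> = 4 / (s * h 0) * x" using assms by (simp add: x_def)
  finally have l: "l1 \<nu> \<le> 4 / (s * h 0) * x" .
  have "x \<le> exp x" using exp_ge_add_one_self[of x] by linarith
  then show "l1 \<nu> \<le> 4 / (s * h 0) * exp (s / 4 * |\<nu>|\<^sub>h)"
    using mult_left_mono[OF _ c] l unfolding x_def[symmetric] by (meson order_trans)
  have "x / 3 \<le> exp (x / 3)" using exp_ge_add_one_self[of "x/3"] by linarith
  then have "(x / 3) ^ 3 \<le> exp (x / 3) ^ 3" using x by (intro power_mono) auto
  also have "exp (x / 3) ^ 3 = exp x" by (simp flip: exp_of_nat_mult)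
  finally have x3: "x ^ 3 \<le> 27 * exp x" by (simp add: power_divide)
  have "l1 \<nu> ^ 3 \<le> (4 / (s * h 0) * x) ^ 3" using l by (intro power_mono) auto
  also have "\<dots> = (4 / (s * h 0)) ^ 3 * x ^ 3" by (rule power_mult_distrib)
  also have "\<dots> \<le> (4 / (s * h 0)) ^ 3 * (27 * exp x)" using x3 c by (intro mult_left_mono) auto
  finally show "l1 \<nu> ^ 3 \<le> 27 * (4 / (s * h 0)) ^ 3 * exp (s / 4 * |\<nu>|\<^sub>h)"
    by (simp add: x_def)
qed

lemma VN_force_sum:
  assumes "0 \<le> \<sigma>" "finite J" and X: "\<And>\<nu>. X \<nu> \<in> entire"
  shows "VN \<sigma> J (\<lambda>i. \<Sum>\<nu>\<in>S. cst (F \<nu>) * icomp \<nu> i * X \<nu>) \<le> (\<Sum>\<nu>\<in>S. norm (F \<nu>) * l1 \<nu> * N \<sigma> (X \<nu>))"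
proof -
  have XA: "X \<nu> \<in> A \<sigma>" for \<nu> using X assms(1) by (simp add: entireD)
  have "VN \<sigma> J (\<lambda>i. \<Sum>\<nu>\<in>S. cst (F \<nu>) * icomp \<nu> i * X \<nu>)
     \<le> (\<Sum>i\<in>J. \<Sum>\<nu>\<in>S. norm (F \<nu>) * \<bar>real_of_int (lk \<nu> i)\<bar> * N \<sigma> (X \<nu>))"
    unfolding VN_def
  proof (rule sum_mono)
    fix i
    have "N \<sigma> (\<Sum>\<nu>\<in>S. cst (F \<nu>) * icomp \<nu> i * X \<nu>) \<le> (\<Sum>\<nu>\<in>S. N \<sigma> (cst (F \<nu>) * icomp \<nu> i * X \<nu>))"
      using assms(1) X by (intro A_sum(3)) (auto simp: entireD)
    also have "\<dots> \<le> (\<Sum>\<nu>\<in>S. norm (F \<nu>) * \<bar>real_of_int (lk \<nu> i)\<bar> * N \<sigma> (X \<nu>))"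
    proof (rule sum_mono)
      fix \<nu>
      have "cst (F \<nu>) * icomp \<nu> i = cst (F \<nu> * (\<i> * of_int (lk \<nu> i)))" by (simp add: fun_eq_iff fun_apply)
      then show "N \<sigma> (cst (F \<nu>) * icomp \<nu> i * X \<nu>) \<le> norm (F \<nu>) * \<bar>real_of_int (lk \<nu> i)\<bar> * N \<sigma> (X \<nu>)"
        using A_cmult(3)[OF assms(1) XA, of "F \<nu> * (\<i> * of_int (lk \<nu> i))" \<nu>] by (simp add: norm_mult)
    qed
    finally show "N \<sigma> (\<Sum>\<nu>\<in>S. cst (F \<nu>) * icomp \<nu> i * X \<nu>)
      \<le> (\<Sum>\<nu>\<in>S. norm (F \<nu>) * \<bar>real_of_int (lk \<nu> i)\<bar> * N \<sigma> (X \<nu>))" .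
  qed
  also have "\<dots> = (\<Sum>\<nu>\<in>S. norm (F \<nu>) * (\<Sum>i\<in>J. \<bar>real_of_int (lk \<nu> i)\<bar>) * N \<sigma> (X \<nu>))"
    by (subst sum.swap) (simp add: sum_distrib_left sum_distrib_right)
  also have "\<dots> \<le> (\<Sum>\<nu>\<in>S. norm (F \<nu>) * l1 \<nu> * N \<sigma> (X \<nu>))"
    using assms(2) by (intro sum_mono mult_right_mono mult_left_mono lookup_le_l1) auto
  finally show ?thesis .
qed

lemma N_icomp_sum:
  assumes "0 \<le> \<sigma>" "finite J" "Poly_Mapping.keys \<nu> \<subseteq> J" and w: "\<And>k. w k \<in> entire"
  shows "N \<sigma> (\<Sum>k\<in>Poly_Mapping.keys \<nu>. icomp \<nu> k * w k) \<le> l1 \<nu> * VN \<sigma> J w"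
proof -
  have "N \<sigma> (\<Sum>k\<in>Poly_Mapping.keys \<nu>. icomp \<nu> k * w k) \<le> (\<Sum>k\<in>Poly_Mapping.keys \<nu>. N \<sigma> (icomp \<nu> k * w k))"
    using assms by (intro A_sum(3)) (auto simp: entireD)
  also have "\<dots> \<le> (\<Sum>k\<in>Poly_Mapping.keys \<nu>. \<bar>real_of_int (lk \<nu> k)\<bar> * VN \<sigma> J w)"
  proof (rule sum_mono)
    fix k assume k: "k \<in> Poly_Mapping.keys \<nu>"
    have "N \<sigma> (icomp \<nu> k * w k) \<le> \<bar>real_of_int (lk \<nu> k)\<bar> * N \<sigma> (w k)"
      using A_cmult(3)[OF assms(1) entireD[OF w assms(1)], of "\<i> * of_int (lk \<nu> k)" k] by (simp add: norm_mult)
    also have "\<dots> \<le> \<bar>real_of_int (lk \<nu> k)\<bar> * VN \<sigma> J w"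
      using k assms by (intro mult_left_mono N_le_VN) auto
    finally show "N \<sigma> (icomp \<nu> k * w k) \<le> \<bar>real_of_int (lk \<nu> k)\<bar> * VN \<sigma> J w" .
  qed
  finally show ?thesis by (simp add: l1_def sum_distrib_right)
qed

lemma N_wave:
  assumes "0 \<le> \<sigma>" "finite J" "Poly_Mapping.keys \<nu> \<subseteq> J" and u: "\<And>k. u k \<in> entire"
  shows "N \<sigma> (wave \<nu> u) \<le> exp (\<sigma> * |\<nu>|\<^sub>h + l1 \<nu> * VN \<sigma> J u)"
proof -
  let ?a = "\<Sum>k\<in>Poly_Mapping.keys \<nu>. icomp \<nu> k * u k"
  have a: "?a \<in> A \<sigma>" using u assms(1) by (intro entireD) auto
  have "N \<sigma> (wave \<nu> u) \<le> N \<sigma> (character \<nu>) * N \<sigma> (fexp ?a)"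
    unfolding wave_def using assms(1) A_fexp(1)[OF assms(1) a] by (intro A_mult(2)) auto
  also have "\<dots> \<le> exp (\<sigma> * |\<nu>|\<^sub>h) * exp (l1 \<nu> * VN \<sigma> J u)"
    using order_trans[OF A_fexp(2)[OF assms(1) a], of "exp (l1 \<nu> * VN \<sigma> J u)"]
      N_icomp_sum[OF assms(1-3), of u] u assms(1)
    by (intro mult_mono) (auto simp: N_character)
  finally show ?thesis by (simp add: exp_add)
qed

lemma l1_VN_le:
  assumes "0 < s" "V \<le> c * (s * h 0)" "0 \<le> c"
  shows "l1 \<nu> * V \<le> c * s * |\<nu>|\<^sub>h"
proof -
  have "l1 \<nu> * V \<le> l1 \<nu> * (c * (s * h 0))" using assms by (intro mult_left_mono) auto
  also have "\<dots> = (c * s) * (h 0 * l1 \<nu>)" by simp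
  also have "\<dots> \<le> (c * s) * |\<nu>|\<^sub>h" using assms by (intro mult_left_mono l1_le_size) auto
  finally show ?thesis .
qed

lemma force_bound:
  assumes \<sigma>: "0 \<le> \<sigma>" "\<sigma> \<le> 3 / 2 * s" and s: "0 < s" and "finite J" "finite K"
    and keys: "\<And>\<nu>. \<nu> \<in> T \<Longrightarrow> Poly_Mapping.keys \<nu> \<subseteq> K"
    and u: "\<And>k. u k \<in> entire" and ub: "VN \<sigma> K u \<le> s * h 0 / 4"
  shows "VN \<sigma> J (force F T u) \<le> 4 / (s * h 0) * (\<Sum>\<nu>\<in>T. norm (F \<nu>) * exp (2 * s * |\<nu>|\<^sub>h))"
proof -
  have "VN \<sigma> J (force F T u) \<le> (\<Sum>\<nu>\<in>T. norm (F \<nu>) * l1 \<nu> * N \<sigma> (wave \<nu> u))"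
    unfolding force_def using assms by (intro VN_force_sum) auto
  also have "\<dots> \<le> (\<Sum>\<nu>\<in>T. 4 / (s * h 0) * (norm (F \<nu>) * exp (2 * s * |\<nu>|\<^sub>h)))"
  proof (rule sum_mono)
    fix \<nu> assume \<nu>: "\<nu> \<in> T"
    have "\<sigma> * |\<nu>|\<^sub>h \<le> 3 / 2 * s * |\<nu>|\<^sub>h" using \<sigma> by (intro mult_right_mono) auto
    moreover have "l1 \<nu> * VN \<sigma> K u \<le> 1 / 4 * s * |\<nu>|\<^sub>h" using ub s by (intro l1_VN_le) auto
    ultimately have "s / 4 * |\<nu>|\<^sub>h + (\<sigma> * |\<nu>|\<^sub>h + l1 \<nu> * VN \<sigma> K u) \<le> 2 * s * |\<nu>|\<^sub>h" by simp
    then have ex: "exp (s / 4 * |\<nu>|\<^sub>h) * exp (\<sigma> * |\<nu>|\<^sub>h + l1 \<nu> * VN \<sigma> K u) \<le> exp (2 * s * |\<nu>|\<^sub>h)"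
      by (simp flip: exp_add)
    have "l1 \<nu> * N \<sigma> (wave \<nu> u) \<le> (4 / (s * h 0) * exp (s / 4 * |\<nu>|\<^sub>h)) * exp (\<sigma> * |\<nu>|\<^sub>h + l1 \<nu> * VN \<sigma> K u)"
      using assms \<nu> by (intro mult_mono l1_exp_le N_wave) (auto simp: less_imp_le)
    also have "\<dots> \<le> 4 / (s * h 0) * exp (2 * s * |\<nu>|\<^sub>h)"
      using mult_left_mono[OF ex, of "4 / (s * h 0)"] s by (simp add: less_imp_le mult.assoc)
    finally show "norm (F \<nu>) * l1 \<nu> * N \<sigma> (wave \<nu> u) \<le> 4 / (s * h 0) * (norm (F \<nu>) * exp (2 * s * |\<nu>|\<^sub>h))"
      using mult_left_mono[of _ _ "norm (F \<nu>)"] by (fastforce simp: mult_ac)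
  qed
  finally show ?thesis by (simp add: sum_distrib_left)
qed

end

context newton_step
begin

lemma taylor_eq:
  assumes w: "\<And>k. w k \<in> entire"
  shows "taylor w i = (\<Sum>\<nu>\<in>S. cst (F \<nu>) * icomp \<nu> i *
    (wave \<nu> u * (fexp (\<Sum>k\<in>Poly_Mapping.keys \<nu>. icomp \<nu> k * w k) - 1 - (\<Sum>k\<in>Poly_Mapping.keys \<nu>. icomp \<nu> k * w k))))"
proof -
  have "(\<Sum>l\<in>J. hess i l * w l) = (\<Sum>\<nu>\<in>S. cst (F \<nu>) * icomp \<nu> i * (wave \<nu> u * (\<Sum>l\<in>J. icomp \<nu> l * w l)))"
    unfolding hess_def sum_distrib_right by (subst sum.swap) (simp add: sum_distrib_left mult_ac)
  also have "\<dots> = (\<Sum>\<nu>\<in>S. cst (F \<nu>) * icomp \<nu> i * (wave \<nu> u * (\<Sum>k\<in>Poly_Mapping.keys \<nu>. icomp \<nu> k * w k)))"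
    by (intro sum.cong refl) (simp add: icomp_sum_superset[OF finJ keysJ])
  finally show ?thesis
    unfolding taylor_def force_def wave_add by (simp add: sum_subtractf right_diff_distrib)
qed

text \<open>The remainder of each wave is \<open>exp (i \<nu> \<cdot> u) (exp a - 1 - a)\<close> with \<open>a = i \<nu> \<cdot> w\<close>, quadratic in \<open>w\<close>; two
  factors \<open>\<nu>\<close> come from \<open>a\<close> and one from the gradient, hence the third power of \<open>l1\<close>.\<close>

lemma taylor_bound:
  assumes \<sigma>: "0 \<le> \<sigma>" "\<sigma> \<le> 3 / 2 * s" and s: "0 < s"
    and w: "\<And>k. w k \<in> entire" and ub: "VN \<sigma> J u \<le> s * h 0 / 8" and wb: "VN \<sigma> J w \<le> s * h 0 / 8"
    and M: "(\<Sum>\<nu>\<in>S. norm (F \<nu>) * exp (2 * s * |\<nu>|\<^sub>h)) \<le> M"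
  shows "VN \<sigma> J (taylor w) \<le> 27 * (4 / (s * h 0)) ^ 3 * M * (VN \<sigma> J w)\<^sup>2"
proof -
  let ?a = "\<lambda>\<nu>. \<Sum>k\<in>Poly_Mapping.keys \<nu>. icomp \<nu> k * w k"
  let ?c = "27 * (4 / (s * h 0)) ^ 3 * (VN \<sigma> J w)\<^sup>2"
  have c0: "0 \<le> ?c" using s by (auto intro!: mult_nonneg_nonneg zero_le_power simp: less_imp_le)
  have aA: "?a \<nu> \<in> A \<sigma>" for \<nu> using w \<sigma> by (intro entireD) auto
  have eA: "wave \<nu> u \<in> A \<sigma>" for \<nu> using \<sigma> by (intro entireD) auto
  have "VN \<sigma> J (taylor w) \<le> (\<Sum>\<nu>\<in>S. norm (F \<nu>) * l1 \<nu> * N \<sigma> (wave \<nu> u * (fexp (?a \<nu>) - 1 - ?a \<nu>)))"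
    unfolding taylor_eq[OF w] using \<sigma> w by (intro VN_force_sum) auto
  also have "\<dots> \<le> (\<Sum>\<nu>\<in>S. ?c * (norm (F \<nu>) * exp (2 * s * |\<nu>|\<^sub>h)))"
  proof (rule sum_mono)
    fix \<nu> assume \<nu>: "\<nu> \<in> S"
    let ?t = "l1 \<nu> * VN \<sigma> J w"
    have t: "N \<sigma> (?a \<nu>) \<le> ?t" using \<sigma> w keysJ[OF \<nu>] by (intro N_icomp_sum) auto
    have "\<sigma> * |\<nu>|\<^sub>h \<le> 3 / 2 * s * |\<nu>|\<^sub>h" using \<sigma> by (intro mult_right_mono) auto
    moreover have "l1 \<nu> * VN \<sigma> J u \<le> 1 / 8 * s * |\<nu>|\<^sub>h" using ub s by (intro l1_VN_le) auto
    moreover have "?t \<le> 1 / 8 * s * |\<nu>|\<^sub>h" using wb s by (intro l1_VN_le) auto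
    ultimately have "s / 4 * |\<nu>|\<^sub>h + (\<sigma> * |\<nu>|\<^sub>h + l1 \<nu> * VN \<sigma> J u) + ?t \<le> 2 * s * |\<nu>|\<^sub>h" by simp
    then have ex: "exp (s / 4 * |\<nu>|\<^sub>h) * (exp (\<sigma> * |\<nu>|\<^sub>h + l1 \<nu> * VN \<sigma> J u) * exp ?t) \<le> exp (2 * s * |\<nu>|\<^sub>h)"
      by (simp flip: exp_add)
    have "N \<sigma> (wave \<nu> u * (fexp (?a \<nu>) - 1 - ?a \<nu>)) \<le> N \<sigma> (wave \<nu> u) * N \<sigma> (fexp (?a \<nu>) - 1 - ?a \<nu>)"
      using \<sigma> by (intro A_mult(2) eA A_fexp_remainder(1) aA) auto
    also have "\<dots> \<le> exp (\<sigma> * |\<nu>|\<^sub>h + l1 \<nu> * VN \<sigma> J u) * (?t\<^sup>2 * exp ?t)"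
    proof (rule mult_mono)
      show "N \<sigma> (wave \<nu> u) \<le> exp (\<sigma> * |\<nu>|\<^sub>h + l1 \<nu> * VN \<sigma> J u)"
        using \<sigma> keysJ[OF \<nu>] by (intro N_wave) auto
      have "N \<sigma> (fexp (?a \<nu>) - 1 - ?a \<nu>) \<le> (N \<sigma> (?a \<nu>))\<^sup>2 * exp (N \<sigma> (?a \<nu>))"
        by (rule A_fexp_remainder(2)[OF \<sigma>(1) aA])
      also have "\<dots> \<le> ?t\<^sup>2 * exp ?t" using t by (intro mult_mono power_mono) auto
      finally show "N \<sigma> (fexp (?a \<nu>) - 1 - ?a \<nu>) \<le> ?t\<^sup>2 * exp ?t" .
    qed auto
    finally have "l1 \<nu> * N \<sigma> (wave \<nu> u * (fexp (?a \<nu>) - 1 - ?a \<nu>))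
      \<le> l1 \<nu> * (exp (\<sigma> * |\<nu>|\<^sub>h + l1 \<nu> * VN \<sigma> J u) * (?t\<^sup>2 * exp ?t))"
      by (rule mult_left_mono) simp
    also have "\<dots> = (VN \<sigma> J w)\<^sup>2 * (l1 \<nu> ^ 3 * (exp (\<sigma> * |\<nu>|\<^sub>h + l1 \<nu> * VN \<sigma> J u) * exp ?t))"
      by (simp add: power_mult_distrib power2_eq_square power3_eq_cube mult_ac)
    also have "\<dots> \<le> (VN \<sigma> J w)\<^sup>2 * (27 * (4 / (s * h 0)) ^ 3 * exp (s / 4 * |\<nu>|\<^sub>h) *
        (exp (\<sigma> * |\<nu>|\<^sub>h + l1 \<nu> * VN \<sigma> J u) * exp ?t))"
      using s by (intro mult_left_mono mult_right_mono l1_exp_le) auto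
    also have "\<dots> = ?c * (exp (s / 4 * |\<nu>|\<^sub>h) * (exp (\<sigma> * |\<nu>|\<^sub>h + l1 \<nu> * VN \<sigma> J u) * exp ?t))"
      by (simp add: mult_ac)
    also have "\<dots> \<le> ?c * exp (2 * s * |\<nu>|\<^sub>h)" using ex c0 by (rule mult_left_mono)
    finally have "norm (F \<nu>) * (l1 \<nu> * N \<sigma> (wave \<nu> u * (fexp (?a \<nu>) - 1 - ?a \<nu>))) \<le> norm (F \<nu>) * (?c * exp (2 * s * |\<nu>|\<^sub>h))"
      by (rule mult_left_mono) simp
    then show "norm (F \<nu>) * l1 \<nu> * N \<sigma> (wave \<nu> u * (fexp (?a \<nu>) - 1 - ?a \<nu>)) \<le> ?c * (norm (F \<nu>) * exp (2 * s * |\<nu>|\<^sub>h))"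
      by (simp add: mult_ac)
  qed
  also have "\<dots> = ?c * (\<Sum>\<nu>\<in>S. norm (F \<nu>) * exp (2 * s * |\<nu>|\<^sub>h))" by (simp add: sum_distrib_left)
  also have "\<dots> \<le> ?c * M" using M c0 by (rule mult_left_mono)
  finally show ?thesis by (simp add: mult_ac)
qed

end

context small_divisor_setting
begin

section \<open>One step of the iteration\<close>

definition supp :: "freq set \<Rightarrow> int set" where "supp S = (\<Union>\<nu>\<in>S. Poly_Mapping.keys \<nu>)"

lemma force_outside:
  assumes "i \<notin> supp S" shows "force F S u i = 0"
  unfolding force_def
proof (rule sum.neutral, rule ballI)
  fix \<nu> assume "\<nu> \<in> S"
  then have "lk \<nu> i = 0" using assms by (auto simp: supp_def in_keys_iff)
  then show "cst (F \<nu>) * icomp \<nu> i * wave \<nu> u = 0" by (simp add: fun_eq_iff fun_apply)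
qed

text \<open>The three summands stem from the linear residual, the Taylor remainder and the newly added
  frequencies of the potential.\<close>

definition step_const :: "real \<Rightarrow> real \<Rightarrow> real" where
  "step_const s M = 10 * (1 + \<Omega> / h 0 + 1 / h 0) + 9 * (27 * (4 / (s * h 0)) ^ 3 * M) + 4 / (s * h 0)"

lemma VN_zero_outside:
  assumes "finite J" "finite J'" "0 \<le> \<sigma>" "\<And>k. k \<notin> J \<Longrightarrow> w k = 0"
  shows "VN \<sigma> J' w \<le> VN \<sigma> J w"
proof -
  have "VN \<sigma> J' w = VN \<sigma> (J' \<inter> J) w"
    unfolding VN_def using assms by (intro sum.mono_neutral_right) auto
  also have "\<dots> \<le> VN \<sigma> J w" unfolding VN_def using assms by (intro sum_mono2) auto
  finally show ?thesis .
qed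

text \<open>The potential is enlarged from the frequencies \<open>S\<close> to \<open>S'\<close> at the end of the step.  The part added
  is of size \<open>\<eta>\<^sup>2\<close>, within the error allowed anyway.\<close>

lemma newton_iteration_step:
  assumes S: "finite S" "finite S'" "S \<subseteq> S'" "uminus ` S = S" and F: "\<And>\<nu>. F (- \<nu>) = cnj (F \<nu>)"
    and s: "0 < s" and \<epsilon>: "\<bar>\<epsilon>\<bar> \<le> 1" and \<delta>: "0 < \<delta>" "\<delta> \<le> 1" and \<sigma>: "0 \<le> \<sigma>" "\<sigma> + 2 * \<delta> \<le> 3 / 2 * s"
    and C: "divisors_ge C \<beta>" "\<beta> \<le> 1" and cut: "exp (- (\<delta> * C)) \<le> \<eta>"
    and u: "\<And>k. u k \<in> entire" "\<And>k. realv (u k)" "\<And>k. k \<notin> supp S \<Longrightarrow> u k = 0"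
    and A: "MN (\<sigma> + 2 * \<delta>) (supp S) (\<lambda>i j. pd j (u i)) \<le> 1 / 8"
    and ub: "VN (\<sigma> + 2 * \<delta>) (supp S) u \<le> s * h 0 / 8"
    and e: "VN (\<sigma> + 2 * \<delta>) (supp S) (resid F S \<epsilon> u) \<le> \<eta>"
    and M: "(\<Sum>\<nu>\<in>S'. norm (F \<nu>) * exp (2 * s * |\<nu>|\<^sub>h)) \<le> M"
    and tail: "(\<Sum>\<nu>\<in>S' - S. norm (F \<nu>) * exp (2 * s * |\<nu>|\<^sub>h)) \<le> \<eta>\<^sup>2"
    and small: "3 * (\<eta> / \<beta>\<^sup>2) \<le> s * h 0 / 8"
  shows "\<exists>w. (\<forall>k. w k \<in> entire \<and> realv (w k) \<and> (k \<notin> supp S \<longrightarrow> w k = 0)) \<and>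
    VN (\<sigma> + 2 * \<delta>) (supp S) w \<le> 3 * (\<eta> / \<beta>\<^sup>2) \<and>
    VN \<sigma> (supp S') (resid F S' \<epsilon> (\<lambda>k. u k + w k)) \<le> step_const s M * (\<eta>\<^sup>2 / (\<beta> ^ 4 * \<delta>))"
proof -
  let ?J = "supp S" and ?J' = "supp S'" and ?\<rho> = "\<sigma> + 2 * \<delta>"
  have fin: "finite ?J" "finite ?J'" using S by (auto simp: supp_def)
  have JJ: "?J \<subseteq> ?J'" using S by (auto simp: supp_def)
  interpret newton_step h \<omega> \<Omega> ?J S F \<epsilon> u
    using fin S u by unfold_locales (auto simp: supp_def)
  have \<rho>: "0 \<le> ?\<rho>" "\<sigma> \<le> ?\<rho>" using \<sigma> \<delta> by auto
  have \<beta>: "0 < \<beta>" using C by (simp add: divisors_ge_def)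
  obtain z where z: "\<And>j. z j \<in> entire" "\<And>j. realv (z j)"
    and cz: "VN ?\<rho> ?J (corr z) \<le> 3 * (\<eta> / \<beta>\<^sup>2)"
    and lz: "VN \<sigma> ?J (linres z) \<le> 10 * (1 + \<Omega> / h 0 + 1 / h 0) * (\<eta>\<^sup>2 / (\<beta>\<^sup>2 * \<delta>))"
    using newton_estimate[OF \<sigma>(1) \<delta> C A e cut u(2) real_resid[where u = u and F = F, OF u(2,1) F S(4)]]
    by blast
  define w where "w = corr z"
  have w: "w k \<in> entire" "realv (w k)" "k \<notin> ?J \<Longrightarrow> w k = 0" for k
    using z u by (auto simp: w_def corr_def V_def intro!: real_sum real_mult real_add real_kron real_pd real_0)
  have wb: "VN ?\<rho> ?J w \<le> 3 * (\<eta> / \<beta>\<^sup>2)" using cz by (simp add: w_def)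
  have wb': "VN \<sigma> ?J w \<le> 3 * (\<eta> / \<beta>\<^sup>2)"
    using VN_mono[OF \<sigma>(1) \<rho>(2), of ?J w] w wb by simp
  have ub': "VN \<sigma> ?J u \<le> s * h 0 / 8"
    using VN_mono[OF \<sigma>(1) \<rho>(2), of ?J u] u ub by simp
  have wt: "VN \<sigma> ?J w \<le> s * h 0 / 8" using wb' small by linarith
  let ?X = "\<eta>\<^sup>2 / (\<beta> ^ 4 * \<delta>)"
  have X0: "0 \<le> ?X" using \<beta> \<delta> by simp
  have X1: "\<eta>\<^sup>2 \<le> ?X"
  proof -
    have "\<beta> ^ 4 * \<delta> \<le> 1 * 1" using \<beta> C \<delta> by (intro mult_mono power_le_one) auto
    then show ?thesis using divide_left_mono[of "\<beta> ^ 4 * \<delta>" 1 "\<eta>\<^sup>2"] \<beta> \<delta> by simp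
  qed
  have X2: "\<eta>\<^sup>2 / (\<beta>\<^sup>2 * \<delta>) \<le> ?X"
    using \<beta> C \<delta> by (intro divide_left_mono mult_right_mono power_decreasing) auto
  have X3: "(3 * (\<eta> / \<beta>\<^sup>2))\<^sup>2 \<le> 9 * ?X"
  proof -
    have "(3 * (\<eta> / \<beta>\<^sup>2))\<^sup>2 = 9 * (\<eta>\<^sup>2 / (\<beta> ^ 4 * 1))"
      by (simp add: power_mult_distrib power_divide flip: power_mult)
    also have "\<dots> \<le> 9 * ?X" using \<beta> \<delta> by (intro mult_left_mono divide_left_mono) auto
    finally show ?thesis .
  qed
  have SM: "(\<Sum>\<nu>\<in>S. norm (F \<nu>) * exp (2 * s * |\<nu>|\<^sub>h)) \<le> M"
    using M sum_mono2[OF S(2,3), of "\<lambda>\<nu>. norm (F \<nu>) * exp (2 * s * |\<nu>|\<^sub>h)"] by fastforce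
  have M0: "0 \<le> M"
    by (rule order_trans[OF _ SM]) (auto intro!: sum_nonneg)
  have c0: "0 \<le> 4 / (s * h 0)" using s by (simp add: less_imp_le)
  have "VN \<sigma> ?J (taylor w) \<le> 27 * (4 / (s * h 0)) ^ 3 * M * (VN \<sigma> ?J w)\<^sup>2"
    using \<sigma> \<rho> s by (intro taylor_bound w ub' wt SM) auto
  also have "\<dots> \<le> 27 * (4 / (s * h 0)) ^ 3 * M * (9 * ?X)"
  proof (rule mult_left_mono)
    show "(VN \<sigma> ?J w)\<^sup>2 \<le> 9 * ?X" using power_mono[OF wb', of 2] X3 by simp
  qed (use c0 M0 in simp)
  finally have tb: "VN \<sigma> ?J (taylor w) \<le> 9 * (27 * (4 / (s * h 0)) ^ 3 * M) * ?X" by (simp only: mult_ac)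
  let ?c = "cst (of_real \<epsilon>)"
  have cb: "N \<sigma> (?c * f) \<le> 1 * N \<sigma> f" if "f \<in> entire" for f
  proof -
    have "N \<sigma> (?c * f) \<le> \<bar>\<epsilon>\<bar> * N \<sigma> f" using A_cmult(3)[OF \<sigma>(1) entireD[OF that \<sigma>(1)], of "of_real \<epsilon>"] by simp
    also have "\<dots> \<le> 1 * N \<sigma> f" using \<epsilon> by (intro mult_right_mono) auto
    finally show ?thesis .
  qed
  have le: "linres z k \<in> entire" "taylor w k \<in> entire" for k
    using z w by (auto simp: linres_def taylor_def entire_corr)
  have fe: "force F T (\<lambda>k. u k + w k) k \<in> entire" for T k using u w by simp
  \<comment> \<open>r1 is the error of the Newton step, r2 the force of the added frequencies\<close>
  define r1 where "r1 = (\<lambda>i. if i \<in> ?J then linres z i + ?c * taylor w i else 0)"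
  define r2 where "r2 = (\<lambda>i. ?c * force F (S' - S) (\<lambda>k. u k + w k) i)"
  have r: "r1 k \<in> entire" "r2 k \<in> entire" for k using le fe by (auto simp: r1_def r2_def)
  have "VN \<sigma> ?J' r1 \<le> VN \<sigma> ?J r1"
    using fin \<sigma> by (intro VN_zero_outside) (auto simp: r1_def)
  also have "\<dots> = VN \<sigma> ?J (\<lambda>i. linres z i + ?c * taylor w i)"
    by (rule VN_cong) (simp add: r1_def)
  also have "\<dots> \<le> VN \<sigma> ?J (linres z) + VN \<sigma> ?J (\<lambda>i. ?c * taylor w i)"
    using \<sigma> le by (intro VN_add) auto
  also have "VN \<sigma> ?J (\<lambda>i. ?c * taylor w i) \<le> 1 * VN \<sigma> ?J (taylor w)"
    using le by (intro VN_le cb) auto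
  finally have r1b: "VN \<sigma> ?J' r1 \<le> VN \<sigma> ?J (linres z) + VN \<sigma> ?J (taylor w)" by simp
  have uw: "VN \<sigma> ?J' (\<lambda>k. u k + w k) \<le> s * h 0 / 4"
  proof -
    have "VN \<sigma> ?J' (\<lambda>k. u k + w k) \<le> VN \<sigma> ?J' u + VN \<sigma> ?J' w"
      using \<sigma> u w by (intro VN_add) auto
    also have "\<dots> \<le> VN \<sigma> ?J u + VN \<sigma> ?J w"
      using fin \<sigma> u w by (intro add_mono VN_zero_outside) auto
    finally show ?thesis using ub' wt by simp
  qed
  have "VN \<sigma> ?J' r2 \<le> 1 * VN \<sigma> ?J' (force F (S' - S) (\<lambda>k. u k + w k))"
    unfolding r2_def using fe by (intro VN_le cb) auto
  also have "VN \<sigma> ?J' (force F (S' - S) (\<lambda>k. u k + w k)) \<le> 4 / (s * h 0) * (\<Sum>\<nu>\<in>S' - S. norm (F \<nu>) * exp (2 * s * |\<nu>|\<^sub>h))"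
    using \<sigma> \<rho> s fin u w uw by (intro force_bound[where K = ?J']) (auto simp: supp_def)
  also have "\<dots> \<le> 4 / (s * h 0) * ?X"
    using tail X1 c0 by (intro mult_left_mono) auto
  finally have r2b: "VN \<sigma> ?J' r2 \<le> 4 / (s * h 0) * ?X" by simp
  have eq: "resid F S' \<epsilon> (\<lambda>k. u k + w k) i = r1 i + r2 i" for i
  proof -
    have "force F S' (\<lambda>k. u k + w k) i = force F S (\<lambda>k. u k + w k) i + force F (S' - S) (\<lambda>k. u k + w k) i"
      unfolding force_def using sum.subset_diff[OF S(3,2)] by (simp add: add.commute)
    then have 1: "resid F S' \<epsilon> (\<lambda>k. u k + w k) i = resid F S \<epsilon> (\<lambda>k. u k + w k) i + r2 i"
      by (simp add: resid_def r2_def distrib_left)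
    have "resid F S \<epsilon> (\<lambda>k. u k + w k) i = r1 i"
    proof (cases "i \<in> ?J")
      case True
      then show ?thesis by (simp add: r1_def linres_def w_def)
    next
      case False
      then have "force F S (\<lambda>k. u k + w k) i = 0" by (rule force_outside)
      then show ?thesis using False u(3) w(3) by (simp add: r1_def resid_def D_rules)
    qed
    with 1 show ?thesis by simp
  qed
  have "VN \<sigma> ?J' (resid F S' \<epsilon> (\<lambda>k. u k + w k)) = VN \<sigma> ?J' (\<lambda>i. r1 i + r2 i)"
    by (rule VN_cong) (rule eq)
  also have "\<dots> \<le> VN \<sigma> ?J' r1 + VN \<sigma> ?J' r2" using \<sigma> r by (intro VN_add) auto
  also have "\<dots> \<le> 10 * (1 + \<Omega> / h 0 + 1 / h 0) * ?X + 9 * (27 * (4 / (s * h 0)) ^ 3 * M) * ?X + 4 / (s * h 0) * ?X"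
  proof -
    have "0 \<le> 10 * (1 + \<Omega> / h 0 + 1 / h 0)" using Omega_nonneg by (simp add: less_imp_le)
    from mult_left_mono[OF X2 this] lz
    have "VN \<sigma> ?J (linres z) \<le> 10 * (1 + \<Omega> / h 0 + 1 / h 0) * ?X" by (rule order_trans[rotated])
    with r1b r2b tb show ?thesis by (meson add_mono order_trans)
  qed
  finally have "VN \<sigma> ?J' (resid F S' \<epsilon> (\<lambda>k. u k + w k)) \<le> step_const s M * ?X"
    by (simp only: step_const_def distrib_right)
  with w wb show ?thesis by (intro exI[of _ w]) blast
qed

end

section \<open>Choice of the cutoffs\<close>

text \<open>The cutoff \<open>m n\<close> is the largest one that the size \<open>E (3/2) ^ n\<close> allows; it may stay constant over many steps, during which the losses grow
  geometrically, and then jump.\<close>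

lemma cutoff_schedule:
  fixes b :: "nat \<Rightarrow> real"
  assumes b: "\<And>m. real m + 1 \<le> b m" and sm: "summable (\<lambda>m. b m / 2 ^ m)" and \<kappa>: "0 < \<kappa>"
  shows "\<exists>E0. \<forall>E\<ge>E0. \<exists>m :: nat \<Rightarrow> nat. \<forall>n. 16 * b (m n) \<le> E * (3/2) ^ n \<and>
     (\<Sum>k<n. E * (3/2) ^ k / 2 ^ m k) \<le> \<kappa>"
proof -
  let ?c = "\<lambda>m. b m / 2 ^ m"
  have c0: "0 \<le> ?c m" for m using b[of m] by simp
  \<comment> \<open>every cutoff used will be at least M, so that only this tail of the series is spent\<close>
  obtain M where M: "suminf (\<lambda>i. ?c (i + M)) < \<kappa> / 96"
  proof -
    obtain M where "\<And>n. n \<ge> M \<Longrightarrow> norm (suminf (\<lambda>i. ?c (i + n))) < \<kappa> / 96"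
      using suminf_exist_split[OF _ sm, of "\<kappa> / 96"] \<kappa> by auto
    from this[of M] show ?thesis by (intro that[of M]) (simp add: abs_less_iff)
  qed
  have bE: "\<exists>m :: nat \<Rightarrow> nat. \<forall>n. 16 * b (m n) \<le> E * (3/2) ^ n \<and> (\<Sum>k<n. E * (3/2) ^ k / 2 ^ m k) \<le> \<kappa>"
    if E: "16 * b M \<le> E" for E
  proof -
    define e where "e = (\<lambda>n. E * (3/2) ^ n)"
    have "0 < b M" using b[of M] by linarith
    with E have E0: "0 < E" by linarith
    have eE: "E \<le> e n" for n
    proof -
      have "1 \<le> (3/2 :: real) ^ n" by (rule one_le_power) simp
      then show ?thesis using E0 unfolding e_def by (simp add: mult_le_cancel_left1)
    qed
    define Q where "Q = (\<lambda>n. {j. 16 * b j \<le> e n})"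
    have fin: "finite (Q n)" for n
    proof (rule finite_subset)
      show "Q n \<subseteq> {..nat \<lceil>e n\<rceil>}"
      proof
        fix j assume "j \<in> Q n"
        then have "real j \<le> e n" using b[of j] by (simp add: Q_def)
        then show "j \<in> {..nat \<lceil>e n\<rceil>}" by simp linarith
      qed
    qed simp
    have MQ: "M \<in> Q n" for n using E eE[of n] by (simp add: Q_def)
    define m where "m = (\<lambda>n. Max (Q n))"
    have mQ: "m n \<in> Q n" for n unfolding m_def using fin MQ by (intro Max_in) auto
    have mM: "M \<le> m n" for n unfolding m_def using fin MQ by (intro Max_ge) auto
    have mx: "e n \<le> 16 * b (m n + 1)" for n
    proof (rule ccontr)
      assume "\<not> e n \<le> 16 * b (m n + 1)"
      then have "m n + 1 \<in> Q n" by (simp add: Q_def)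
      then have "m n + 1 \<le> m n" unfolding m_def using fin by (intro Max_ge) auto
      then show False by simp
    qed
    have geo: "(\<Sum>k\<le>L. e k) \<le> 3 * e L" for L
    proof (induction L)
      case (Suc L)
      then show ?case by (simp add: e_def)
    qed (use E0 in \<open>simp add: e_def\<close>)
    have "(\<Sum>k<n. e k / 2 ^ m k) \<le> \<kappa>" for n
    proof -
      have "(\<Sum>k<n. e k / 2 ^ m k) = (\<Sum>v\<in>m ` {..<n}. \<Sum>k\<in>{k\<in>{..<n}. m k = v}. e k / 2 ^ m k)"
        by (rule sum.image_gen) simp
      also have "\<dots> \<le> (\<Sum>v\<in>m ` {..<n}. 96 * ?c (v + 1))"
      proof (rule sum_mono)
        fix v assume v: "v \<in> m ` {..<n}"
        let ?I = "{k\<in>{..<n}. m k = v}"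
        \<comment> \<open>the last step with cutoff v dominates the geometric sum over all of them\<close>
        define L where "L = Max ?I"
        have "L \<in> ?I" unfolding L_def using v by (intro Max_in) auto
        then have mL: "m L = v" by simp
        have "(\<Sum>k\<in>?I. e k / 2 ^ m k) = (\<Sum>k\<in>?I. e k) / 2 ^ v"
          by (simp add: sum_divide_distrib)
        also have "(\<Sum>k\<in>?I. e k) \<le> (\<Sum>k\<le>L. e k)"
        proof (rule sum_mono2)
          show "?I \<subseteq> {..L}" unfolding L_def by (auto intro!: Max_ge)
        qed (use E0 in \<open>auto simp: e_def\<close>)
        also have "\<dots> \<le> 3 * e L" by (rule geo)
        also have "\<dots> \<le> 48 * b (v + 1)" using mx[of L] mL by simp
        finally show "(\<Sum>k\<in>?I. e k / 2 ^ m k) \<le> 96 * ?c (v + 1)"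
          by (simp add: divide_right_mono)
      qed
      also have "\<dots> \<le> 96 * suminf (\<lambda>i. ?c (i + M))"
      proof -
        have inj: "inj_on (\<lambda>v. v + 1 - M) (m ` {..<n})"
        proof (rule inj_onI)
          fix x y assume *: "x \<in> m ` {..<n}" "y \<in> m ` {..<n}" "x + 1 - M = y + 1 - M"
          then have "M \<le> x" "M \<le> y" using mM by auto
          with * show "x = y" by linarith
        qed
        have "(\<Sum>v\<in>m ` {..<n}. ?c (v + 1)) = (\<Sum>i\<in>(\<lambda>v. v + 1 - M) ` m ` {..<n}. ?c (i + M))"
          unfolding sum.reindex[OF inj] o_def
        proof (rule sum.cong[OF refl])
          fix v assume "v \<in> m ` {..<n}"
          then have "M \<le> v" using mM by auto
          then show "?c (v + 1) = ?c (v + 1 - M + M)" by simp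
        qed
        also have "\<dots> \<le> suminf (\<lambda>i. ?c (i + M))"
          using c0 by (intro sum_le_suminf summable_ignore_initial_segment sm) auto
        finally show ?thesis unfolding sum_distrib_left[symmetric] by (rule mult_left_mono) simp
      qed
      also have "\<dots> \<le> \<kappa>" using M by simp
      finally show ?thesis .
    qed
    with mQ show ?thesis unfolding Q_def e_def by (intro exI[of _ m]) auto
  qed
  show ?thesis by (intro exI[of _ "16 * b M"]) (use bE in blast)
qed

lemma exp_schedule_sum:
  fixes E :: real
  assumes "2 \<le> E"
  shows "(\<Sum>k<n. exp (- (E * (3/2) ^ k) / 2)) \<le> 3 * exp (- E / 2)"
proof -
  define r where "r = exp (- (1/2 :: real))"
  have r: "0 < r" "r \<le> 2/3"
  proof -
    have "3/2 \<le> exp (1/2 :: real)" using exp_ge_add_one_self[of "1/2 :: real"] by simp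
    then show "r \<le> 2/3" unfolding r_def exp_minus by (simp add: field_simps)
  qed (simp add: r_def)
  have "exp (- (E * (3/2) ^ k) / 2) \<le> exp (- E / 2) * r ^ k" for k
  proof -
    have "1 + real k * (1/2) \<le> (1 + 1/2 :: real) ^ k" by (rule Bernoulli_inequality) simp
    then have "E * (1 + real k * (1/2)) \<le> E * (3/2) ^ k" using assms by (intro mult_left_mono) auto
    moreover have "real k * 2 \<le> E * real k" using mult_right_mono[OF assms, of "real k"] by (simp add: mult.commute)
    ultimately have "E + real k \<le> E * (3/2) ^ k" by (simp add: algebra_simps)
    then have "exp (- (E * (3/2) ^ k) / 2) \<le> exp (- E / 2 + real k * (- (1/2)))" by simp
    also have "\<dots> = exp (- E / 2) * r ^ k" unfolding r_def exp_add exp_of_nat_mult by simp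
    finally show ?thesis .
  qed
  then have "(\<Sum>k<n. exp (- (E * (3/2) ^ k) / 2)) \<le> (\<Sum>k<n. exp (- E / 2) * r ^ k)" by (rule sum_mono)
  also have "\<dots> = exp (- E / 2) * (\<Sum>k<n. r ^ k)" by (simp add: sum_distrib_left)
  also have "(\<Sum>k<n. r ^ k) \<le> 3"
  proof -
    have "(1 - r) * (\<Sum>k<n. r ^ k) = 1 - r ^ n" by (rule one_diff_power_eq[symmetric])
    also have "\<dots> \<le> 1" using r by simp
    finally have *: "(1 - r) * (\<Sum>k<n. r ^ k) \<le> 1" .
    have "1/3 * (\<Sum>k<n. r ^ k) \<le> (1 - r) * (\<Sum>k<n. r ^ k)"
      using r by (intro mult_right_mono sum_nonneg) auto
    with * show ?thesis by linarith
  qed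
  finally show ?thesis by simp
qed

text \<open>Powers of \<open>1 / \<beta> \<le> exp b\<close> and \<open>1 / \<delta> \<le> 2 ^ m \<le> exp b\<close> together cost at most \<open>exp (5 b)\<close>, and
  \<open>16 b \<le> E\<close>; so a squared error \<open>exp (- 2 E)\<close> still beats \<open>exp (- 3/2 E)\<close>.\<close>

lemma schedule_bounds:
  fixes E b \<delta> C :: real
  assumes E: "1 \<le> E" "8 * ln C \<le> E" and C: "1 \<le> C" and b: "16 * b \<le> E" "real m \<le> b"
    and \<delta>: "\<delta> = E / 2 ^ m"
  shows "C * (exp (- E) ^ 2 / (exp (- b) ^ 4 * \<delta>)) \<le> exp (- (E * (3/2)))"
    and "exp (- E) / exp (- b) ^ 2 \<le> exp (- E / 2)"
    and "exp (- E) / (exp (- b) ^ 2 * \<delta>) \<le> exp (- E / 2)"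
    and "exp (- (\<delta> * 2 ^ m)) \<le> exp (- E)" and "0 < \<delta>"
proof -
  show d: "0 < \<delta>" using E \<delta> by simp
  have "2 \<le> exp (1 :: real)" using exp_ge_add_one_self[of "1 :: real"] by simp
  then have "(2 :: real) ^ m \<le> exp 1 ^ m" by (rule power_mono) simp
  also have "\<dots> = exp (real m)" by (simp flip: exp_of_nat_mult)
  finally have m2: "(2 :: real) ^ m \<le> exp (real m)" .
  have inv: "1 / \<delta> \<le> exp b"
  proof -
    have "1 / \<delta> = 2 ^ m / E" by (simp add: \<delta>)
    also have "\<dots> \<le> 2 ^ m / 1" using E by (intro divide_left_mono) auto
    also have "\<dots> \<le> exp b" using m2 b(2) by (simp add: order_trans[OF m2])
    finally show ?thesis .
  qed
  have b0: "0 \<le> b" using b by linarith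
  have "C * (exp (- E) ^ 2 / (exp (- b) ^ 4 * \<delta>)) = exp (ln C) * exp (- 2 * E) * exp (4 * b) * (1 / \<delta>)"
    using C by (simp add: exp_minus power_inverse field_simps flip: exp_of_nat_mult exp_add)
  also have "\<dots> \<le> exp (ln C) * exp (- 2 * E) * exp (4 * b) * exp b"
    by (intro mult_left_mono inv) auto
  also have "\<dots> = exp (ln C - 2 * E + 5 * b)" by (simp flip: exp_add add: algebra_simps)
  also have "\<dots> \<le> exp (- (E * (3/2)))" using E b by simp
  finally show "C * (exp (- E) ^ 2 / (exp (- b) ^ 4 * \<delta>)) \<le> exp (- (E * (3/2)))" .
  have e2: "exp (- E) / exp (- b) ^ 2 = exp (- E + 2 * b)"
    by (simp add: exp_add exp_minus field_simps power2_eq_square flip: exp_add)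
  moreover have "\<dots> \<le> exp (- E / 2)" using E b by simp
  ultimately show 2: "exp (- E) / exp (- b) ^ 2 \<le> exp (- E / 2)" by simp
  have "exp (- E) / (exp (- b) ^ 2 * \<delta>) = exp (- E + 2 * b) * (1 / \<delta>)"
    using e2 by (simp flip: divide_divide_eq_left)
  also have "\<dots> \<le> exp (- E + 2 * b) * exp b" by (intro mult_left_mono inv) auto
  also have "\<dots> = exp (- E + 3 * b)" by (simp flip: exp_add)
  also have "\<dots> \<le> exp (- E / 2)" using E b by simp
  finally show "exp (- E) / (exp (- b) ^ 2 * \<delta>) \<le> exp (- E / 2)" .
  show "exp (- (\<delta> * 2 ^ m)) \<le> exp (- E)" by (simp add: \<delta>)
qed

section \<open>Bryuno vectors\<close>

text \<open>The terms of the Bryuno sum may be negative, but only summably so.  Hence divergence is possible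
  only to \<open>\<infinity>\<close>.\<close>

lemma summable_of_ereal_suminf:
  fixes r :: "nat \<Rightarrow> real"
  assumes lb: "\<And>m. - (c / 2 ^ m) \<le> r m" and fin: "suminf (\<lambda>m. ereal (r m)) \<noteq> \<infinity>"
  shows "summable r"
proof (rule ccontr)
  assume nr: "\<not> summable r"
  define a where "a = (\<lambda>m. c / 2 ^ m :: real)"
  have sa: "summable a"
    using summable_mult[OF summable_geometric[of "1/2 :: real"], of c] by (simp add: a_def power_divide)
  define r' where "r' = (\<lambda>m. r m + a m)"
  have pos: "0 \<le> r' m" for m using lb[of m] by (simp add: r'_def a_def)
  have "\<not> summable r'" using nr summable_diff[OF _ sa, of r'] by (auto simp: r'_def)
  then have "suminf (\<lambda>m. ereal (r' m)) = \<infinity>" using summable_ereal pos by blast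
  moreover have "(\<lambda>m. ereal (r' m)) sums suminf (\<lambda>m. ereal (r' m))"
    using pos by (intro summable_sums summable_ereal_pos) auto
  ultimately have "(\<lambda>n. ereal (\<Sum>m<n. r' m)) \<longlonglongrightarrow> \<infinity>" by (simp add: sums_def)
  then have r': "filterlim (\<lambda>n. \<Sum>m<n. r' m) at_top sequentially" by (simp add: tendsto_PInfty_eq_at_top)
  have "(\<lambda>n. - (\<Sum>m<n. a m)) \<longlonglongrightarrow> - suminf a"
    using summable_sums[OF sa] by (intro tendsto_minus) (simp add: sums_def)
  from filterlim_tendsto_add_at_top[OF this r']
  have "filterlim (\<lambda>n. \<Sum>m<n. r m) at_top sequentially" by (simp add: r'_def sum.distrib)
  then have "(\<lambda>n. ereal (\<Sum>m<n. r m)) \<longlonglongrightarrow> \<infinity>" by (simp add: tendsto_PInfty_eq_at_top)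
  then have "(\<lambda>m. ereal (r m)) sums \<infinity>" by (simp add: sums_def)
  then show False using fin sums_unique by fastforce
qed

text \<open>A vanishing infimum of the divisors at some level would persist at all higher levels and make the
  Bryuno sum infinite.  The summand \<open>m + 1\<close> keeps the series convergent and lets \<open>b\<close> control \<open>2 ^ m\<close> as well.\<close>

lemma bryuno_exponents:
  assumes h: "star_weight h" and bry: "star_bryuno h \<omega>"
  shows "\<exists>b. (\<forall>m. real m + 1 \<le> b m) \<and> summable (\<lambda>m. b m / 2 ^ m) \<and>
     (\<forall>m \<nu>. \<nu> \<noteq> 0 \<longrightarrow> star_norm h \<nu> \<le> 2 ^ m \<longrightarrow> exp (- b m) \<le> \<bar>freq_dot \<omega> \<nu>\<bar>)"
proof -
  interpret star_weighted h by unfold_locales (rule h)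
  let ?S = "small_divisors h \<omega>" and ?\<beta> = "star_beta h \<omega>"
  define t where "t = (\<lambda>m. if m = 0 \<or> ?S m = {} then 0 else if ?\<beta> m = 0 then \<infinity>
       else ereal (1 / 2 ^ m * ln (1 / ?\<beta> m)))"
  have fin: "suminf t \<noteq> \<infinity>"
    using bry by (simp add: star_bryuno_def star_bryuno_sum_def t_def)
  have mono: "?S m \<subseteq> ?S n" if "m \<le> n" for m n
  proof -
    have le: "(2::real) ^ m \<le> 2 ^ n" using that by simp
    show ?thesis unfolding small_divisors_def using order_trans[OF _ le] by blast
  qed
  have bdd: "bdd_below (?S m)" for m by (rule bdd_belowI[of _ 0]) (auto simp: small_divisors_def)
  have \<beta>0: "0 \<le> ?\<beta> m" if "?S m \<noteq> {}" for m
    unfolding star_beta_def using that by (intro cInf_greatest) (auto simp: small_divisors_def)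
  have \<beta>mono: "?\<beta> n \<le> ?\<beta> m" if "m \<le> n" "?S m \<noteq> {}" for m n
    unfolding star_beta_def using that mono bdd by (intro cInf_superset_mono) auto
  have \<beta>pos: "0 < ?\<beta> m" if m: "1 \<le> m" "?S m \<noteq> {}" for m
  proof (rule ccontr)
    assume "\<not> 0 < ?\<beta> m"
    then have z: "?\<beta> m = 0" using \<beta>0[OF m(2)] by simp
    have nm: "t n \<noteq> -\<infinity>" for n by (simp add: t_def)
    have tm: "t m = \<infinity>" using m z by (simp add: t_def)
    have "(\<Sum>i<n. t i) = \<infinity>" if "m < n" for n
      using that tm nm by (subst sum_Pinfty) auto
    then have "eventually (\<lambda>n. (\<Sum>i<n. t i) = \<infinity>) sequentially"
      by (auto simp: eventually_sequentially intro: exI[of _ "Suc m"])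
    then have "t sums \<infinity>" unfolding sums_def by (rule tendsto_eventually)
    then show False using fin sums_unique by fastforce
  qed
  define r where "r = (\<lambda>m. if m = 0 \<or> ?S m = {} then 0 else 1 / 2 ^ m * ln (1 / ?\<beta> m))"
  have tr: "t m = ereal (r m)" for m
  proof (cases "m = 0 \<or> ?S m = {}")
    case False
    then have "0 < ?\<beta> m" using \<beta>pos[of m] by simp
    then show ?thesis using False by (simp add: t_def r_def)
  qed (auto simp: t_def r_def)
  obtain c where c: "\<And>m. - (c / 2 ^ m) \<le> r m"
  proof (cases "\<exists>m\<ge>1. ?S m \<noteq> {}")
    case False
    then have "r m = 0" for m by (cases m) (auto simp: r_def)
    then show ?thesis by (intro that[of 0]) simp
  next
    case True
    define m1 where "m1 = (LEAST m. 1 \<le> m \<and> ?S m \<noteq> {})"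
    have m1: "1 \<le> m1" "?S m1 \<noteq> {}" using True LeastI_ex[of "\<lambda>m. 1 \<le> m \<and> ?S m \<noteq> {}"] by (auto simp: m1_def)
    show ?thesis
    proof (rule that[of "\<bar>ln (1 / ?\<beta> m1)\<bar>"])
      fix m
      show "- (\<bar>ln (1 / ?\<beta> m1)\<bar> / 2 ^ m) \<le> r m"
      proof (cases "m = 0 \<or> ?S m = {}")
        case False
        then have "m1 \<le> m" unfolding m1_def by (intro Least_le) auto
        then have "?\<beta> m \<le> ?\<beta> m1" "0 < ?\<beta> m" using \<beta>mono m1 \<beta>pos[of m] False by auto
        then have "ln (1 / ?\<beta> m1) \<le> ln (1 / ?\<beta> m)" by (simp add: ln_div)
        then have "- \<bar>ln (1 / ?\<beta> m1)\<bar> \<le> ln (1 / ?\<beta> m)" by linarith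
        then have "- \<bar>ln (1 / ?\<beta> m1)\<bar> / 2 ^ m \<le> ln (1 / ?\<beta> m) / 2 ^ m" by (intro divide_right_mono) auto
        then show ?thesis using False by (simp add: r_def)
      qed (auto simp: r_def)
    qed
  qed
  have sr: "summable r" using summable_of_ereal_suminf[OF c] fin by (simp add: tr[abs_def])
  define p where "p = (\<lambda>m. max 0 (2 ^ m * r m))"
  \<comment> \<open>level 0 is missing in the Bryuno sum; level 1 covers its frequencies\<close>
  define b where "b = (\<lambda>m. real m + 1 + p (max 1 m))"
  have p0: "0 \<le> p m" for m by (simp add: p_def)
  have src: "summable (\<lambda>m. r m + \<bar>c\<bar> / 2 ^ m)"
    using sr summable_mult[OF summable_geometric[of "1/2 :: real"], of "\<bar>c\<bar>"]
    by (intro summable_add) (auto simp: power_divide)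
  have pc: "p m / 2 ^ m \<le> r m + \<bar>c\<bar> / 2 ^ m" for m
  proof -
    have "p m / 2 ^ m = max 0 (r m)" 
    proof (cases "0 \<le> r m")
      case False
      then have "2 ^ m * r m \<le> 0" by (intro mult_nonneg_nonpos) auto
      then show ?thesis using False by (simp add: p_def)
    qed (simp add: p_def)
    moreover have "- (\<bar>c\<bar> / 2 ^ m) \<le> - (c / 2 ^ m)" by (simp add: divide_right_mono)
    ultimately show ?thesis using c[of m] by (simp add: max_def) 
  qed
  have sp: "summable (\<lambda>m. p m / 2 ^ m)"
    by (rule summable_comparison_test[OF _ src]) (use p0 pc in auto)
  have sb: "summable (\<lambda>m. b m / 2 ^ m)"
  proof -
    have "summable (\<lambda>m. real (Suc m) * (1/2) ^ m)"
      using geometric_deriv_sums[of "1/2 :: real"] by (auto simp: sums_iff)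
    with sp have "summable (\<lambda>m. real (Suc m) * (1/2) ^ m + p m / 2 ^ m)" by (rule summable_add[rotated])
    then have "summable (\<lambda>m. real (Suc (Suc m)) * (1/2) ^ Suc m + p (Suc m) / 2 ^ Suc m)"
      by (subst (asm) summable_Suc_iff[symmetric])
    also have "(\<lambda>m. real (Suc (Suc m)) * (1/2) ^ Suc m + p (Suc m) / 2 ^ Suc m) = (\<lambda>m. b (Suc m) / 2 ^ Suc m)"
      by (auto simp: b_def fun_eq_iff field_simps power_divide)
    finally show ?thesis by (subst (asm) summable_Suc_iff)
  qed
  have "exp (- b m) \<le> \<bar>freq_dot \<omega> \<nu>\<bar>" if \<nu>: "\<nu> \<noteq> 0" "star_norm h \<nu> \<le> 2 ^ m" for m \<nu>
  proof -
    define k where "k = max 1 m"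
    have "\<bar>freq_dot \<omega> \<nu>\<bar> \<in> ?S m" using \<nu> by (auto simp: small_divisors_def)
    then have mem: "\<bar>freq_dot \<omega> \<nu>\<bar> \<in> ?S k" using mono[of m k] by (auto simp: k_def)
    then have ne: "?S k \<noteq> {}" "1 \<le> k" by (auto simp: k_def)
    then have pos: "0 < ?\<beta> k" by (intro \<beta>pos)
    have "ln (1 / ?\<beta> k) \<le> p k" using ne by (simp add: p_def r_def)
    then have "- b m \<le> ln (?\<beta> k)" using pos by (simp add: b_def k_def ln_div)
    then have "exp (- b m) \<le> ?\<beta> k" using pos by (metis exp_le_cancel_iff exp_ln)
    also have "\<dots> \<le> \<bar>freq_dot \<omega> \<nu>\<bar>" unfolding star_beta_def using mem bdd by (intro cInf_lower)
    finally show ?thesis .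
  qed
  with sb p0 show ?thesis by (intro exI[of _ b]) (auto simp: b_def)
qed

context small_divisor_setting
begin

section \<open>The Newton sequence\<close>

lemma MN_add_pd:
  assumes "0 \<le> \<sigma>" "0 < \<delta>" "finite J" and u: "\<And>k. u k \<in> entire" and w: "\<And>k. w k \<in> entire"
  shows "MN \<sigma> J (\<lambda>i j. pd j (u i + w i)) \<le> MN \<sigma> J (\<lambda>i j. pd j (u i)) + 1 / (h 0 * \<delta>) * VN (\<sigma> + \<delta>) J w"
proof -
  have "MN \<sigma> J (\<lambda>i j. pd j (u i + w i)) = MN \<sigma> J (\<lambda>i j. pd j (u i) + pd j (w i))"
    using u w by (intro MN_cong) (simp add: pd_rules)
  also have "\<dots> \<le> MN \<sigma> J (\<lambda>i j. pd j (u i)) + MN \<sigma> J (\<lambda>i j. pd j (w i))"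
    using assms by (intro MN_add) auto
  also have "MN \<sigma> J (\<lambda>i j. pd j (w i)) \<le> 1 / (h 0 * \<delta>) * VN (\<sigma> + \<delta>) J w"
    using assms by (intro N_pd_matrix) auto
  finally show ?thesis by simp
qed

text \<open>The sets are made symmetric so that the truncated potentials are real.\<close>

lemma exhausting_frequencies:
  fixes F :: "freq \<Rightarrow> complex"
  assumes sm: "(\<lambda>\<nu>. norm (F \<nu>) * exp (c * |\<nu>|\<^sub>h)) summable_on UNIV" and t: "\<And>n. 0 < t n"
  shows "\<exists>S :: nat \<Rightarrow> freq set. \<forall>n. finite (S n) \<and> S n \<subseteq> S (Suc n) \<and> uminus ` S n = S n \<and>
    (\<forall>X. finite X \<longrightarrow> X \<inter> S n = {} \<longrightarrow> (\<Sum>\<nu>\<in>X. norm (F \<nu>) * exp (c * |\<nu>|\<^sub>h)) \<le> t n)"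
proof -
  let ?f = "\<lambda>\<nu>. norm (F \<nu>) * exp (c * |\<nu>|\<^sub>h)"
  have "\<exists>B. finite B \<and> (\<forall>X. finite X \<longrightarrow> X \<inter> B = {} \<longrightarrow> sum ?f X \<le> t n)" for n
  proof -
    obtain B where B: "finite B" "dist (sum ?f B) (infsum ?f UNIV) \<le> t n"
      using infsum_finite_approximation[OF sm t] by auto
    have "sum ?f X \<le> t n" if X: "finite X" "X \<inter> B = {}" for X
    proof -
      have "sum ?f B + sum ?f X = sum ?f (B \<union> X)" using B X by (subst sum.union_disjoint) auto
      also have "\<dots> \<le> infsum ?f UNIV" using B X by (intro finite_sum_le_infsum sm) auto
      finally show ?thesis using B(2) by (simp add: dist_real_def)
    qed
    with B(1) show ?thesis by blast
  qed
  then obtain B where B: "\<And>n. finite (B n)" "\<And>n X. finite X \<Longrightarrow> X \<inter> B n = {} \<Longrightarrow> sum ?f X \<le> t n"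
    by metis
  define S where "S = (\<lambda>n. \<Union>k\<le>n. B k \<union> uminus ` B k)"
  have "S n \<subseteq> S (Suc n)" for n unfolding S_def by (auto simp: le_Suc_eq)
  moreover have "uminus ` S n = S n" for n
  proof -
    have "uminus ` S n \<subseteq> S n" by (force simp: S_def)
    moreover from this have "uminus ` uminus ` S n \<subseteq> uminus ` S n" by blast
    ultimately show ?thesis by (simp add: image_image)
  qed
  moreover have "B n \<subseteq> S n" for n by (auto simp: S_def)
  ultimately show ?thesis using B by (intro exI[of _ S]) (auto simp: S_def disjoint_iff subset_iff)
qed

text \<open>The data handed over to the limit: the norms of the increments are summable at the fixed width
  \<open>5/4 s\<close>, and the residuals and the neglected part of the potential tend to zero.\<close>

definition newton_sequence_for ::
    "(freq \<Rightarrow> complex) \<Rightarrow> real \<Rightarrow> real \<Rightarrow> real \<Rightarrow> (nat \<Rightarrow> int \<Rightarrow> tfun) \<Rightarrow> (nat \<Rightarrow> freq set) \<Rightarrow> bool" where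
  "newton_sequence_for F s \<epsilon> E u S \<longleftrightarrow> u 0 = (\<lambda>k. 0) \<and> (\<forall>n. finite (S n) \<and>
     (\<forall>X. finite X \<longrightarrow> X \<inter> S n = {} \<longrightarrow> (\<Sum>\<nu>\<in>X. norm (F \<nu>) * exp (2 * s * |\<nu>|\<^sub>h)) \<le> (exp (- (E * (3/2) ^ n)))\<^sup>2) \<and>
     (\<forall>k. u n k \<in> entire \<and> realv (u n k) \<and> (k \<notin> supp (S n) \<longrightarrow> u n k = 0)) \<and>
     (\<forall>J. finite J \<longrightarrow> VN (5/4 * s) J (\<lambda>k. u (Suc n) k - u n k) \<le> 3 * exp (- (E * (3/2) ^ n) / 2)) \<and>
     VN (5/4 * s) (supp (S n)) (resid F (S n) \<epsilon> (u n)) \<le> exp (- (E * (3/2) ^ n)))"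

text \<open>The widths decrease from \<open>3/2 s\<close> to no less than \<open>5/4 s\<close>, because the total loss is at most \<open>2 (s / 8)\<close>.  The
  bounds on \<open>u\<close> and \<open>\<partial>u\<close> are carried along for all finite index sets at once, since the index set of
  the next step is larger and \<open>u\<close> may depend on all angles.\<close>

lemma newton_sequence:
  assumes s: "0 < s" and F: "\<And>\<nu>. F (- \<nu>) = cnj (F \<nu>)"
    and sm: "(\<lambda>\<nu>. norm (F \<nu>) * exp (2 * s * |\<nu>|\<^sub>h)) summable_on UNIV"
    and M: "(\<Sum>\<^sub>\<infinity>\<nu>. norm (F \<nu>) * exp (2 * s * |\<nu>|\<^sub>h)) \<le> M"
    and \<epsilon>: "\<bar>\<epsilon>\<bar> \<le> 1" "\<bar>\<epsilon>\<bar> * (4 / (s * h 0) * M) \<le> exp (- E)"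
    and b: "\<And>m. real m \<le> b m" "\<And>m \<nu>. \<nu> \<noteq> 0 \<Longrightarrow> |\<nu>|\<^sub>h \<le> 2 ^ m \<Longrightarrow> exp (- b m) \<le> \<bar>freq_dot \<omega> \<nu>\<bar>"
    and E: "2 \<le> E" "8 * ln (max 1 (step_const s M)) \<le> E" "9 * exp (- E / 2) \<le> s * h 0 / 8"
      "9 / h 0 * exp (- E / 2) \<le> 1 / 8"
    and m: "\<And>n. 16 * b (m n) \<le> E * (3/2) ^ n" "\<And>n. (\<Sum>k<n. E * (3/2) ^ k / 2 ^ m k) \<le> min (s / 8) 1"
  shows "\<exists>u S. newton_sequence_for F s \<epsilon> E u S"
proof -
  define e where "e = (\<lambda>n. E * (3/2) ^ n)"
  define \<delta> where "\<delta> = (\<lambda>n. e n / 2 ^ m n)"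
  define \<sigma> where "\<sigma> = (\<lambda>n. 3/2 * s - 2 * (\<Sum>k<n. \<delta> k))"
  \<comment> \<open>accumulated size of the corrections, in units of 3\<close>
  define x where "x = (\<lambda>n. \<Sum>k<n. exp (- e k / 2))"
  have eE: "E \<le> e n" for n
  proof -
    have "1 \<le> (3/2 :: real) ^ n" by (rule one_le_power) simp
    then show ?thesis using E unfolding e_def by (simp add: mult_le_cancel_left1)
  qed
  have "\<exists>S. \<forall>n. finite (S n) \<and> S n \<subseteq> S (Suc n) \<and> uminus ` S n = S n \<and>
    (\<forall>X. finite X \<longrightarrow> X \<inter> S n = {} \<longrightarrow> (\<Sum>\<nu>\<in>X. norm (F \<nu>) * exp (2 * s * |\<nu>|\<^sub>h)) \<le> (exp (- e n))\<^sup>2)"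
    by (rule exhausting_frequencies[OF sm]) simp
  then obtain S where S': "\<forall>n. finite (S n) \<and> S n \<subseteq> S (Suc n) \<and> uminus ` S n = S n \<and>
    (\<forall>X. finite X \<longrightarrow> X \<inter> S n = {} \<longrightarrow> (\<Sum>\<nu>\<in>X. norm (F \<nu>) * exp (2 * s * |\<nu>|\<^sub>h)) \<le> (exp (- e n))\<^sup>2)" ..
  then have S: "\<And>n. finite (S n)" "\<And>n. S n \<subseteq> S (Suc n)" "\<And>n. uminus ` S n = S n"
    "\<And>n X. finite X \<Longrightarrow> X \<inter> S n = {} \<Longrightarrow> (\<Sum>\<nu>\<in>X. norm (F \<nu>) * exp (2 * s * |\<nu>|\<^sub>h)) \<le> (exp (- e n))\<^sup>2"
    by blast+
  have fs: "finite (supp (S n))" for n using S(1) by (simp add: supp_def)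
  have SM: "(\<Sum>\<nu>\<in>S n. norm (F \<nu>) * exp (2 * s * |\<nu>|\<^sub>h)) \<le> M" for n
    using finite_sum_le_infsum[OF sm S(1), of n] M by (auto intro: order_trans)
  note sb = schedule_bounds[of "e n" "max 1 (step_const s M)" "b (m n)" "m n" "\<delta> n" for n]
  have C1: "step_const s M * (exp (- e n) ^ 2 / (exp (- b (m n)) ^ 4 * \<delta> n)) \<le> exp (- e (Suc n))"
    and C2: "exp (- e n) / exp (- b (m n)) ^ 2 \<le> exp (- e n / 2)"
    and C3: "exp (- e n) / (exp (- b (m n)) ^ 2 * \<delta> n) \<le> exp (- e n / 2)"
    and C4: "exp (- (\<delta> n * 2 ^ m n)) \<le> exp (- e n)" and \<delta>pos: "0 < \<delta> n" for n
  proof -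
    have *: "1 \<le> e n" "8 * ln (max 1 (step_const s M)) \<le> e n" "1 \<le> max 1 (step_const s M)"
      "16 * b (m n) \<le> e n" "real (m n) \<le> b (m n)" "\<delta> n = e n / 2 ^ m n"
      using order_trans[OF _ eE[of n]] E m(1)[of n] b(1) by (simp_all add: e_def \<delta>_def)
    note ** = sb[OF *]
    show "exp (- e n) / exp (- b (m n)) ^ 2 \<le> exp (- e n / 2)"
      "exp (- e n) / (exp (- b (m n)) ^ 2 * \<delta> n) \<le> exp (- e n / 2)"
      "exp (- (\<delta> n * 2 ^ m n)) \<le> exp (- e n)" "0 < \<delta> n" using **(2-5) by auto
    have "step_const s M * (exp (- e n) ^ 2 / (exp (- b (m n)) ^ 4 * \<delta> n))
      \<le> max 1 (step_const s M) * (exp (- e n) ^ 2 / (exp (- b (m n)) ^ 4 * \<delta> n))"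
      using **(5) by (intro mult_right_mono divide_nonneg_pos) auto
    also have "\<dots> \<le> exp (- (e n * (3/2)))" by (rule **(1))
    finally show "step_const s M * (exp (- e n) ^ 2 / (exp (- b (m n)) ^ 4 * \<delta> n)) \<le> exp (- e (Suc n))"
      by (simp add: e_def mult_ac)
  qed
  have sum\<delta>: "(\<Sum>k<n. \<delta> k) \<le> s / 8" "(\<Sum>k<n. \<delta> k) \<le> 1" for n
    using m(2)[of n] by (auto simp: \<delta>_def e_def)
  have \<delta>1: "\<delta> n \<le> 1" for n
    using sum\<delta>(2)[of "Suc n"] sum_nonneg[of "{..<n}" \<delta>] \<delta>pos by (fastforce simp: less_imp_le)
  have \<sigma>low: "5/4 * s \<le> \<sigma> n" for n using sum\<delta>(1)[of n] by (simp add: \<sigma>_def)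
  have \<sigma>up: "\<sigma> n \<le> 3/2 * s" for n using sum_nonneg[of "{..<n}" \<delta>] \<delta>pos by (simp add: \<sigma>_def less_imp_le)
  have \<sigma>S: "\<sigma> n = \<sigma> (Suc n) + 2 * \<delta> n" for n by (simp add: \<sigma>_def)
  have \<sigma>0: "0 \<le> \<sigma> n" for n using \<sigma>low[of n] s by simp
  have xb: "x n \<le> 3 * exp (- E / 2)" for n
    using exp_schedule_sum[OF E(1), of n] by (simp add: x_def e_def)
  define P where "P = (\<lambda>n u. (\<forall>k. u k \<in> entire \<and> realv (u k) \<and> (k \<notin> supp (S n) \<longrightarrow> u k = 0)) \<and>
     (\<forall>J. finite J \<longrightarrow> VN (\<sigma> n) J u \<le> 3 * x n \<and> MN (\<sigma> n) J (\<lambda>i j. pd j (u i)) \<le> 3 / h 0 * x n) \<and>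
     VN (\<sigma> n) (supp (S n)) (resid F (S n) \<epsilon> u) \<le> exp (- e n))"
  define Q where "Q = (\<lambda>n u u'. \<forall>J. finite J \<longrightarrow> VN (5/4 * s) J (\<lambda>k. u' k - u k :: tfun) \<le> 3 * exp (- e n / 2))"
  have P0: "P 0 (\<lambda>k. 0)"
  proof -
    have z: "VN (\<sigma> 0) J (\<lambda>k. 0) = 0" for J using \<sigma>0[of 0] by (simp add: VN_def)
    have zM: "MN (\<sigma> 0) J (\<lambda>i j. pd j 0) = 0" for J using \<sigma>0[of 0] by (simp add: MN_def pd_rules)
    have "VN (\<sigma> 0) (supp (S 0)) (resid F (S 0) \<epsilon> (\<lambda>k. 0)) \<le> \<bar>\<epsilon>\<bar> * VN (\<sigma> 0) (supp (S 0)) (force F (S 0) (\<lambda>k. 0))"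
    proof (rule VN_le)
      fix j
      have fA: "force F (S 0) (\<lambda>k. 0) j \<in> A (\<sigma> 0)" by (rule entireD[OF entire_force \<sigma>0]) simp
      show "N (\<sigma> 0) (resid F (S 0) \<epsilon> (\<lambda>k. 0) j) \<le> \<bar>\<epsilon>\<bar> * N (\<sigma> 0) (force F (S 0) (\<lambda>k. 0) j)"
        using A_cmult(3)[OF \<sigma>0 fA, of "of_real \<epsilon>"] by (simp add: resid_def D_rules)
    qed
    also have "VN (\<sigma> 0) (supp (S 0)) (force F (S 0) (\<lambda>k. 0)) \<le> 4 / (s * h 0) * (\<Sum>\<nu>\<in>S 0. norm (F \<nu>) * exp (2 * s * |\<nu>|\<^sub>h))"
      using \<sigma>0 \<sigma>up s fs z
      by (intro force_bound[where K = "supp (S 0)"]) (auto simp: supp_def less_imp_le)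
    also have "\<dots> \<le> 4 / (s * h 0) * M" using SM s by (intro mult_left_mono) (auto simp: less_imp_le)
    finally have "VN (\<sigma> 0) (supp (S 0)) (resid F (S 0) \<epsilon> (\<lambda>k. 0)) \<le> \<bar>\<epsilon>\<bar> * (4 / (s * h 0) * M)"
      by (simp add: mult_left_mono)
    also have "\<dots> \<le> exp (- e 0)" using \<epsilon> by (simp add: e_def)
    finally show ?thesis using z zM by (simp add: P_def x_def real_0)
  qed
  have step: "\<exists>u'. P (Suc n) u' \<and> Q n u u'" if P: "P n u" for n u
  proof -
    have u: "u k \<in> entire" "realv (u k)" "k \<notin> supp (S n) \<Longrightarrow> u k = 0" for k using P by (auto simp: P_def)
    have small: "3 * (exp (- e n) / (exp (- b (m n)))\<^sup>2) \<le> 3 * exp (- e n / 2)" using C2[of n] by simp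
    have "exp (- e n / 2) \<le> exp (- E / 2)" using eE[of n] by simp
    then have small': "3 * (exp (- e n) / (exp (- b (m n)))\<^sup>2) \<le> s * h 0 / 8"
      using small E(3) exp_gt_zero[of "- E / 2"] by linarith
    have ub: "VN (\<sigma> n) J u \<le> s * h 0 / 8" if "finite J" for J
    proof -
      have "VN (\<sigma> n) J u \<le> 3 * x n" using P that by (simp add: P_def)
      then show ?thesis using xb[of n] E(3) by linarith
    qed
    have A: "MN (\<sigma> n) (supp (S n)) (\<lambda>i j. pd j (u i)) \<le> 1 / 8"
    proof -
      have "MN (\<sigma> n) (supp (S n)) (\<lambda>i j. pd j (u i)) \<le> 3 / h 0 * x n" using P fs by (simp add: P_def)
      also have "\<dots> \<le> 3 / h 0 * (3 * exp (- E / 2))"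
        by (intro mult_left_mono xb) (auto simp: less_imp_le)
      also have "\<dots> = 9 / h 0 * exp (- E / 2)" by simp
      also have "\<dots> \<le> 1 / 8" by (rule E(4))
      finally show ?thesis .
    qed
    have dv: "divisors_ge (2 ^ m n) (exp (- b (m n)))" using b(2) by (auto simp: divisors_ge_def)
    have b0: "exp (- b (m n)) \<le> 1" using b(1)[of "m n"] by simp
    have res: "VN (\<sigma> n) (supp (S n)) (resid F (S n) \<epsilon> u) \<le> exp (- e n)" using P by (simp add: P_def)
    have tl: "(\<Sum>\<nu>\<in>S (Suc n) - S n. norm (F \<nu>) * exp (2 * s * |\<nu>|\<^sub>h)) \<le> (exp (- e n))\<^sup>2"
      using S(1) by (intro S(4)) auto
    obtain w where w: "\<And>k. w k \<in> entire" "\<And>k. realv (w k)" "\<And>k. k \<notin> supp (S n) \<Longrightarrow> w k = 0"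
      and wb: "VN (\<sigma> n) (supp (S n)) w \<le> 3 * (exp (- e n) / (exp (- b (m n)))\<^sup>2)"
      and r: "VN (\<sigma> (Suc n)) (supp (S (Suc n))) (resid F (S (Suc n)) \<epsilon> (\<lambda>k. u k + w k))
         \<le> step_const s M * ((exp (- e n))\<^sup>2 / (exp (- b (m n)) ^ 4 * \<delta> n))"
      using newton_iteration_step[where S = "S n" and S' = "S (Suc n)" and F = F and s = s and \<epsilon> = \<epsilon>
          and \<delta> = "\<delta> n" and \<sigma> = "\<sigma> (Suc n)" and C = "2 ^ m n" and \<beta> = "exp (- b (m n))" and \<eta> = "exp (- e n)"
          and u = u and M = M, unfolded \<sigma>S[symmetric],
          OF S(1) S(1) S(2) S(3) F s \<epsilon>(1) \<delta>pos \<delta>1 \<sigma>0 \<sigma>up dv b0 C4 u(1) u(2) u(3) A ub[OF fs] res SM tl small']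
      by blast
    have wJ: "VN (\<sigma> n) J w \<le> 3 * (exp (- e n) / (exp (- b (m n)))\<^sup>2)" if "finite J" for J
    proof -
      have "VN (\<sigma> n) J w \<le> VN (\<sigma> n) (supp (S n)) w"
        using fs that \<sigma>0 w(3) by (intro VN_zero_outside) auto
      then show ?thesis using wb by linarith
    qed
    let ?u = "\<lambda>k. u k + w k"
    have "P (Suc n) ?u"
      unfolding P_def
    proof (intro conjI allI impI)
      fix k assume "k \<notin> supp (S (Suc n))"
      then have "k \<notin> supp (S n)" using S(2)[of n] by (auto simp: supp_def)
      then show "u k + w k = 0" using u w by simp
    next
      fix J :: "int set" assume J: "finite J"
      have "VN (\<sigma> (Suc n)) J ?u \<le> VN (\<sigma> n) J ?u"
        using \<sigma>0 \<sigma>S[of n] \<delta>pos[of n] u w by (intro VN_mono) auto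
      also have "\<dots> \<le> VN (\<sigma> n) J u + VN (\<sigma> n) J w" using \<sigma>0 u w by (intro VN_add) auto
      also have "\<dots> \<le> 3 * x n + 3 * exp (- e n / 2)"
        using P J wJ[OF J] small by (intro add_mono) (auto simp: P_def)
      finally show "VN (\<sigma> (Suc n)) J ?u \<le> 3 * x (Suc n)" by (simp add: x_def)
      have "MN (\<sigma> (Suc n)) J (\<lambda>i j. pd j (?u i)) \<le> MN (\<sigma> (Suc n)) J (\<lambda>i j. pd j (u i))
          + 1 / (h 0 * (2 * \<delta> n)) * VN (\<sigma> (Suc n) + 2 * \<delta> n) J w"
        using \<sigma>0 \<delta>pos J u w by (intro MN_add_pd) auto
      also have "MN (\<sigma> (Suc n)) J (\<lambda>i j. pd j (u i)) \<le> MN (\<sigma> n) J (\<lambda>i j. pd j (u i))"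
        using \<sigma>0 \<sigma>S[of n] \<delta>pos[of n] u by (intro MN_mono) auto
      also have "\<dots> \<le> 3 / h 0 * x n" using P J by (simp add: P_def)
      also have "1 / (h 0 * (2 * \<delta> n)) * VN (\<sigma> (Suc n) + 2 * \<delta> n) J w \<le> 3 / h 0 * exp (- e n / 2)"
      proof -
        have "1 / (h 0 * (2 * \<delta> n)) * VN (\<sigma> (Suc n) + 2 * \<delta> n) J w
          \<le> 1 / (h 0 * (2 * \<delta> n)) * (3 * (exp (- e n) / (exp (- b (m n)))\<^sup>2))"
          using wJ[OF J] \<delta>pos[of n] unfolding \<sigma>S[symmetric] by (intro mult_left_mono) (auto simp: less_imp_le)
        also have "\<dots> = 3 / (2 * h 0) * (exp (- e n) / ((exp (- b (m n)))\<^sup>2 * \<delta> n))" by simp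
        also have "\<dots> \<le> 3 / h 0 * exp (- e n / 2)"
          using C3[of n] \<delta>pos[of n] by (intro mult_mono divide_left_mono) (auto simp: less_imp_le)
        finally show ?thesis .
      qed
      finally show "MN (\<sigma> (Suc n)) J (\<lambda>i j. pd j (?u i)) \<le> 3 / h 0 * x (Suc n)"
        by (simp add: x_def distrib_left add_divide_distrib)
    qed (use u w r C1[of n] in \<open>auto intro: real_add\<close>)
    moreover have "Q n u ?u"
      unfolding Q_def
    proof (intro allI impI)
      fix J :: "int set" assume J: "finite J"
      have "VN (5/4 * s) J w \<le> VN (\<sigma> n) J w" using \<sigma>low s w by (intro VN_mono) auto
      then show "VN (5/4 * s) J (\<lambda>k. ?u k - u k) \<le> 3 * exp (- e n / 2)" using wJ[OF J] small by simp
    qed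
    ultimately show ?thesis by blast
  qed
  obtain u where u: "u 0 = (\<lambda>k. 0)" "\<And>n. P n (u n)" "\<And>n. Q n (u n) (u (Suc n))"
  proof -
    define f where "f = rec_nat (\<lambda>k. 0) (\<lambda>n v. SOME v'. P (Suc n) v' \<and> Q n v v')"
    have f: "f 0 = (\<lambda>k. 0)" "f (Suc n) = (SOME v'. P (Suc n) v' \<and> Q n (f n) v')" for n by (simp_all add: f_def)
    have Pf: "P n (f n)" for n
    proof (induction n)
      case (Suc n)
      then show ?case unfolding f(2) using someI_ex[OF step] by blast
    qed (simp add: f P0)
    have "Q n (f n) (f (Suc n))" for n unfolding f(2) using someI_ex[OF step[OF Pf]] by blast
    with f Pf that show ?thesis by blast
  qed
  have res: "VN (5/4 * s) (supp (S n)) (resid F (S n) \<epsilon> (u n)) \<le> exp (- e n)" for n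
  proof -
    have ent: "u n k \<in> entire" for k using u(2)[of n] by (auto simp: P_def)
    have "VN (5/4 * s) (supp (S n)) (resid F (S n) \<epsilon> (u n)) \<le> VN (\<sigma> n) (supp (S n)) (resid F (S n) \<epsilon> (u n))"
      using \<sigma>low s ent by (intro VN_mono) auto
    then show ?thesis using u(2)[of n] by (auto simp: P_def)
  qed
  have "\<forall>k. u n k \<in> entire \<and> realv (u n k) \<and> (k \<notin> supp (S n) \<longrightarrow> u n k = 0)" for n
    using u(2)[of n] by (simp add: P_def)
  then show ?thesis
    using u(1) u(3) S(1,4) res by (intro exI[of _ u] exI[of _ S]) (simp add: newton_sequence_for_def Q_def e_def)
qed

end

section \<open>Passage to the limit\<close>

lemma norm_cis_diff_le: "norm (cis a - cis b) \<le> \<bar>a - b\<bar>"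
proof -
  have "(norm (cis a - cis b))\<^sup>2 = 2 - 2 * cos (a - b)"
    by (simp add: cmod_power2 cos_diff power2_diff algebra_simps)
  also have "\<dots> = (2 * sin ((a - b) / 2))\<^sup>2"
  proof -
    have "2 * ((a - b) / 2) = a - b" by simp
    from cos_double_sin[of "(a - b) / 2", unfolded this] show ?thesis by (simp add: power_mult_distrib)
  qed
  also have "\<dots> \<le> (a - b)\<^sup>2"
    using abs_sin_x_le_abs_x[of "(a - b) / 2"] by (intro abs_le_square_iff[THEN iffD1]) (simp add: abs_mult)
  finally show ?thesis by (simp add: abs_le_square_iff[symmetric])
qed

context small_divisor_setting
begin

lemma D_diff_A:
  assumes "0 < \<sigma>" "f \<in> A \<sigma>" "g \<in> A \<sigma>"
  shows "D (f - g) = D f - D g"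
proof -
  have fg: "f - g \<in> A \<sigma>" "coef (f - g) = (\<lambda>\<nu>. coef f \<nu> - coef g \<nu>)" using A_diff[of \<sigma> f g] assms by auto
  note Df = N_D[of 0 \<sigma>, simplified, OF assms(1,2)]
  note Dg = N_D[of 0 \<sigma>, simplified, OF assms(1,3)]
  note Dfg = N_D[of 0 \<sigma>, simplified, OF assms(1) fg(1)]
  show ?thesis
    using A_diff[OF order_refl Df(1) Dg(1)]
    by (intro A_eqI[OF Dfg(1)]) (auto simp: Df(2) Dg(2) Dfg(2) fg(2) algebra_simps)
qed

text \<open>Two applications of \<open>D\<close>, each with half of the available width.\<close>

lemma DD_diff_le:
  assumes s: "0 < s" and f: "f \<in> A s" and g: "g \<in> A s"
  shows "norm (D (D f) \<theta> - D (D g) \<theta>) \<le> (\<Omega> / (h 0 * (s / 2)))\<^sup>2 * N s (f - g)"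
proof -
  let ?c = "\<Omega> / (h 0 * (s / 2))"
  have c: "0 \<le> ?c" using Omega_nonneg s by (intro divide_nonneg_pos) auto
  have fg: "f - g \<in> A s" using A_diff(1)[OF _ f g] s by simp
  have A1: "D f \<in> A (s/2)" "D g \<in> A (s/2)" "D (f - g) \<in> A (s/2)"
    using N_D(1)[of "s/2" "s/2"] s f g fg by auto
  have A0: "D (D (f - g)) \<in> A 0" using N_D(1)[of 0 "s/2"] s A1 by auto
  have "D (D f) - D (D g) = D (D (f - g))"
    using D_diff_A[OF s f g] D_diff_A[OF _ A1(1,2)] s by simp
  then have "norm (D (D f) \<theta> - D (D g) \<theta>) = norm (D (D (f - g)) \<theta>)" by (metis minus_apply)
  also have "\<dots> \<le> N 0 (D (D (f - g)))" by (rule norm_le_N[OF order_refl A0])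
  also have "\<dots> \<le> ?c * N (s/2) (D (f - g))" using N_D(3)[of 0 "s/2"] s A1 by simp
  also have "\<dots> \<le> ?c * (?c * N s (f - g))" using N_D(3)[of "s/2" "s/2" "f - g"] s fg c by (intro mult_left_mono) auto
  finally show ?thesis by (simp only: power2_eq_square mult.assoc)
qed

lemma wave_real:
  assumes "\<And>k. realv (v k)"
  shows "wave \<nu> v \<theta> = character \<nu> (rotate_torus \<theta> (\<lambda>k. Re (v k \<theta>)))"
proof -
  have v: "v k \<theta> = of_real (Re (v k \<theta>))" for k using assms[of k] by (simp add: realv_def complex_eq_iff)
  have "(\<Sum>k\<in>Poly_Mapping.keys \<nu>. \<i> * of_int (lk \<nu> k) * v k \<theta>) = \<i> * of_real (freq_dot (\<lambda>k. Re (v k \<theta>)) \<nu>)"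
    unfolding freq_dot_def of_real_sum sum_distrib_left
    by (intro sum.cong refl) (subst v, simp)
  then show ?thesis
    by (simp add: wave_def fexp_def fun_apply sum_fun_apply character_rotate cis_conv_exp)
qed

lemma l1_square_le:
  assumes "0 < s" shows "l1 \<nu> ^ 2 \<le> (4 / (s * h 0))\<^sup>2 * exp (2 * s * |\<nu>|\<^sub>h)"
    "l1 \<nu> \<le> 4 / (s * h 0) * exp (2 * s * |\<nu>|\<^sub>h)"
proof -
  have "l1 \<nu> ^ 2 \<le> (4 / (s * h 0) * exp (s / 4 * |\<nu>|\<^sub>h))\<^sup>2"
    using l1_exp_le(1)[OF assms] by (intro power_mono) auto
  also have "\<dots> = (4 / (s * h 0))\<^sup>2 * exp (s / 2 * |\<nu>|\<^sub>h)"
    by (subst power_mult_distrib) (simp flip: exp_of_nat_mult)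
  also have "\<dots> \<le> (4 / (s * h 0))\<^sup>2 * exp (2 * s * |\<nu>|\<^sub>h)"
    using assms by (intro mult_left_mono) (auto intro: mult_right_mono)
  finally show "l1 \<nu> ^ 2 \<le> (4 / (s * h 0))\<^sup>2 * exp (2 * s * |\<nu>|\<^sub>h)" .
  have "4 / (s * h 0) * exp (s / 4 * |\<nu>|\<^sub>h) \<le> 4 / (s * h 0) * exp (2 * s * |\<nu>|\<^sub>h)"
    using assms by (intro mult_left_mono) (auto intro: mult_right_mono simp: less_imp_le)
  with l1_exp_le(1)[OF assms, of \<nu>] show "l1 \<nu> \<le> 4 / (s * h 0) * exp (2 * s * |\<nu>|\<^sub>h)" by linarith
qed

text \<open>Characters are Lipschitz with constant \<open>l1 \<nu>\<close> with respect to uniform displacement, and the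
  coefficients of \<open>f\<close> are summable against \<open>(l1 \<nu>)\<^sup>2\<close>.\<close>

lemma force_convergence:
  assumes s: "0 < s" and sm: "(\<lambda>\<nu>. norm (F \<nu>) * exp (2 * s * |\<nu>|\<^sub>h)) summable_on UNIV"
    and S: "\<And>n. finite (S n)" and t: "t \<longlonglongrightarrow> 0"
    and tail: "\<And>n X. finite X \<Longrightarrow> X \<inter> S n = {} \<Longrightarrow> (\<Sum>\<nu>\<in>X. norm (F \<nu>) * exp (2 * s * |\<nu>|\<^sub>h)) \<le> t n"
    and real: "\<And>n k. realv (u n k)" "\<And>k. realv (W k)"
    and R: "R \<longlonglongrightarrow> 0" "\<And>n k. norm (u n k \<theta> - W k \<theta>) \<le> R n"
  shows "(\<lambda>n. force F (S n) (u n) j \<theta>) \<longlonglongrightarrow>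
     (\<Sum>\<^sub>\<infinity>\<nu>. F \<nu> * (\<i> * of_int (lk \<nu> j)) * character \<nu> (rotate_torus \<theta> (\<lambda>k. Re (W k \<theta>))))"
proof -
  let ?w = "\<lambda>\<nu>. norm (F \<nu>) * exp (2 * s * |\<nu>|\<^sub>h)"
  let ?a = "\<lambda>n \<nu>. F \<nu> * (\<i> * of_int (lk \<nu> j)) * wave \<nu> (u n) \<theta>"
  let ?b = "\<lambda>\<nu>. F \<nu> * (\<i> * of_int (lk \<nu> j)) * wave \<nu> W \<theta>"
  let ?c = "4 / (s * h 0)"
  define T where "T = (\<Sum>\<^sub>\<infinity>\<nu>. ?b \<nu>)"
  have c: "0 \<le> ?c" using s by (simp add: less_imp_le)
  have bw: "norm (?b \<nu>) \<le> ?c * ?w \<nu>" for \<nu>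
  proof -
    have "norm (?b \<nu>) = norm (F \<nu>) * \<bar>real_of_int (lk \<nu> j)\<bar>" by (simp add: norm_mult wave_real[OF real(2)])
    also have "\<dots> \<le> norm (F \<nu>) * (?c * exp (2 * s * |\<nu>|\<^sub>h))"
      using order_trans[OF abs_lookup_le l1_square_le(2)[OF s]] by (intro mult_left_mono) auto
    finally show ?thesis by (simp add: mult_ac)
  qed
  have sc: "(\<lambda>\<nu>. ?c * ?w \<nu>) summable_on UNIV" by (intro summable_on_cmult_right sm)
  have sb: "?b summable_on UNIV"
    by (rule abs_summable_summable[OF Infinite_Sum.abs_summable_on_comparison_test'[OF sc bw]])
  have diff: "norm (?a n \<nu> - ?b \<nu>) \<le> R n * (?c\<^sup>2 * ?w \<nu>)" for n \<nu>
  proof -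
    let ?x = "\<lambda>k. Re (u n k \<theta>)" and ?y = "\<lambda>k. Re (W k \<theta>)"
    have R0: "0 \<le> R n" using R(2)[of n 0] norm_ge_zero order_trans by blast
    have fd: "freq_dot ?x \<nu> - freq_dot ?y \<nu> = freq_dot (\<lambda>k. ?x k - ?y k) \<nu>"
      unfolding freq_dot_def by (simp add: left_diff_distrib sum_subtractf)
    have "\<bar>?x k - ?y k\<bar> \<le> R n" for k using R(2)[of n k] abs_Re_le_cmod[of "u n k \<theta> - W k \<theta>"] by simp
    then have fr: "\<bar>freq_dot ?x \<nu> - freq_dot ?y \<nu>\<bar> \<le> R n * l1 \<nu>" unfolding fd by (rule abs_freq_dot_le)
    have "wave \<nu> (u n) \<theta> - wave \<nu> W \<theta> = character \<nu> \<theta> * (cis (freq_dot ?x \<nu>) - cis (freq_dot ?y \<nu>))"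
      by (simp add: wave_real[OF real(1)] wave_real[OF real(2)] character_rotate right_diff_distrib)
    then have "norm (wave \<nu> (u n) \<theta> - wave \<nu> W \<theta>) \<le> R n * l1 \<nu>"
      using order_trans[OF norm_cis_diff_le fr] by (simp add: norm_mult)
    then have "norm (?a n \<nu> - ?b \<nu>) \<le> norm (F \<nu>) * l1 \<nu> * (R n * l1 \<nu>)"
      unfolding right_diff_distrib[symmetric] norm_mult
      by (intro mult_mono) (auto simp: norm_mult abs_lookup_le)
    also have "\<dots> = R n * norm (F \<nu>) * l1 \<nu> ^ 2" by (simp add: power2_eq_square mult_ac)
    also have "\<dots> \<le> R n * norm (F \<nu>) * (?c\<^sup>2 * exp (2 * s * |\<nu>|\<^sub>h))"
      using R0 by (intro mult_left_mono l1_square_le s) auto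
    finally show ?thesis by (simp add: mult_ac)
  qed
  have main: "norm (force F (S n) (u n) j \<theta> - T) \<le> R n * (?c\<^sup>2 * infsum ?w UNIV) + ?c * t n" for n
  proof -
    have R0: "0 \<le> R n" using R(2)[of n 0] norm_ge_zero order_trans by blast
    have f: "force F (S n) (u n) j \<theta> = sum (?a n) (S n)"
      by (simp add: force_def sum_fun_apply fun_apply)
    have sub: "?b summable_on (- S n)" by (rule summable_on_subset_banach[OF sb]) simp
    have "T = sum ?b (S n) + infsum ?b (- S n)"
      using infsum_Un_disjoint[of ?b "S n" "- S n"] S sub by (simp add: T_def)
    then have "force F (S n) (u n) j \<theta> - T = (\<Sum>\<nu>\<in>S n. ?a n \<nu> - ?b \<nu>) - infsum ?b (- S n)"
      unfolding f by (simp add: sum_subtractf)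
    then have "norm (force F (S n) (u n) j \<theta> - T) \<le> norm (\<Sum>\<nu>\<in>S n. ?a n \<nu> - ?b \<nu>) + norm (infsum ?b (- S n))"
      by (simp only: norm_triangle_ineq4)
    also have "norm (\<Sum>\<nu>\<in>S n. ?a n \<nu> - ?b \<nu>) \<le> (\<Sum>\<nu>\<in>S n. R n * (?c\<^sup>2 * ?w \<nu>))"
      by (rule sum_norm_le) (rule diff)
    also have "\<dots> = R n * (?c\<^sup>2 * sum ?w (S n))" by (simp add: sum_distrib_left)
    also have "\<dots> \<le> R n * (?c\<^sup>2 * infsum ?w UNIV)"
      using R0 S by (intro mult_left_mono finite_sum_le_infsum sm) auto
    also have "norm (infsum ?b (- S n)) \<le> ?c * t n"
    proof -
      have sw: "(\<lambda>\<nu>. ?c * ?w \<nu>) summable_on (- S n)" by (rule summable_on_subset_banach[OF sc]) simp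
      have "norm (infsum ?b (- S n)) \<le> (\<Sum>\<^sub>\<infinity>\<nu>\<in>- S n. ?c * ?w \<nu>)"
        by (rule norm_infsum_le[OF has_sum_infsum[OF sub] has_sum_infsum[OF sw] bw])
      also have "\<dots> \<le> ?c * t n"
      proof (rule infsum_le_finite_sums[OF sw])
        fix X assume X: "finite X" "X \<subseteq> - S n"
        have "sum ?w X \<le> t n" using X by (intro tail) auto
        from mult_left_mono[OF this c] show "(\<Sum>\<nu>\<in>X. ?c * ?w \<nu>) \<le> ?c * t n" by (simp only: sum_distrib_left)
      qed
      finally show ?thesis .
    qed
    finally show ?thesis by simp
  qed
  have "(\<lambda>n. R n * (?c\<^sup>2 * infsum ?w UNIV) + ?c * t n) \<longlonglongrightarrow> 0 * (?c\<^sup>2 * infsum ?w UNIV) + ?c * 0"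
    by (intro tendsto_intros R t)
  then have "(\<lambda>n. force F (S n) (u n) j \<theta> - T) \<longlonglongrightarrow> 0"
    by (intro Lim_null_comparison[OF always_eventually[rule_format, OF main]]) simp
  then have "(\<lambda>n. force F (S n) (u n) j \<theta>) \<longlonglongrightarrow> T" by (rule LIM_zero_cancel)
  then show ?thesis unfolding T_def by (simp add: wave_real[OF real(2)])
qed

text \<open>The components of a solution as scalar functions, with absolutely summable norms.\<close>

definition solution_profile :: "(freq \<Rightarrow> complex) \<Rightarrow> real \<Rightarrow> real \<Rightarrow> real \<Rightarrow> (int \<Rightarrow> tfun) \<Rightarrow> bool" where
  "solution_profile F s \<epsilon> B W \<longleftrightarrow> (\<forall>j. W j \<in> A (5/4 * s) \<and> realv (W j)) \<and>
    (\<forall>J. finite J \<longrightarrow> VN (5/4 * s) J W \<le> B) \<and>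
    (\<forall>j \<theta>. D (D (W j)) \<theta> = - of_real \<epsilon> *
      (\<Sum>\<^sub>\<infinity>\<nu>. F \<nu> * (\<i> * of_int (lk \<nu> j)) * character \<nu> (rotate_torus \<theta> (\<lambda>k. Re (W k \<theta>)))))"

text \<open>The increments sum to the limit in norm; along the sequence the residual tends to zero and
  both of its terms converge pointwise.\<close>

lemma limit_solution:
  assumes s: "0 < s" and sm: "(\<lambda>\<nu>. norm (F \<nu>) * exp (2 * s * |\<nu>|\<^sub>h)) summable_on UNIV"
    and E: "2 \<le> E" and ns: "newton_sequence_for F s \<epsilon> E u S"
  shows "\<exists>W. solution_profile F s \<epsilon> (9 * exp (- E / 2)) W"
proof -
  note ns = ns[unfolded newton_sequence_for_def]
  have u0: "u 0 = (\<lambda>k. 0)" and S: "finite (S n)"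
    and tail: "finite X \<Longrightarrow> X \<inter> S n = {} \<Longrightarrow>
       (\<Sum>\<nu>\<in>X. norm (F \<nu>) * exp (2 * s * |\<nu>|\<^sub>h)) \<le> (exp (- (E * (3/2) ^ n)))\<^sup>2"
    and u: "u n k \<in> entire" "realv (u n k)" "k \<notin> supp (S n) \<Longrightarrow> u n k = 0"
    and du: "finite J \<Longrightarrow> VN (5/4 * s) J (\<lambda>k. u (Suc n) k - u n k) \<le> 3 * exp (- (E * (3/2) ^ n) / 2)"
    and res: "VN (5/4 * s) (supp (S n)) (resid F (S n) \<epsilon> (u n)) \<le> exp (- (E * (3/2) ^ n))" for n k X J
    using ns by blast+
  let ?\<tau> = "5/4 * s"
  have \<tau>: "0 \<le> ?\<tau>" using s by simp
  define \<rho> where "\<rho> = (\<lambda>n. 3 * exp (- (E * (3/2) ^ n) / 2))"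
  define w where "w = (\<lambda>n k. u (Suc n) k - u n k)"
  have w: "w n k \<in> A ?\<tau>" for n k using u \<tau> by (intro entireD) (auto simp: w_def)
  have Nw: "N ?\<tau> (w n k) \<le> \<rho> n" for n k using du[of "{k}" n] by (simp add: VN_def w_def \<rho>_def)
  have \<rho>0: "0 \<le> \<rho> n" for n by (simp add: \<rho>_def)
  have \<rho>sum: "sum \<rho> {..<n} \<le> 9 * exp (- E / 2)" for n
    using exp_schedule_sum[OF E, of n] by (simp add: \<rho>_def flip: sum_distrib_left)
  have s\<rho>: "summable \<rho>" by (rule summableI_nonneg_bounded[OF \<rho>0 \<rho>sum])
  have \<rho>inf: "suminf \<rho> \<le> 9 * exp (- E / 2)" by (rule suminf_le_const[OF s\<rho> \<rho>sum])
  have tele: "(\<Sum>k<n. w k j \<theta>) = u n j \<theta>" for n j \<theta>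
    by (induction n) (auto simp: u0 w_def fun_apply)
  have sN: "summable (\<lambda>k. N ?\<tau> (w (k + n) j))" for n j
    by (rule summable_comparison_test[OF _ summable_ignore_initial_segment[OF s\<rho>, of n]]) (use Nw in auto)
  have ptw: "summable (\<lambda>k. w k j \<theta>)" for j \<theta>
  proof (rule summable_comparison_test[OF _ s\<rho>])
    show "\<exists>N. \<forall>n\<ge>N. norm (w n j \<theta>) \<le> \<rho> n"
      using order_trans[OF norm_le_N[OF \<tau> w] Nw] by blast
  qed
  define W where "W = (\<lambda>j \<theta>. suminf (\<lambda>k. w k j \<theta>))"
  have Ws: "(\<lambda>k. w k j \<theta>) sums W j \<theta>" for j \<theta> unfolding W_def by (rule summable_sums[OF ptw])
  have WA: "W j \<in> A ?\<tau>" and WN: "N ?\<tau> (W j) \<le> suminf (\<lambda>k. N ?\<tau> (w k j))" for j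
    using A_suminf[OF \<tau> w _ Ws, of j] sN[of 0 j] by auto
  have Wr: "realv (W j)" for j
    unfolding realv_def
  proof
    fix \<theta>
    have "Im (w k j \<theta>) = 0" for k using u(2) by (simp add: realv_def w_def fun_apply)
    then have "(\<lambda>k. 0) sums Im (W j \<theta>)" using sums_Im[OF Ws[of j \<theta>]] by simp
    then show "Im (W j \<theta>) = 0" using sums_unique2 sums_zero by blast
  qed
  have WV: "VN ?\<tau> J W \<le> 9 * exp (- E / 2)" if J: "finite J" for J
  proof -
    have "VN ?\<tau> J W \<le> (\<Sum>j\<in>J. suminf (\<lambda>k. N ?\<tau> (w k j)))" unfolding VN_def by (intro sum_mono WN)
    also have "\<dots> = suminf (\<lambda>k. \<Sum>j\<in>J. N ?\<tau> (w k j))" using sN[of 0] by (intro suminf_sum[symmetric]) simp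
    also have "\<dots> \<le> suminf \<rho>"
      using sN[of 0] du[OF J] by (intro suminf_le s\<rho> summable_sum) (auto simp: VN_def w_def \<rho>_def)
    finally show ?thesis using \<rho>inf by linarith
  qed
  define R where "R = (\<lambda>n. suminf (\<lambda>k. \<rho> (k + n)))"
  have R0: "R \<longlonglongrightarrow> 0"
  proof -
    have "(\<lambda>n. suminf \<rho> - sum \<rho> {..<n}) \<longlonglongrightarrow> suminf \<rho> - suminf \<rho>"
      using summable_LIMSEQ[OF s\<rho>] by (intro tendsto_diff) auto
    then show ?thesis by (simp add: R_def[abs_def] suminf_minus_initial_segment[OF s\<rho>])
  qed
  have diffA: "W j - u n j \<in> A ?\<tau>" for n j using A_diff(1)[OF \<tau> WA entireD[OF u(1) \<tau>]] .
  have diffN: "N ?\<tau> (W j - u n j) \<le> R n" for n j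
  proof -
    have "(\<lambda>k. w (k + n) j \<theta>) sums (W j - u n j) \<theta>" for \<theta>
      using sums_split_initial_segment[OF Ws[of j \<theta>], of n] by (simp add: tele fun_apply)
    from A_suminf(3)[OF \<tau> w sN this]
    have "N ?\<tau> (W j - u n j) \<le> suminf (\<lambda>k. N ?\<tau> (w (k + n) j))" .
    also have "\<dots> \<le> R n" unfolding R_def
      by (intro suminf_le sN summable_ignore_initial_segment s\<rho> Nw)
    finally show ?thesis .
  qed
  have uW: "norm (u n k \<theta> - W k \<theta>) \<le> R n" for n k \<theta>
    using order_trans[OF norm_le_N[OF \<tau> diffA, of k n \<theta>] diffN] by (simp add: fun_apply norm_minus_commute)
  let ?t = "\<lambda>n. (exp (- (E * (3/2) ^ n)))\<^sup>2"
  have \<rho>lim: "\<rho> \<longlonglongrightarrow> 0" by (rule summable_LIMSEQ_zero[OF s\<rho>])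
  have ex\<rho>: "exp (- (E * (3/2) ^ n)) \<le> \<rho> n" for n
  proof -
    have "0 \<le> E * (3/2) ^ n" using E by simp
    then have "exp (- (E * (3/2) ^ n)) \<le> exp (- (E * (3/2) ^ n) / 2)" by simp
    then show ?thesis unfolding \<rho>_def using exp_gt_zero[of "- (E * (3/2) ^ n) / 2"] by linarith
  qed
  have elim: "(\<lambda>n. exp (- (E * (3/2) ^ n))) \<longlonglongrightarrow> 0"
    by (rule Lim_null_comparison[OF always_eventually \<rho>lim]) (use ex\<rho> in simp)
  have tlim: "?t \<longlonglongrightarrow> 0" using tendsto_power[OF elim, of 2] by simp
  have eq: "D (D (W j)) \<theta> = - of_real \<epsilon> *
      (\<Sum>\<^sub>\<infinity>\<nu>. F \<nu> * (\<i> * of_int (lk \<nu> j)) * character \<nu> (rotate_torus \<theta> (\<lambda>k. Re (W k \<theta>))))" (is "_ = - of_real \<epsilon> * ?T") for j \<theta>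
  proof -
    have f: "(\<lambda>n. force F (S n) (u n) j \<theta>) \<longlonglongrightarrow> ?T"
      by (rule force_convergence[OF s sm S tlim tail u(2) Wr R0 uW])
    have rz: "(\<lambda>n. resid F (S n) \<epsilon> (u n) j \<theta>) \<longlonglongrightarrow> 0"
    proof (rule Lim_null_comparison[OF always_eventually elim], rule allI)
      fix n
      show "norm (resid F (S n) \<epsilon> (u n) j \<theta>) \<le> exp (- (E * (3/2) ^ n))"
      proof (cases "j \<in> supp (S n)")
        case True
        have "finite (supp (S n))" using S by (simp add: supp_def)
        from N_le_VN[OF this True, of ?\<tau> "resid F (S n) \<epsilon> (u n)"] res[of n]
        have "N ?\<tau> (resid F (S n) \<epsilon> (u n) j) \<le> exp (- (E * (3/2) ^ n))" by linarith
        with norm_le_N[OF \<tau> entireD[OF entire_resid \<tau>], of "u n" F "S n" \<epsilon> j \<theta>] u(1) show ?thesis by force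
      next
        case False
        then have "force F (S n) (u n) j = 0" by (rule force_outside)
        then show ?thesis using u(3)[OF False] by (simp add: resid_def D_rules fun_apply)
      qed
    qed
    have "(\<lambda>n. resid F (S n) \<epsilon> (u n) j \<theta> - of_real \<epsilon> * force F (S n) (u n) j \<theta>) \<longlonglongrightarrow> 0 - of_real \<epsilon> * ?T"
      by (intro tendsto_intros rz f)
    then have 1: "(\<lambda>n. D (D (u n j)) \<theta>) \<longlonglongrightarrow> - of_real \<epsilon> * ?T"
      by (simp add: resid_def fun_apply)
    let ?c = "(\<Omega> / (h 0 * (s / 2)))\<^sup>2"
    have "(\<lambda>n. D (D (u n j)) \<theta> - D (D (W j)) \<theta>) \<longlonglongrightarrow> 0"
    proof (rule Lim_null_comparison[OF always_eventually], rule allI)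
      fix n
      have "norm (D (D (W j)) \<theta> - D (D (u n j)) \<theta>) \<le> ?c * N s (W j - u n j)"
        using s WA[of j] by (intro DD_diff_le) (auto intro: A_mono(1)[of _ "5/4 * s"] entireD u)
      also have "\<dots> \<le> ?c * R n"
        using order_trans[OF A_mono(2)[OF _ _ diffA] diffN, of s j n] s by (intro mult_left_mono) auto
      finally show "norm (D (D (u n j)) \<theta> - D (D (W j)) \<theta>) \<le> ?c * R n" by (simp add: norm_minus_commute)
      show "(\<lambda>n. ?c * R n) \<longlonglongrightarrow> 0" using tendsto_mult_left[OF R0, of ?c] by simp
    qed
    then have "(\<lambda>n. D (D (u n j)) \<theta>) \<longlonglongrightarrow> D (D (W j)) \<theta>" by (rule LIM_zero_cancel)
    with 1 show ?thesis using LIMSEQ_unique by blast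
  qed
  show ?thesis unfolding solution_profile_def using WA Wr WV eq by (intro exI[of _ W]) blast
qed

end

section \<open>Functions with values in the bounded sequences\<close>

lemma apply_Bcontfun_int:
  fixes f :: "int \<Rightarrow> 'a::real_normed_vector"
  assumes "\<And>j. norm (f j) \<le> c"
  shows "apply_bcontfun (Bcontfun f) = f"
  by (intro Bcontfun_inverse bcontfun_normI[of _ c] assms Topological_Spaces.continuous_on_discrete)

lemma bounded_linear_apply_bcontfun: "bounded_linear (\<lambda>f. apply_bcontfun (f :: int \<Rightarrow>\<^sub>C complex) j)"
  by (rule bounded_linear_intro[of _ 1]) (auto simp: norm_bounded)

text \<open>Evaluation at an index is a bounded linear map and reduces the claim to scalar functions.\<close>

lemma fourier_rep_linf_unique:
  assumes "fourier_rep_linf u U" "fourier_rep_linf u U'"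
  shows "U = U'"
proof
  fix \<nu>
  have rep: "represents (\<lambda>\<nu>. apply_bcontfun (X \<nu>) j) (\<lambda>\<phi>. complex_of_real (apply_bcontfun (u \<phi>) j))"
    if X: "fourier_rep_linf u X" for X j
  proof -
    have "abs_sum (\<lambda>\<nu>. apply_bcontfun (X \<nu>) j)" unfolding abs_sum_def
      by (rule Infinite_Sum.abs_summable_on_comparison_test'[of "\<lambda>\<nu>. norm (X \<nu>)"])
         (use X in \<open>auto simp: fourier_rep_linf_def norm_bounded\<close>)
    moreover have "((\<lambda>\<nu>. apply_bcontfun (X \<nu>) j * character \<nu> \<phi>) has_sum complex_of_real (apply_bcontfun (u \<phi>) j)) UNIV" for \<phi>
    proof -
      have "((\<lambda>\<nu>. linf_scale (character \<nu> \<phi>) (X \<nu>)) has_sum linf_of_real (u \<phi>)) UNIV"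
        using X by (simp add: fourier_rep_linf_def)
      from has_sum_bounded_linear[OF bounded_linear_apply_bcontfun[of j] this]
      show ?thesis by (simp add: linf_scale.rep_eq linf_of_real.rep_eq mult.commute)
    qed
    ultimately show ?thesis by (simp add: represents_def)
  qed
  have "(\<lambda>\<nu>. apply_bcontfun (U \<nu>) j) = (\<lambda>\<nu>. apply_bcontfun (U' \<nu>) j)" for j
    by (rule represents_unique[OF rep[OF assms(1)] rep[OF assms(2)]])
  then show "U \<nu> = U' \<nu>" by (intro bcontfun_eqI) meson
qed

lemma fourier_coeff_linf_eq: "fourier_rep_linf u U \<Longrightarrow> fourier_coeff_linf u = U"
  unfolding fourier_coeff_linf_def by (rule the_equality) (auto intro: fourier_rep_linf_unique)

lemma fourier_rep_represents:
  assumes "fourier_rep f F"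
  shows "represents F (\<lambda>\<theta>. complex_of_real (f \<theta>))"
  using assms by (simp add: fourier_rep_def represents_def abs_sum_def mult.commute)

lemma fourier_coeff_eq: "fourier_rep f F \<Longrightarrow> fourier_coeff f = F"
  unfolding fourier_coeff_def
  by (rule the_equality) (auto intro: represents_unique dest!: fourier_rep_represents)

context small_divisor_setting
begin

text \<open>The bounded-sequence-valued function, and its coefficients, assembled from scalar components;
  meaningful for \<open>admissible\<close> families, for which the sequences are bounded.\<close>

definition linf_fun :: "(int \<Rightarrow> tfun) \<Rightarrow> torus \<Rightarrow> linf_real" where
  "linf_fun W \<phi> = Bcontfun (\<lambda>j. Re (W j \<phi>))"

definition linf_coef :: "(int \<Rightarrow> tfun) \<Rightarrow> freq \<Rightarrow> linf_complex" where
  "linf_coef W \<nu> = Bcontfun (\<lambda>j. coef (W j) \<nu>)"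

text \<open>Summability over the index bounds the components uniformly and survives the interchange of
  sums over indices and frequencies.\<close>

definition admissible :: "real \<Rightarrow> real \<Rightarrow> (int \<Rightarrow> tfun) \<Rightarrow> bool" where
  "admissible \<sigma> B W \<longleftrightarrow> 0 \<le> \<sigma> \<and> (\<forall>j. W j \<in> A \<sigma> \<and> realv (W j)) \<and> (\<forall>J. finite J \<longrightarrow> VN \<sigma> J W \<le> B)"

lemma
  assumes "admissible \<sigma> B W"
  shows admissible_N: "N \<sigma> (W j) \<le> B"
    and apply_linf_fun: "apply_bcontfun (linf_fun W \<phi>) j = Re (W j \<phi>)"
    and apply_linf_coef: "apply_bcontfun (linf_coef W \<nu>) j = coef (W j) \<nu>"
proof -
  have \<sigma>: "0 \<le> \<sigma>" and W: "W j \<in> A \<sigma>" for j using assms by (auto simp: admissible_def)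
  have "VN \<sigma> {j} W \<le> B" for j using assms unfolding admissible_def by blast
  then show NB: "N \<sigma> (W j) \<le> B" for j by (simp add: VN_def)
  have "norm (Re (W j \<phi>)) \<le> B" for j
    using order_trans[OF norm_le_N[OF \<sigma> W] NB, of j \<phi>] abs_Re_le_cmod[of "W j \<phi>"] by simp
  from apply_Bcontfun_int[of "\<lambda>j. Re (W j \<phi>)", OF this]
  show "apply_bcontfun (linf_fun W \<phi>) j = Re (W j \<phi>)" by (simp add: linf_fun_def)
  have "norm (coef (W j) \<nu>) \<le> B" for j
  proof -
    have "norm (coef (W j) \<nu>) * 1 \<le> norm (coef (W j) \<nu>) * exp (\<sigma> * |\<nu>|\<^sub>h)"
      using \<sigma> by (intro mult_left_mono) auto
    also have "\<dots> \<le> N \<sigma> (W j)"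
      using finite_sum_le_has_sum[OF N_has_sum[OF W[of j]], of "{\<nu>}"] by simp
    finally show ?thesis using NB[of j] by simp
  qed
  from apply_Bcontfun_int[of "\<lambda>j. coef (W j) \<nu>", OF this]
  show "apply_bcontfun (linf_coef W \<nu>) j = coef (W j) \<nu>" by (simp add: linf_coef_def)
qed

text \<open>The supremum over the index is at most the sum over the index, and the sums may be interchanged.\<close>

lemma linf_coef_summable:
  assumes adm: "admissible \<sigma> B W"
  shows "(\<lambda>\<nu>. norm (linf_coef W \<nu>) * exp (\<sigma> * |\<nu>|\<^sub>h)) summable_on UNIV"
    and "(\<Sum>\<^sub>\<infinity>\<nu>. norm (linf_coef W \<nu>) * exp (\<sigma> * |\<nu>|\<^sub>h)) \<le> B"
proof -
  have \<sigma>: "0 \<le> \<sigma>" and W: "W j \<in> A \<sigma>" for j using assms by (auto simp: admissible_def)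
  have fb: "sum (\<lambda>j. N \<sigma> (W j)) J \<le> B" if "finite J" for J
    using adm that by (simp add: admissible_def VN_def)
  have sN: "(\<lambda>j. N \<sigma> (W j)) summable_on UNIV"
    by (rule nonneg_bdd_above_summable_on) (use fb in \<open>auto intro!: bdd_aboveI2[of _ _ B]\<close>)
  have iN: "infsum (\<lambda>j. N \<sigma> (W j)) UNIV \<le> B"
    by (rule infsum_le_finite_sums[OF sN]) (use fb in auto)
  let ?f = "\<lambda>j \<nu>. norm (coef (W j) \<nu>) * exp (\<sigma> * |\<nu>|\<^sub>h)"
  define p where "p = (\<lambda>\<nu>. \<Sum>\<^sub>\<infinity>j. ?f j \<nu>)"
  have f0: "0 \<le> ?f j \<nu>" for j \<nu> by simp
  note dbl = nonneg_double_sum[OF f0 N_has_sum[OF W] has_sum_infsum[OF sN]]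
  have pin: "((\<lambda>j. ?f j \<nu>) has_sum p \<nu>) UNIV" for \<nu> unfolding p_def by (rule dbl(2))
  have p: "(p has_sum infsum (\<lambda>j. N \<sigma> (W j)) UNIV) UNIV" unfolding p_def by (rule dbl(3))
  have le: "norm (linf_coef W \<nu>) * exp (\<sigma> * |\<nu>|\<^sub>h) \<le> p \<nu>" for \<nu>
  proof -
    have "norm (apply_bcontfun (linf_coef W \<nu>) j) \<le> p \<nu> / exp (\<sigma> * |\<nu>|\<^sub>h)" for j
      using finite_sum_le_has_sum[OF pin[of \<nu>], of "{j}"] by (simp add: apply_linf_coef[OF adm] field_simps)
    then have "norm (linf_coef W \<nu>) \<le> p \<nu> / exp (\<sigma> * |\<nu>|\<^sub>h)" by (rule norm_bound)
    then show ?thesis by (simp add: field_simps)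
  qed
  show 1: "(\<lambda>\<nu>. norm (linf_coef W \<nu>) * exp (\<sigma> * |\<nu>|\<^sub>h)) summable_on UNIV"
    by (rule summable_on_comparison_test[OF has_sum_imp_summable[OF p] le]) auto
  show "(\<Sum>\<^sub>\<infinity>\<nu>. norm (linf_coef W \<nu>) * exp (\<sigma> * |\<nu>|\<^sub>h)) \<le> B"
    using has_sum_mono[OF has_sum_infsum[OF 1] p le] iN by linarith
qed

text \<open>Convergence in the supremum norm: the distance of a finite partial sum from the function is, in
  each component, at most the sum of the remaining norms.\<close>

lemma linf_rep:
  assumes adm: "admissible \<sigma> B W"
  shows "fourier_rep_linf (linf_fun W) (linf_coef W)"
proof -
  have \<sigma>: "0 \<le> \<sigma>" and W: "W j \<in> A \<sigma>" "realv (W j)" for j using assms by (auto simp: admissible_def)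
  have s: "(\<lambda>\<nu>. norm (linf_coef W \<nu>)) summable_on UNIV"
    by (rule Infinite_Sum.abs_summable_on_comparison_test'[OF linf_coef_summable(1)[OF adm]])
       (use \<sigma> in \<open>auto intro!: mult_le_cancel_left1[THEN iffD2]\<close>)
  have sym: "linf_coef W (- \<nu>) = linf_cnj (linf_coef W \<nu>)" for \<nu>
    by (rule bcontfun_eqI) (simp add: linf_cnj.rep_eq apply_linf_coef[OF adm] coef_real[OF W])
  have "((\<lambda>\<nu>. linf_scale (character \<nu> \<phi>) (linf_coef W \<nu>)) has_sum linf_of_real (linf_fun W \<phi>)) UNIV" for \<phi>
  proof -
    let ?g = "\<lambda>\<nu>. linf_scale (character \<nu> \<phi>) (linf_coef W \<nu>)" and ?n = "\<lambda>\<nu>. norm (linf_coef W \<nu>)"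
    let ?L = "linf_of_real (linf_fun W \<phi>)"
    have bound: "norm (sum ?g X - ?L) \<le> infsum ?n UNIV - sum ?n X" if X: "finite X" for X
    proof (rule norm_bound)
      fix j
      let ?t = "\<lambda>\<nu>. character \<nu> \<phi> * coef (W j) \<nu>"
      interpret ap: bounded_linear "\<lambda>f. apply_bcontfun (f :: linf_complex) j" by (rule bounded_linear_apply_bcontfun)
      have L: "apply_bcontfun ?L j = W j \<phi>"
        using W(2)[of j] by (simp add: linf_of_real.rep_eq apply_linf_fun[OF adm] realv_def complex_eq_iff)
      have g: "apply_bcontfun (sum ?g X) j = sum ?t X"
        by (simp add: ap.sum linf_scale.rep_eq apply_linf_coef[OF adm])
      have "((\<lambda>\<nu>. if \<nu> \<in> X then ?t \<nu> else 0) has_sum sum ?t X) UNIV"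
        using X by (intro has_sum_finite_neutralI[of X]) auto
      moreover have "(?t has_sum W j \<phi>) UNIV"
        using A_has_sum[OF W(1)[of j], of \<phi>] by (simp add: mult.commute)
      ultimately have t: "((\<lambda>\<nu>. (if \<nu> \<in> X then ?t \<nu> else 0) - ?t \<nu>) has_sum sum ?t X - W j \<phi>) UNIV"
        by (rule has_sum_diff)
      have "((\<lambda>\<nu>. if \<nu> \<in> X then ?n \<nu> else 0) has_sum sum ?n X) UNIV"
        using X by (intro has_sum_finite_neutralI[of X]) auto
      from has_sum_diff[OF has_sum_infsum[OF s] this]
      have n: "((\<lambda>\<nu>. ?n \<nu> - (if \<nu> \<in> X then ?n \<nu> else 0)) has_sum infsum ?n UNIV - sum ?n X) UNIV" .
      have "norm (?t \<nu>) \<le> ?n \<nu>" for \<nu>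
        using norm_bounded[of "linf_coef W \<nu>" j] by (simp add: norm_mult apply_linf_coef[OF adm])
      then have "norm ((if \<nu> \<in> X then ?t \<nu> else 0) - ?t \<nu>) \<le> ?n \<nu> - (if \<nu> \<in> X then ?n \<nu> else 0)" for \<nu>
        by simp
      then have "norm (sum ?t X - W j \<phi>) \<le> infsum ?n UNIV - sum ?n X"
        by (intro norm_infsum_le[OF t n]) auto
      then show "norm (apply_bcontfun (sum ?g X - ?L) j) \<le> infsum ?n UNIV - sum ?n X"
        by (simp add: ap.diff g L)
    qed
    have "((\<lambda>X. infsum ?n UNIV - sum ?n X) \<longlongrightarrow> infsum ?n UNIV - infsum ?n UNIV) (finite_subsets_at_top UNIV)"
      by (intro tendsto_diff tendsto_const infsum_tendsto s)
    then have lim: "((\<lambda>X. infsum ?n UNIV - sum ?n X) \<longlongrightarrow> 0) (finite_subsets_at_top UNIV)" by simp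
    have "((\<lambda>X. sum ?g X - ?L) \<longlongrightarrow> 0) (finite_subsets_at_top UNIV)"
      by (rule Lim_null_comparison[OF _ lim]) (use bound in \<open>auto intro: eventually_finite_subsets_at_top_weakI\<close>)
    then show ?thesis unfolding has_sum_def by (rule LIM_zero_cancel)
  qed
  with s sym show ?thesis by (simp add: fourier_rep_linf_def)
qed

lemma admissible_mono: "admissible \<tau> B W \<Longrightarrow> 0 \<le> \<sigma> \<Longrightarrow> \<sigma> \<le> \<tau> \<Longrightarrow> admissible \<sigma> B W"
  unfolding admissible_def VN_def
  by (meson A_mono order_trans sum_mono)

lemma admissible_D:
  assumes adm: "admissible (\<sigma> + \<delta>) B W" and "0 \<le> \<sigma>" "0 < \<delta>"
  shows "admissible \<sigma> (\<Omega> / (h 0 * \<delta>) * B) (\<lambda>j. D (W j))"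
proof -
  have W: "W j \<in> A (\<sigma> + \<delta>)" "realv (W j)" for j using adm by (auto simp: admissible_def)
  note DW = N_D[OF assms(2,3) W(1)]
  have c: "0 \<le> \<Omega> / (h 0 * \<delta>)" using Omega_nonneg assms by (intro divide_nonneg_pos) auto
  have "realv (D (W j))" for j
  proof (rule real_coefI[OF _ A_has_sum[OF DW(1)]])
    show "coef (D (W j)) (- \<nu>) = cnj (coef (D (W j)) \<nu>)" for \<nu>
      by (simp add: DW(2) coef_real[OF W] freq_dot_uminus)
  qed
  moreover have "VN \<sigma> J (\<lambda>j. D (W j)) \<le> \<Omega> / (h 0 * \<delta>) * B" if "finite J" for J
  proof -
    have "VN \<sigma> J (\<lambda>j. D (W j)) \<le> \<Omega> / (h 0 * \<delta>) * VN (\<sigma> + \<delta>) J W" by (rule VN_le[OF DW(3)])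
    also have "\<dots> \<le> \<Omega> / (h 0 * \<delta>) * B" using adm that c by (intro mult_left_mono) (auto simp: admissible_def)
    finally show ?thesis .
  qed
  ultimately show ?thesis using assms(2) DW(1) by (simp add: admissible_def)
qed

lemma omega_deriv_linf_fun:
  assumes adm: "admissible (\<sigma> + \<delta>) B W" and "0 \<le> \<sigma>" "0 < \<delta>"
  shows "omega_deriv \<omega> (linf_fun W) = linf_fun (\<lambda>j. D (W j))"
proof
  fix \<phi>
  note admD = admissible_D[OF assms]
  have W: "W j \<in> A (\<sigma> + \<delta>)" for j using adm by (auto simp: admissible_def)
  have fc: "fourier_coeff_linf (linf_fun W) = linf_coef W" by (rule fourier_coeff_linf_eq[OF linf_rep[OF adm]])
  have eq: "linf_scale (\<i> * of_real (freq_dot \<omega> \<nu>) * character \<nu> \<phi>) (linf_coef W \<nu>)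
      = linf_scale (character \<nu> \<phi>) (linf_coef (\<lambda>j. D (W j)) \<nu>)" for \<nu>
    by (rule bcontfun_eqI)
       (simp add: linf_scale.rep_eq apply_linf_coef[OF adm] apply_linf_coef[OF admD] N_D(2)[OF assms(2,3) W] mult_ac)
  have "infsum (\<lambda>\<nu>. linf_scale (character \<nu> \<phi>) (linf_coef (\<lambda>j. D (W j)) \<nu>)) UNIV = linf_of_real (linf_fun (\<lambda>j. D (W j)) \<phi>)"
    using linf_rep[OF admD] by (intro infsumI) (simp add: fourier_rep_linf_def)
  moreover have "linf_Re (linf_of_real x) = x" for x
    by (rule bcontfun_eqI) (simp add: linf_Re.rep_eq linf_of_real.rep_eq)
  ultimately show "omega_deriv \<omega> (linf_fun W) \<phi> = linf_fun (\<lambda>j. D (W j)) \<phi>"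
    by (simp add: omega_deriv_def fc eq)
qed

section \<open>Existence of almost-periodic solutions\<close>

text \<open>The size \<open>\<eta>\<close> of the first residual is a free parameter above \<open>C \<bar>\<epsilon>\<bar>\<close>.  How small \<open>\<eta>\<close> must be depends on
  \<open>f\<close> only through its norm.\<close>

lemma quasiperiodic_solution:
  assumes s: "0 < s" and bry: "star_bryuno h \<omega>" and M: "0 \<le> M"
  shows "\<exists>\<eta>1>0. \<forall>f\<in>H_star h (2 * s). H_star_norm h (2 * s) f = M \<longrightarrow>
    (\<forall>\<eta> \<epsilon>. 0 < \<eta> \<longrightarrow> \<eta> \<le> \<eta>1 \<longrightarrow> \<bar>\<epsilon>\<bar> \<le> 1 \<longrightarrow> \<bar>\<epsilon>\<bar> * (4 / (s * h 0) * M) \<le> \<eta> \<longrightarrow>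
      (\<exists>u\<in>H_star_linf h s. H_star_linf_norm h s u \<le> 9 * sqrt \<eta> \<and>
        (\<forall>\<phi> j. apply_bcontfun (omega_deriv \<omega> (omega_deriv \<omega> u) \<phi>) j =
                  - \<epsilon> * torus_grad f (torus_translate \<phi> (u \<phi>)) j)))"
proof -
  obtain b where b: "\<And>m. real m + 1 \<le> b m" "summable (\<lambda>m. b m / 2 ^ m)"
    "\<And>m \<nu>. \<nu> \<noteq> 0 \<Longrightarrow> |\<nu>|\<^sub>h \<le> 2 ^ m \<Longrightarrow> exp (- b m) \<le> \<bar>freq_dot \<omega> \<nu>\<bar>"
    using bryuno_exponents[OF star_weight bry] by auto
  have \<kappa>: "0 < min (s / 8) 1" using s by simp
  obtain E0 where E0: "\<And>E. E0 \<le> E \<Longrightarrow> \<exists>m :: nat \<Rightarrow> nat. \<forall>n. 16 * b (m n) \<le> E * (3/2) ^ n \<and>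
     (\<Sum>k<n. E * (3/2) ^ k / 2 ^ m k) \<le> min (s / 8) 1"
    using cutoff_schedule[OF b(1,2) \<kappa>] by auto
  define c where "c = min (s * h 0 / 72) (h 0 / 72)"
  have c: "0 < c" using s by (simp add: c_def)
  \<comment> \<open>thresholds: the schedule, the constants of one step, and the smallness of u and its Jacobian\<close>
  define E1 where "E1 = max (max E0 2) (max (8 * ln (max 1 (step_const s M))) (- 2 * ln c))"
  show ?thesis
  proof (intro exI[of _ "exp (- E1)"] conjI ballI impI allI)
    fix f \<eta> \<epsilon>
    assume f: "f \<in> H_star h (2 * s)" "H_star_norm h (2 * s) f = M" and \<eta>: "0 < \<eta>" "\<eta> \<le> exp (- E1)"
      and \<epsilon>: "\<bar>\<epsilon>\<bar> \<le> 1" "\<bar>\<epsilon>\<bar> * (4 / (s * h 0) * M) \<le> \<eta>"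
    obtain F where F: "fourier_rep f F" "(\<lambda>\<nu>. norm (F \<nu>) * exp (2 * s * |\<nu>|\<^sub>h)) summable_on UNIV"
      using f(1) by (auto simp: H_star_def)
    have fF: "fourier_coeff f = F" by (rule fourier_coeff_eq[OF F(1)])
    have FM: "(\<Sum>\<^sub>\<infinity>\<nu>. norm (F \<nu>) * exp (2 * s * |\<nu>|\<^sub>h)) \<le> M" using f(2) by (simp add: H_star_norm_def fF)
    have Fs: "F (- \<nu>) = cnj (F \<nu>)" for \<nu> using F(1) by (simp add: fourier_rep_def)
    define E where "E = - ln \<eta>"
    have E\<eta>: "exp (- E) = \<eta>" using \<eta> by (simp add: E_def)
    have EE: "E1 \<le> E" 
    proof -
      have "ln \<eta> \<le> ln (exp (- E1))" using \<eta> by (subst ln_le_cancel_iff) auto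
      then show ?thesis by (simp add: E_def)
    qed
    then have E: "E0 \<le> E" "2 \<le> E" "8 * ln (max 1 (step_const s M)) \<le> E" "- 2 * ln c \<le> E"
      by (auto simp: E1_def)
    have "exp (- E / 2) \<le> exp (ln c)" using E(4) by (subst exp_le_cancel_iff) simp
    then have ec: "exp (- E / 2) \<le> c" using c by simp
    have e1: "9 * exp (- E / 2) \<le> s * h 0 / 8" using ec by (simp add: c_def)
    have e2: "9 / h 0 * exp (- E / 2) \<le> 1 / 8"
    proof -
      have "9 / h 0 * exp (- E / 2) \<le> 9 / h 0 * (h 0 / 72)"
        using ec by (intro mult_left_mono) (auto simp: c_def less_imp_le)
      also have "\<dots> = 1 / 8" using less_imp_neq[OF h0_pos] by simp
      finally show ?thesis .
    qed
    obtain m where m: "\<And>n. 16 * b (m n) \<le> E * (3/2) ^ n" "\<And>n. (\<Sum>k<n. E * (3/2) ^ k / 2 ^ m k) \<le> min (s / 8) 1"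
      using E0[OF E(1)] by blast
    have b': "real m \<le> b m" for m using b(1)[of m] by simp
    have \<epsilon>': "\<bar>\<epsilon>\<bar> * (4 / (s * h 0) * M) \<le> exp (- E)" using \<epsilon>(2) E\<eta> by simp
    have "\<exists>u S. newton_sequence_for F s \<epsilon> E u S"
      by (rule newton_sequence[where M = M and b = b and m = m])
        (rule s Fs F(2) FM \<epsilon>(1) \<epsilon>' b' E(2) E(3) e1 e2 m b(3); assumption)+
    then obtain u S where "newton_sequence_for F s \<epsilon> E u S" by blast
    from limit_solution[OF s F(2) E(2) this] obtain W where P: "solution_profile F s \<epsilon> (9 * exp (- E / 2)) W" ..
    note W = P[unfolded solution_profile_def, THEN conjunct1, rule_format, THEN conjunct1]
      P[unfolded solution_profile_def, THEN conjunct1, rule_format, THEN conjunct2]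
      P[unfolded solution_profile_def, THEN conjunct2, THEN conjunct1, rule_format]
      P[unfolded solution_profile_def, THEN conjunct2, THEN conjunct2, rule_format]
    let ?B = "9 * exp (- E / 2)" and ?d = "5/8 * s"
    have adm: "admissible (?d + ?d) ?B W" using W s by (auto simp: admissible_def)
    have adms: "admissible s ?B W" using s by (intro admissible_mono[OF adm]) auto
    have d: "0 \<le> ?d" "0 < ?d" using s by auto
    note adm1 = admissible_D[OF adm d]
    let ?u = "linf_fun W"
    have u1: "omega_deriv \<omega> ?u = linf_fun (\<lambda>j. D (W j))" by (rule omega_deriv_linf_fun[OF adm d])
    have adm1': "admissible (0 + ?d) (\<Omega> / (h 0 * ?d) * ?B) (\<lambda>j. D (W j))" using adm1 by simp
    note adm2 = admissible_D[OF adm1' order_refl d(2)]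
    have u2: "omega_deriv \<omega> (omega_deriv \<omega> ?u) = linf_fun (\<lambda>j. D (D (W j)))"
      unfolding u1 by (rule omega_deriv_linf_fun[OF adm1' order_refl d(2)])
    have rep: "fourier_rep_linf ?u (linf_coef W)" by (rule linf_rep[OF adms])
    have "?u \<in> H_star_linf h s"
      unfolding H_star_linf_def using rep linf_coef_summable(1)[OF adms] by blast
    moreover have "H_star_linf_norm h s ?u \<le> 9 * sqrt \<eta>"
    proof -
      have "H_star_linf_norm h s ?u \<le> ?B"
        using linf_coef_summable(2)[OF adms] by (simp add: H_star_linf_norm_def fourier_coeff_linf_eq[OF rep])
      also have "exp (- E / 2) = sqrt \<eta>"
        unfolding E\<eta>[symmetric] by (rule real_sqrt_unique[symmetric]) (simp_all flip: exp_of_nat_mult)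
      finally show ?thesis .
    qed
    moreover have "apply_bcontfun (omega_deriv \<omega> (omega_deriv \<omega> ?u) \<phi>) j =
                  - \<epsilon> * torus_grad f (torus_translate \<phi> (?u \<phi>)) j" for \<phi> j
    proof -
      have tt: "torus_translate \<phi> (?u \<phi>) = rotate_torus \<phi> (\<lambda>k. Re (W k \<phi>))"
        by (simp add: torus_translate_def rotate_torus_def apply_linf_fun[OF adms])
      have "apply_bcontfun (omega_deriv \<omega> (omega_deriv \<omega> ?u) \<phi>) j = Re (D (D (W j)) \<phi>)"
        unfolding u2 by (rule apply_linf_fun[OF adm2])
      also have "\<dots> = - \<epsilon> * Re (\<Sum>\<^sub>\<infinity>\<nu>. F \<nu> * (\<i> * of_int (lk \<nu> j)) * character \<nu> (rotate_torus \<phi> (\<lambda>k. Re (W k \<phi>))))"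
        unfolding W(4) by simp
      finally show ?thesis by (simp add: torus_grad_def fF tt mult_ac)
    qed
    ultimately show "\<exists>u\<in>H_star_linf h s. H_star_linf_norm h s u \<le> 9 * sqrt \<eta> \<and>
        (\<forall>\<phi> j. apply_bcontfun (omega_deriv \<omega> (omega_deriv \<omega> u) \<phi>) j =
                  - \<epsilon> * torus_grad f (torus_translate \<phi> (u \<phi>)) j)" by blast
  qed simp
qed

end

theorem proposition2p9:
  fixes h \<omega> :: "int \<Rightarrow> real" and q s M :: real
  assumes "star_weight h"
    and "q > 1 / 2" and "s > 0"
    and "\<omega> \<in> ell_infty q"
    and "star_bryuno h \<omega>"
  shows "\<exists>\<epsilon>\<^sub>1>0. \<forall>f \<in> H_star h (2 * s). H_star_norm h (2 * s) f = M \<longrightarrow>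
    (\<exists>u :: real \<Rightarrow> torus \<Rightarrow> linf_real.
       (\<forall>\<epsilon> \<in> {- \<epsilon>\<^sub>1<..<\<epsilon>\<^sub>1}.
          u \<epsilon> \<in> H_star_linf h s \<and>
          (\<forall>\<phi> j. apply_bcontfun (omega_deriv \<omega> (omega_deriv \<omega> (u \<epsilon>)) \<phi>) j =
                  - \<epsilon> * torus_grad f (torus_translate \<phi> (u \<epsilon> \<phi>)) j)) \<and>
       ((\<lambda>\<epsilon>. H_star_linf_norm h s (u \<epsilon>)) \<longlongrightarrow> 0) (at 0))"
proof (cases "0 \<le> M")
  case False
  have "H_star_norm h (2 * s) f \<noteq> M" for f
  proof -
    have "0 \<le> H_star_norm h (2 * s) f" unfolding H_star_norm_def by (intro infsum_nonneg) auto
    with False show ?thesis by linarith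
  qed
  then show ?thesis by (intro exI[of _ 1]) auto
next
  case True
  obtain \<Omega> where \<Omega>: "\<And>j. \<bar>\<omega> j\<bar> * max 1 \<bar>real_of_int j\<bar> powr q \<le> \<Omega>"
    using assms(4) by (auto simp: ell_infty_def bdd_above_def)
  have "\<bar>\<omega> j\<bar> \<le> \<Omega>" for j
  proof -
    have "1 \<le> max 1 \<bar>real_of_int j\<bar> powr q" using assms(2) by (intro ge_one_powr_ge_zero) auto
    then have "\<bar>\<omega> j\<bar> * 1 \<le> \<bar>\<omega> j\<bar> * max 1 \<bar>real_of_int j\<bar> powr q" by (intro mult_left_mono) auto
    with \<Omega>[of j] show ?thesis by simp
  qed
  then interpret small_divisor_setting h \<omega> \<Omega> using assms(1) by unfold_locales auto
  obtain \<eta>1 where \<eta>1: "0 < \<eta>1" and sol: "\<And>f \<eta> \<epsilon>. f \<in> H_star h (2 * s) \<Longrightarrow> H_star_norm h (2 * s) f = M \<Longrightarrow>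
      0 < \<eta> \<Longrightarrow> \<eta> \<le> \<eta>1 \<Longrightarrow> \<bar>\<epsilon>\<bar> \<le> 1 \<Longrightarrow> \<bar>\<epsilon>\<bar> * (4 / (s * h 0) * M) \<le> \<eta> \<Longrightarrow>
      \<exists>u\<in>H_star_linf h s. H_star_linf_norm h s u \<le> 9 * sqrt \<eta> \<and>
        (\<forall>\<phi> j. apply_bcontfun (omega_deriv \<omega> (omega_deriv \<omega> u) \<phi>) j =
                  - \<epsilon> * torus_grad f (torus_translate \<phi> (u \<phi>)) j)"
    using quasiperiodic_solution[OF assms(3,5) True] by blast
  define C where "C = 4 / (s * h 0) * M + 1"
  have C: "0 < C" "4 / (s * h 0) * M \<le> C" using True assms(3) by (auto simp: C_def add_nonneg_pos less_imp_le)
  define \<epsilon>1 where "\<epsilon>1 = min 1 (\<eta>1 / C)"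
  have \<epsilon>1: "0 < \<epsilon>1" using \<eta>1 C by (simp add: \<epsilon>1_def)
  \<comment> \<open>the bound on the first residual has to be positive, also for epsilon = 0, where the limit does not see it\<close>
  define size where "size = (\<lambda>\<epsilon>. if \<epsilon> = 0 then \<eta>1 else C * \<bar>\<epsilon>\<bar>)"
  show ?thesis
  proof (intro exI[of _ \<epsilon>1] conjI ballI impI \<epsilon>1)
    fix f assume f: "f \<in> H_star h (2 * s)" "H_star_norm h (2 * s) f = M"
    have "\<exists>u. u \<in> H_star_linf h s \<and> H_star_linf_norm h s u \<le> 9 * sqrt (size \<epsilon>) \<and>
        (\<forall>\<phi> j. apply_bcontfun (omega_deriv \<omega> (omega_deriv \<omega> u) \<phi>) j =
                  - \<epsilon> * torus_grad f (torus_translate \<phi> (u \<phi>)) j)" if \<epsilon>: "\<epsilon> \<in> {- \<epsilon>1<..<\<epsilon>1}" for \<epsilon>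
    proof -
      have \<epsilon>': "\<bar>\<epsilon>\<bar> \<le> 1" "\<bar>\<epsilon>\<bar> \<le> \<eta>1 / C" using \<epsilon> by (auto simp: \<epsilon>1_def)
      have "0 < size \<epsilon>" "size \<epsilon> \<le> \<eta>1" using \<epsilon>'(2) \<eta>1 C by (auto simp: size_def field_simps)
      moreover have "\<bar>\<epsilon>\<bar> * (4 / (s * h 0) * M) \<le> size \<epsilon>"
        using mult_left_mono[OF C(2), of "\<bar>\<epsilon>\<bar>"] \<eta>1 by (auto simp: size_def mult.commute)
      ultimately show ?thesis using sol[OF f _ _ \<epsilon>'(1)] by blast
    qed
    then obtain u where u: "\<And>\<epsilon>. \<epsilon> \<in> {- \<epsilon>1<..<\<epsilon>1} \<Longrightarrow> u \<epsilon> \<in> H_star_linf h s \<and> H_star_linf_norm h s (u \<epsilon>) \<le> 9 * sqrt (size \<epsilon>) \<and>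
        (\<forall>\<phi> j. apply_bcontfun (omega_deriv \<omega> (omega_deriv \<omega> (u \<epsilon>)) \<phi>) j =
                  - \<epsilon> * torus_grad f (torus_translate \<phi> (u \<epsilon> \<phi>)) j)"
      by metis
    have "((\<lambda>\<epsilon>. 9 * sqrt (C * \<bar>\<epsilon>\<bar>)) \<longlongrightarrow> 9 * sqrt (C * \<bar>0\<bar>)) (at 0)"
      by (intro tendsto_intros)
    then have lim: "((\<lambda>\<epsilon>. 9 * sqrt (C * \<bar>\<epsilon>\<bar>)) \<longlongrightarrow> 0) (at 0)" by simp
    have "eventually (\<lambda>\<epsilon>. \<epsilon> \<in> {- \<epsilon>1<..<\<epsilon>1}) (at 0)"
      using \<epsilon>1 by (intro eventually_at_in_open') auto
    moreover have "eventually (\<lambda>\<epsilon>::real. \<epsilon> \<noteq> 0) (at 0)" by (simp add: eventually_at_filter)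
    ultimately have "eventually (\<lambda>\<epsilon>. norm (H_star_linf_norm h s (u \<epsilon>)) \<le> 9 * sqrt (C * \<bar>\<epsilon>\<bar>)) (at 0)"
    proof eventually_elim
      case (elim \<epsilon>)
      have "0 \<le> H_star_linf_norm h s (u \<epsilon>)" unfolding H_star_linf_norm_def by (intro infsum_nonneg) auto
      with u[OF elim(1)] elim(2) show ?case by (simp add: size_def)
    qed
    from Lim_null_comparison[OF this lim]
    have "((\<lambda>\<epsilon>. H_star_linf_norm h s (u \<epsilon>)) \<longlongrightarrow> 0) (at 0)" .
    with u show "\<exists>u :: real \<Rightarrow> torus \<Rightarrow> linf_real.
       (\<forall>\<epsilon> \<in> {- \<epsilon>1<..<\<epsilon>1}.
          u \<epsilon> \<in> H_star_linf h s \<and>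
          (\<forall>\<phi> j. apply_bcontfun (omega_deriv \<omega> (omega_deriv \<omega> (u \<epsilon>)) \<phi>) j =
                  - \<epsilon> * torus_grad f (torus_translate \<phi> (u \<epsilon> \<phi>)) j)) \<and>
       ((\<lambda>\<epsilon>. H_star_linf_norm h s (u \<epsilon>)) \<longlongrightarrow> 0) (at 0)" by blast
  qed
qed

end
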